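(* Let $G$ be a group (not necessarily countable), and let $P\in LO(G)$ be an isolated point of the space $LO(G)$, with associated left ordering $<$ of $G$. Then $B_<(G)$ is abelian of rank one, and $C_<(G)$ is non-trivial and admits only finitely many left orderings.
   Context: A left ordering of a group $G$ is a strict total ordering $<$ of $G$ such that $g<h$ implies $fg<fh$ for all $f,g,h\in G$. Its positive cone is $P=\{g\in G: g>1\}$. Positive cones are exactly the subsets $P\subset G$ with $PP\subset P$ such that for every $g\in G$ exactly one of $g\in P$, $g^{-1}\in P$, $g=1$ holds; the associated ordering is $g<h$ iff $g^{-1}h\in P$. $LO(G)\subset 2^G$ is the set of all positive cones of $G$, with the subspace topology from the product topology on $2^G$; a subbasis is given by the sets $U_g=\{P\in LO(G): g\in P\}$, $g\in G$. A left ordering is a bi-ordering if also $g<h$ implies $gf<hf$ for all $f,g,h$. A left ordering is Conradian if for all $g,h>1$ there is $n\in\mathbb{N}$ with $g<hg^n$. A subgroup $C$ of $(G,<)$ is convex if $f,h\in C$, $g\in G$ and $f<g<h$ imply $g\in C$. $C_<(G)$ (the Conradian soul) denotes the largest convex subgroup $C\subset G$ such that the restriction of $<$ to $C$ is Conradian. $B_<(G)$ denotes the largest convex subgroup $C\subset G$ such that the restriction of $<$ to $C$ is a bi-ordering. The rank of a torsion-free abelian group $A$ is $\dim_{\mathbb{Q}}(A\otimes\mathbb{Q})$.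
   Formalization: The group G is assumed to be non-trivial; for the trivial group LO(G) is a single isolated point, but B_<(G) has rank zero and C_<(G) is trivial, so the claim as stated fails. *)

theory Defs
  imports
    "HOL-Analysis.Function_Topology"
    "HOL-Algebra.Free_Abelian_Groups"
    "Jordan_Normal_Form.VS_Connect"
begin

subsection \<open>Left orderings and positive cones\<close>

text \<open>
  An ordering is the set of pairs \<open>(g, h)\<close> with \<open>g < h\<close>. It is required to be contained in
  \<open>carrier G \<times> carrier G\<close>, so that distinct sets of pairs are distinct orderings of \<open>G\<close>.
\<close>

definition left_ordering :: "('a, 'b) monoid_scheme \<Rightarrow> 'a rel \<Rightarrow> bool" where
  "left_ordering G r \<longleftrightarrow>
     r \<subseteq> carrier G \<times> carrier G \<and> irrefl r \<and> trans r \<and> total_on (carrier G) r \<and>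
     (\<forall>f\<in>carrier G. \<forall>g\<in>carrier G. \<forall>h\<in>carrier G.
        (g, h) \<in> r \<longrightarrow> (f \<otimes>\<^bsub>G\<^esub> g, f \<otimes>\<^bsub>G\<^esub> h) \<in> r)"

definition bi_ordering :: "('a, 'b) monoid_scheme \<Rightarrow> 'a rel \<Rightarrow> bool" where
  "bi_ordering G r \<longleftrightarrow>
     left_ordering G r \<and>
     (\<forall>f\<in>carrier G. \<forall>g\<in>carrier G. \<forall>h\<in>carrier G.
        (g, h) \<in> r \<longrightarrow> (g \<otimes>\<^bsub>G\<^esub> f, h \<otimes>\<^bsub>G\<^esub> f) \<in> r)"

definition positive_cone :: "('a, 'b) monoid_scheme \<Rightarrow> 'a rel \<Rightarrow> 'a set" where
  "positive_cone G r = {g \<in> carrier G. (\<one>\<^bsub>G\<^esub>, g) \<in> r}"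

text \<open>
  Allowing \<open>n = 0\<close> below is harmless: if \<open>1 < g < h\<close> then
  \<open>1 < g\<inverse>h < (g\<inverse>h)g\<close>, hence \<open>g < hg\<close>.
\<close>

definition Conradian_ordering :: "('a, 'b) monoid_scheme \<Rightarrow> 'a rel \<Rightarrow> bool" where
  "Conradian_ordering G r \<longleftrightarrow>
     left_ordering G r \<and>
     (\<forall>g\<in>positive_cone G r. \<forall>h\<in>positive_cone G r.
        \<exists>n::nat. (g, h \<otimes>\<^bsub>G\<^esub> g [^]\<^bsub>G\<^esub> n) \<in> r)"

definition cone_ordering :: "('a, 'b) monoid_scheme \<Rightarrow> 'a set \<Rightarrow> 'a rel" where
  "cone_ordering G P =
     {(g, h). g \<in> carrier G \<and> h \<in> carrier G \<and> inv\<^bsub>G\<^esub> g \<otimes>\<^bsub>G\<^esub> h \<in> P}"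


subsection \<open>The space of left orderings\<close>

definition LO :: "('a, 'b) monoid_scheme \<Rightarrow> 'a set set" where
  "LO G = {positive_cone G r | r. left_ordering G r}"

lemma cone_ordering_positive_cone:
  assumes "Group.group G" and "left_ordering G r"
  shows "cone_ordering G (positive_cone G r) = r"
proof -
  interpret G: Group.group G by fact
  have r: "r \<subseteq> carrier G \<times> carrier G" 
    and inv: "\<And>f g h. f \<in> carrier G \<Longrightarrow> (g, h) \<in> r \<Longrightarrow> (f \<otimes>\<^bsub>G\<^esub> g, f \<otimes>\<^bsub>G\<^esub> h) \<in> r"
    using assms(2) by (auto simp: left_ordering_def)
  have "(\<one>\<^bsub>G\<^esub>, inv\<^bsub>G\<^esub> g \<otimes>\<^bsub>G\<^esub> h) \<in> r \<longleftrightarrow> (g, h) \<in> r" if gh: "g \<in> carrier G" "h \<in> carrier G" for g h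
  proof
    assume "(\<one>\<^bsub>G\<^esub>, inv\<^bsub>G\<^esub> g \<otimes>\<^bsub>G\<^esub> h) \<in> r"
    from inv[OF gh(1) this] show "(g, h) \<in> r"
      using gh by (simp add: G.m_assoc[symmetric])
  next
    assume "(g, h) \<in> r"
    from inv[OF G.inv_closed[OF gh(1)] this] show "(\<one>\<^bsub>G\<^esub>, inv\<^bsub>G\<^esub> g \<otimes>\<^bsub>G\<^esub> h) \<in> r"
      using gh by simp
  qed
  then show ?thesis
    using r by (auto simp: cone_ordering_def positive_cone_def)
qed

lemma LO_iff:
  assumes "Group.group G"
  shows "P \<in> LO G \<longleftrightarrow>
    P \<subseteq> carrier G \<and> (\<forall>g\<in>P. \<forall>h\<in>P. g \<otimes>\<^bsub>G\<^esub> h \<in> P) \<and> \<one>\<^bsub>G\<^esub> \<notin> P \<and>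
    (\<forall>g\<in>carrier G. g \<noteq> \<one>\<^bsub>G\<^esub> \<longrightarrow> (g \<in> P \<longleftrightarrow> inv\<^bsub>G\<^esub> g \<notin> P))" (is "_ \<longleftrightarrow> ?cone P")
proof
  interpret G: Group.group G by fact
  assume "P \<in> LO G"
  then obtain r where r: "left_ordering G r" and P: "P = positive_cone G r"
    by (auto simp: LO_def)
  have sub: "r \<subseteq> carrier G \<times> carrier G" and irr: "\<And>x. (x, x) \<notin> r" and tr: "trans r"
    and tot: "\<And>x y. x \<in> carrier G \<Longrightarrow> y \<in> carrier G \<Longrightarrow> x \<noteq> y \<Longrightarrow> (x, y) \<in> r \<or> (y, x) \<in> r"
    and inv: "\<And>f g h. f \<in> carrier G \<Longrightarrow> (g, h) \<in> r \<Longrightarrow> (f \<otimes>\<^bsub>G\<^esub> g, f \<otimes>\<^bsub>G\<^esub> h) \<in> r"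
    using r by (auto simp: left_ordering_def irrefl_def total_on_def)
  show "?cone P"
  proof (intro conjI ballI impI)
    fix g h assume "g \<in> P" "h \<in> P"
    then have g: "g \<in> carrier G" "(\<one>\<^bsub>G\<^esub>, g) \<in> r" and h: "h \<in> carrier G" "(\<one>\<^bsub>G\<^esub>, h) \<in> r"
      by (auto simp: P positive_cone_def)
    have "(g, g \<otimes>\<^bsub>G\<^esub> h) \<in> r" using inv[OF g(1) h(2)] g by simp
    with g(2) tr have "(\<one>\<^bsub>G\<^esub>, g \<otimes>\<^bsub>G\<^esub> h) \<in> r" by (blast dest: transD)
    then show "g \<otimes>\<^bsub>G\<^esub> h \<in> P" using g h by (simp add: P positive_cone_def)
  next
    fix g assume g: "g \<in> carrier G" "g \<noteq> \<one>\<^bsub>G\<^esub>"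
    have "(\<one>\<^bsub>G\<^esub>, inv\<^bsub>G\<^esub> g) \<in> r \<longleftrightarrow> (g, \<one>\<^bsub>G\<^esub>) \<in> r"
      using inv[OF g(1), of "\<one>\<^bsub>G\<^esub>" "inv\<^bsub>G\<^esub> g"] inv[of "inv\<^bsub>G\<^esub> g" g "\<one>\<^bsub>G\<^esub>"] g by auto
    then show "g \<in> P \<longleftrightarrow> inv\<^bsub>G\<^esub> g \<notin> P"
      using tot[of "\<one>\<^bsub>G\<^esub>" g] g tr irr by (auto simp: P positive_cone_def dest: transD)
  qed (auto simp: P positive_cone_def irr)
next
  interpret G: Group.group G by fact
  assume P: "?cone P"
  have Pc: "\<And>g. g \<in> P \<Longrightarrow> g \<in> carrier G" using P by blast
  have eq: "inv\<^bsub>G\<^esub> (inv\<^bsub>G\<^esub> g \<otimes>\<^bsub>G\<^esub> h) = inv\<^bsub>G\<^esub> h \<otimes>\<^bsub>G\<^esub> g" if "g \<in> carrier G" "h \<in> carrier G" for g h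
    using that by (simp add: G.inv_mult_group)
  have "left_ordering G (cone_ordering G P)"
    unfolding left_ordering_def
  proof (intro conjI ballI impI)
    show "irrefl (cone_ordering G P)"
      using P by (auto simp: irrefl_def cone_ordering_def)
    show "trans (cone_ordering G P)"
    proof (rule transI)
      fix x y z assume "(x, y) \<in> cone_ordering G P" "(y, z) \<in> cone_ordering G P"
      then have c: "x \<in> carrier G" "y \<in> carrier G" "z \<in> carrier G"
        and p: "inv\<^bsub>G\<^esub> x \<otimes>\<^bsub>G\<^esub> y \<in> P" "inv\<^bsub>G\<^esub> y \<otimes>\<^bsub>G\<^esub> z \<in> P" by (auto simp: cone_ordering_def)
      have "(inv\<^bsub>G\<^esub> x \<otimes>\<^bsub>G\<^esub> y) \<otimes>\<^bsub>G\<^esub> (inv\<^bsub>G\<^esub> y \<otimes>\<^bsub>G\<^esub> z) \<in> P" using P p by blast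
      also have "(inv\<^bsub>G\<^esub> x \<otimes>\<^bsub>G\<^esub> y) \<otimes>\<^bsub>G\<^esub> (inv\<^bsub>G\<^esub> y \<otimes>\<^bsub>G\<^esub> z) = inv\<^bsub>G\<^esub> x \<otimes>\<^bsub>G\<^esub> z"
        using c by (metis G.inv_closed G.m_assoc G.m_closed G.r_inv G.l_one)
      finally show "(x, z) \<in> cone_ordering G P" using c by (simp add: cone_ordering_def)
    qed
    show "total_on (carrier G) (cone_ordering G P)"
    proof (rule total_onI)
      fix x y assume c: "x \<in> carrier G" "y \<in> carrier G" "x \<noteq> y"
      then have "inv\<^bsub>G\<^esub> x \<otimes>\<^bsub>G\<^esub> y \<noteq> \<one>\<^bsub>G\<^esub>"
        by (metis G.inv_closed G.inv_equality G.inv_inv)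
      then show "(x, y) \<in> cone_ordering G P \<or> (y, x) \<in> cone_ordering G P"
        using P c eq[OF c(1,2)] by (simp add: cone_ordering_def)
    qed
    fix f g h assume c: "f \<in> carrier G" "g \<in> carrier G" "h \<in> carrier G" "(g, h) \<in> cone_ordering G P"
    have "inv\<^bsub>G\<^esub> (f \<otimes>\<^bsub>G\<^esub> g) \<otimes>\<^bsub>G\<^esub> (f \<otimes>\<^bsub>G\<^esub> h) = inv\<^bsub>G\<^esub> g \<otimes>\<^bsub>G\<^esub> h"
    proof -
      have "inv\<^bsub>G\<^esub> f \<otimes>\<^bsub>G\<^esub> (f \<otimes>\<^bsub>G\<^esub> h) = h"
        using c by (simp add: G.m_assoc[symmetric])
      then show ?thesis using c by (simp add: G.inv_mult_group G.m_assoc)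
    qed
    with c show "(f \<otimes>\<^bsub>G\<^esub> g, f \<otimes>\<^bsub>G\<^esub> h) \<in> cone_ordering G P" by (simp add: cone_ordering_def)
  qed (auto simp: cone_ordering_def)
  moreover have "positive_cone G (cone_ordering G P) = P"
    using Pc by (auto simp: positive_cone_def cone_ordering_def)
  ultimately show "P \<in> LO G" unfolding LO_def by blast
qed

text \<open>The product topology on \<open>2\<^sup>A\<close>, a subset of \<open>A\<close> being identified with its characteristic
  function on \<open>A\<close>.\<close>

definition powerset_topology :: "'a set \<Rightarrow> 'a set topology" where
  "powerset_topology A =
     pullback_topology (Pow A) (\<lambda>S. \<lambda>a\<in>A. a \<in> S)
       (product_topology (\<lambda>_. discrete_topology (UNIV :: bool set)) A)"

definition LO_topology :: "('a, 'b) monoid_scheme \<Rightarrow> 'a set topology" where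
  "LO_topology G = subtopology (powerset_topology (carrier G)) (LO G)"

definition isolated_point :: "'a topology \<Rightarrow> 'a \<Rightarrow> bool" where
  "isolated_point X x \<longleftrightarrow> x \<in> topspace X \<and> openin X {x}"

lemma topspace_LO_topology [simp]: "topspace (LO_topology G) = LO G"
  by (auto simp: LO_topology_def powerset_topology_def topspace_pullback_topology LO_def positive_cone_def)

lemma openin_LO_topology_subbasis:
  assumes "g \<in> carrier G"
  shows "openin (LO_topology G) {P \<in> LO G. g \<in> P}"
proof -
  let ?T = "product_topology (\<lambda>_. discrete_topology (UNIV :: bool set)) (carrier G)"
  have "openin ?T {x \<in> topspace ?T. x g \<in> {True}}"
    by (rule openin_continuous_map_preimage[OF continuous_map_product_projection[OF assms]]) simp
  then show ?thesis unfolding LO_topology_def powerset_topology_def openin_subtopology openin_pullback_topology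
    using assms by (intro exI[of _ "{S. S \<subseteq> carrier G \<and> g \<in> S}"] conjI exI[of _ "{x \<in> topspace ?T. x g \<in> {True}}"])
      (auto simp: LO_def positive_cone_def)
qed


subsection \<open>Convex subgroups\<close>

definition convex_subgroup :: "('a, 'b) monoid_scheme \<Rightarrow> 'a rel \<Rightarrow> 'a set \<Rightarrow> bool" where
  "convex_subgroup G r C \<longleftrightarrow>
     subgroup C G \<and>
     (\<forall>f\<in>C. \<forall>h\<in>C. \<forall>g\<in>carrier G. (f, g) \<in> r \<and> (g, h) \<in> r \<longrightarrow> g \<in> C)"

definition Conradian_soul :: "('a, 'b) monoid_scheme \<Rightarrow> 'a rel \<Rightarrow> 'a set" where
  "Conradian_soul G r =
     (GREATEST C. convex_subgroup G r C \<and> Conradian_ordering (G\<lparr>carrier := C\<rparr>) (Restr r C))"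

definition bi_ordered_soul :: "('a, 'b) monoid_scheme \<Rightarrow> 'a rel \<Rightarrow> 'a set" where
  "bi_ordered_soul G r =
     (GREATEST C. convex_subgroup G r C \<and> bi_ordering (G\<lparr>carrier := C\<rparr>) (Restr r C))"

text \<open>
  Convex subgroups form a chain, and both defining properties pass to unions of chains, so both
  \<open>GREATEST\<close> sets exist.
\<close>

lemma left_ordering_Restr:
  assumes r: "left_ordering G r" and C: "subgroup C G"
  shows "left_ordering (G\<lparr>carrier := C\<rparr>) (Restr r C)"
proof -
  have sub: "\<And>x. x \<in> C \<Longrightarrow> x \<in> carrier G" using subgroup.mem_carrier[OF C] .
  have "trans r" "irrefl r" "total_on (carrier G) r" using r by (auto simp: left_ordering_def)
  then have "trans (Restr r C)" "irrefl (Restr r C)" "total_on C (Restr r C)"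
    using sub by (auto simp: irrefl_def total_on_def intro: trans_Restr)
  then show ?thesis
    using r sub subgroup.m_closed[OF C] by (simp add: left_ordering_def)
qed

lemma convex_subgroups_chain:
  assumes "Group.group G" "left_ordering G r" "convex_subgroup G r C" "convex_subgroup G r D"
  shows "C \<subseteq> D \<or> D \<subseteq> C"
proof (rule ccontr)
  interpret G: Group.group G by fact
  assume "\<not> ?thesis"
  then obtain c d where c: "c \<in> C" "c \<notin> D" and d: "d \<in> D" "d \<notin> C" by blast
  interpret C: subgroup C G using assms by (simp add: convex_subgroup_def)
  interpret D: subgroup D G using assms by (simp add: convex_subgroup_def)
  have tot: "\<And>x y. x \<in> carrier G \<Longrightarrow> y \<in> carrier G \<Longrightarrow> x \<noteq> y \<Longrightarrow> (x, y) \<in> r \<or> (y, x) \<in> r"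
    and inv: "\<And>f g h. f \<in> carrier G \<Longrightarrow> g \<in> carrier G \<Longrightarrow> h \<in> carrier G \<Longrightarrow> (g, h) \<in> r \<Longrightarrow> (f \<otimes>\<^bsub>G\<^esub> g, f \<otimes>\<^bsub>G\<^esub> h) \<in> r"
    using assms(2) by (auto simp: left_ordering_def total_on_def)
  have cc: "\<And>f g h. f \<in> C \<Longrightarrow> h \<in> C \<Longrightarrow> g \<in> carrier G \<Longrightarrow> (f, g) \<in> r \<Longrightarrow> (g, h) \<in> r \<Longrightarrow> g \<in> C"
    and dc: "\<And>f g h. f \<in> D \<Longrightarrow> h \<in> D \<Longrightarrow> g \<in> carrier G \<Longrightarrow> (f, g) \<in> r \<Longrightarrow> (g, h) \<in> r \<Longrightarrow> g \<in> D"
    using assms(3,4) unfolding convex_subgroup_def by blast+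
  have pos: "\<exists>x'\<in>X. x' \<notin> Y \<and> (\<one>\<^bsub>G\<^esub>, x') \<in> r" if X: "subgroup X G" and Y: "subgroup Y G" and x: "x \<in> X" "x \<notin> Y" for x X Y
  proof -
    have xc: "x \<in> carrier G" and x1: "x \<noteq> \<one>\<^bsub>G\<^esub>"
      using subgroup.mem_carrier[OF X x(1)] subgroup.one_closed[OF Y] x by auto
    have "(\<one>\<^bsub>G\<^esub>, x) \<in> r \<or> (\<one>\<^bsub>G\<^esub>, inv\<^bsub>G\<^esub> x) \<in> r"
      using tot[of x "\<one>\<^bsub>G\<^esub>"] xc x1 inv[of "inv\<^bsub>G\<^esub> x" x "\<one>\<^bsub>G\<^esub>"] by auto
    moreover have "inv\<^bsub>G\<^esub> x \<in> X" "inv\<^bsub>G\<^esub> x \<notin> Y"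
      using subgroup.m_inv_closed[OF X x(1)] subgroup.m_inv_closed[OF Y, of "inv\<^bsub>G\<^esub> x"] xc x by auto
    ultimately show ?thesis using x by blast
  qed
  obtain c' where c': "c' \<in> C" "c' \<notin> D" "(\<one>\<^bsub>G\<^esub>, c') \<in> r"
    using pos[OF C.subgroup_axioms D.subgroup_axioms c] by blast
  obtain d' where d': "d' \<in> D" "d' \<notin> C" "(\<one>\<^bsub>G\<^esub>, d') \<in> r"
    using pos[OF D.subgroup_axioms C.subgroup_axioms d] by blast
  have "(c', d') \<in> r \<or> (d', c') \<in> r" using tot c' d' C.mem_carrier D.mem_carrier by metis
  then show False
    using dc[of "\<one>\<^bsub>G\<^esub>" d' c'] cc[of "\<one>\<^bsub>G\<^esub>" c' d'] c' d' by auto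
qed

lemma greatest_convex_subgroup:
  assumes G: "Group.group G" and r: "left_ordering G r"
    and Q_one: "Q {\<one>\<^bsub>G\<^esub>}"
    and Q_Union: "\<And>\<C>. \<C> \<noteq> {} \<Longrightarrow> \<forall>C\<in>\<C>. convex_subgroup G r C \<and> Q C \<Longrightarrow>
            \<forall>x\<in>\<Union>\<C>. \<forall>y\<in>\<Union>\<C>. \<exists>C\<in>\<C>. x \<in> C \<and> y \<in> C \<Longrightarrow> subgroup (\<Union>\<C>) G \<Longrightarrow> Q (\<Union>\<C>)"
  defines "S \<equiv> GREATEST C. convex_subgroup G r C \<and> Q C"
  shows "convex_subgroup G r S" and "Q S" and "\<And>C. convex_subgroup G r C \<Longrightarrow> Q C \<Longrightarrow> C \<subseteq> S"
proof -
  interpret G: Group.group G by fact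
  define \<C> where "\<C> = {C. convex_subgroup G r C \<and> Q C}"
  have one: "convex_subgroup G r {\<one>\<^bsub>G\<^esub>}"
    using G.triv_subgroup r
    by (auto simp: convex_subgroup_def left_ordering_def irrefl_def dest: transD)
  then have ne: "\<C> \<noteq> {}" using Q_one by (auto simp: \<C>_def)
  have all: "\<forall>C\<in>\<C>. convex_subgroup G r C \<and> Q C" by (simp add: \<C>_def)
  have dir: "\<forall>x\<in>\<Union>\<C>. \<forall>y\<in>\<Union>\<C>. \<exists>C\<in>\<C>. x \<in> C \<and> y \<in> C"
    using convex_subgroups_chain[OF G r] all by blast
  have sg: "\<And>C. C \<in> \<C> \<Longrightarrow> subgroup C G" using all by (auto simp: convex_subgroup_def)
  have sub: "subgroup (\<Union>\<C>) G"
  proof (rule G.subgroupI)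
    show "\<Union>\<C> \<subseteq> carrier G" using subgroup.subset[OF sg] by blast
    show "\<Union>\<C> \<noteq> {}" using ne subgroup.one_closed[OF sg] by blast
    show "inv\<^bsub>G\<^esub> a \<in> \<Union>\<C>" if "a \<in> \<Union>\<C>" for a using that subgroup.m_inv_closed[OF sg] by blast
    show "a \<otimes>\<^bsub>G\<^esub> b \<in> \<Union>\<C>" if "a \<in> \<Union>\<C>" "b \<in> \<Union>\<C>" for a b
      using that dir subgroup.m_closed[OF sg] by (metis UnionI)
  qed
  have con: "convex_subgroup G r (\<Union>\<C>)"
    unfolding convex_subgroup_def
  proof (intro conjI sub ballI impI)
    fix f h g assume *: "f \<in> \<Union>\<C>" "h \<in> \<Union>\<C>" "g \<in> carrier G" "(f, g) \<in> r \<and> (g, h) \<in> r"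
    then obtain C where "C \<in> \<C>" "f \<in> C" "h \<in> C" using dir by blast
    then show "g \<in> \<Union>\<C>" using * all unfolding convex_subgroup_def by blast
  qed
  have Q: "Q (\<Union>\<C>)" using Q_Union ne all dir sub by blast
  have "S = \<Union>\<C>" unfolding S_def
    by (rule Greatest_equality) (use con Q in \<open>auto simp: \<C>_def\<close>)
  then show "convex_subgroup G r S" "Q S" "\<And>C. convex_subgroup G r C \<Longrightarrow> Q C \<Longrightarrow> C \<subseteq> S"
    using con Q by (auto simp: \<C>_def)
qed

lemma bi_ordered_soul:
  assumes G: "Group.group G" and r: "left_ordering G r"
  shows "convex_subgroup G r (bi_ordered_soul G r)"
    and "bi_ordering (G\<lparr>carrier := bi_ordered_soul G r\<rparr>) (Restr r (bi_ordered_soul G r))"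
    and "\<And>C. convex_subgroup G r C \<Longrightarrow> bi_ordering (G\<lparr>carrier := C\<rparr>) (Restr r C) \<Longrightarrow> C \<subseteq> bi_ordered_soul G r"
proof -
  interpret G: Group.group G by fact
  have one: "bi_ordering (G\<lparr>carrier := {\<one>\<^bsub>G\<^esub>}\<rparr>) (Restr r {\<one>\<^bsub>G\<^esub>})"
    using left_ordering_Restr[OF r G.triv_subgroup] r
    by (auto simp: bi_ordering_def left_ordering_def irrefl_def)
  have U: "bi_ordering (G\<lparr>carrier := \<Union>\<C>\<rparr>) (Restr r (\<Union>\<C>))"
    if all: "\<forall>C\<in>\<C>. convex_subgroup G r C \<and> bi_ordering (G\<lparr>carrier := C\<rparr>) (Restr r C)"
      and dir: "\<forall>x\<in>\<Union>\<C>. \<forall>y\<in>\<Union>\<C>. \<exists>C\<in>\<C>. x \<in> C \<and> y \<in> C" and sub: "subgroup (\<Union>\<C>) G" for \<C>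
  proof -
    have "(g \<otimes>\<^bsub>G\<^esub> f, h \<otimes>\<^bsub>G\<^esub> f) \<in> Restr r (\<Union>\<C>)"
      if *: "f \<in> \<Union>\<C>" "g \<in> \<Union>\<C>" "h \<in> \<Union>\<C>" "(g, h) \<in> Restr r (\<Union>\<C>)" for f g h
    proof -
    obtain C1 C2 where C12: "C1 \<in> \<C>" "f \<in> C1" "g \<in> C1" "C2 \<in> \<C>" "h \<in> C2" "g \<in> C2" using dir * by blast
    have "C1 \<subseteq> C2 \<or> C2 \<subseteq> C1" using convex_subgroups_chain[OF G r] all C12 by blast
    then obtain C where C: "C \<in> \<C>" "f \<in> C" "g \<in> C" "h \<in> C" using C12 by blast
    have "bi_ordering (G\<lparr>carrier := C\<rparr>) (Restr r C)" using all C by blast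
    then have "(g \<otimes>\<^bsub>G\<^esub> f, h \<otimes>\<^bsub>G\<^esub> f) \<in> Restr r C"
      using C * by (simp add: bi_ordering_def)
    then show ?thesis using C by blast
    qed
    then show ?thesis using left_ordering_Restr[OF r sub] by (simp add: bi_ordering_def)
  qed
  note greatest = greatest_convex_subgroup[OF G r, where Q = "\<lambda>C. bi_ordering (G\<lparr>carrier := C\<rparr>) (Restr r C)"]
  show "convex_subgroup G r (bi_ordered_soul G r)"
    unfolding bi_ordered_soul_def by (rule greatest(1)) (fact one, rule U)
  show "bi_ordering (G\<lparr>carrier := bi_ordered_soul G r\<rparr>) (Restr r (bi_ordered_soul G r))"
    unfolding bi_ordered_soul_def by (rule greatest(2)) (fact one, rule U)
  show "C \<subseteq> bi_ordered_soul G r" if "convex_subgroup G r C" "bi_ordering (G\<lparr>carrier := C\<rparr>) (Restr r C)" for C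
    unfolding bi_ordered_soul_def by (rule greatest(3)) (fact one, (rule U; assumption), fact+)
qed

lemma Conradian_soul:
  assumes G: "Group.group G" and r: "left_ordering G r"
  shows "convex_subgroup G r (Conradian_soul G r)"
    and "Conradian_ordering (G\<lparr>carrier := Conradian_soul G r\<rparr>) (Restr r (Conradian_soul G r))"
    and "\<And>C. convex_subgroup G r C \<Longrightarrow> Conradian_ordering (G\<lparr>carrier := C\<rparr>) (Restr r C) \<Longrightarrow> C \<subseteq> Conradian_soul G r"
proof -
  interpret G: Group.group G by fact
  have one: "Conradian_ordering (G\<lparr>carrier := {\<one>\<^bsub>G\<^esub>}\<rparr>) (Restr r {\<one>\<^bsub>G\<^esub>})"
    using left_ordering_Restr[OF r G.triv_subgroup] r
    by (auto simp: Conradian_ordering_def left_ordering_def irrefl_def positive_cone_def)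
  have U: "Conradian_ordering (G\<lparr>carrier := \<Union>\<C>\<rparr>) (Restr r (\<Union>\<C>))"
    if all: "\<forall>C\<in>\<C>. convex_subgroup G r C \<and> Conradian_ordering (G\<lparr>carrier := C\<rparr>) (Restr r C)"
      and dir: "\<forall>x\<in>\<Union>\<C>. \<forall>y\<in>\<Union>\<C>. \<exists>C\<in>\<C>. x \<in> C \<and> y \<in> C" and sub: "subgroup (\<Union>\<C>) G" for \<C>
    unfolding Conradian_ordering_def
  proof (intro conjI left_ordering_Restr[OF r sub] ballI)
    fix g h assume "g \<in> positive_cone (G\<lparr>carrier := \<Union>\<C>\<rparr>) (Restr r (\<Union>\<C>))"
      "h \<in> positive_cone (G\<lparr>carrier := \<Union>\<C>\<rparr>) (Restr r (\<Union>\<C>))"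
    then have *: "g \<in> \<Union>\<C>" "h \<in> \<Union>\<C>" "(\<one>\<^bsub>G\<^esub>, g) \<in> r" "(\<one>\<^bsub>G\<^esub>, h) \<in> r"
      by (auto simp: positive_cone_def)
    then obtain C where C: "C \<in> \<C>" "g \<in> C" "h \<in> C" using dir by blast
    have CC: "Conradian_ordering (G\<lparr>carrier := C\<rparr>) (Restr r C)" and "subgroup C G"
      using all C unfolding convex_subgroup_def by blast+
    then have "\<one>\<^bsub>G\<^esub> \<in> C" by (simp add: subgroup.one_closed)
    then have "g \<in> positive_cone (G\<lparr>carrier := C\<rparr>) (Restr r C)" "h \<in> positive_cone (G\<lparr>carrier := C\<rparr>) (Restr r C)"
      using C * by (auto simp: positive_cone_def)
    then obtain n :: nat where "(g, h \<otimes>\<^bsub>G\<lparr>carrier := C\<rparr>\<^esub> g [^]\<^bsub>G\<lparr>carrier := C\<rparr>\<^esub> n) \<in> Restr r C"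
      using CC unfolding Conradian_ordering_def by blast
    then have "(g, h \<otimes>\<^bsub>G\<^esub> g [^]\<^bsub>G\<^esub> n) \<in> Restr r (\<Union>\<C>)"
      using C by (auto simp: nat_pow_def)
    then show "\<exists>n::nat. (g, h \<otimes>\<^bsub>G\<lparr>carrier := \<Union>\<C>\<rparr>\<^esub> g [^]\<^bsub>G\<lparr>carrier := \<Union>\<C>\<rparr>\<^esub> n) \<in> Restr r (\<Union>\<C>)"
      by (auto simp: nat_pow_def)
  qed
  note greatest = greatest_convex_subgroup[OF G r, where Q = "\<lambda>C. Conradian_ordering (G\<lparr>carrier := C\<rparr>) (Restr r C)"]
  show "convex_subgroup G r (Conradian_soul G r)"
    unfolding Conradian_soul_def by (rule greatest(1)) (fact one, rule U)
  show "Conradian_ordering (G\<lparr>carrier := Conradian_soul G r\<rparr>) (Restr r (Conradian_soul G r))"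
    unfolding Conradian_soul_def by (rule greatest(2)) (fact one, rule U)
  show "C \<subseteq> Conradian_soul G r" if "convex_subgroup G r C" "Conradian_ordering (G\<lparr>carrier := C\<rparr>) (Restr r C)" for C
    unfolding Conradian_soul_def by (rule greatest(3)) (fact one, (rule U; assumption), fact+)
qed


subsection \<open>The rank of an abelian group\<close>

text \<open>
  \<open>A \<otimes> \<rat>\<close> as a rational vector space: the free abelian group on pairs \<open>(a, q)\<close>, standing for
  \<open>a \<otimes> q\<close>, modulo the subgroup generated by the biadditivity relations. The group \<open>A\<close> is
  written multiplicatively. The scalar \<open>p\<close> sends the class of \<open>(a, q)\<close> to the class of
  \<open>(a, p q)\<close>. The ring multiplication of the \<open>module\<close> record plays no role.
\<close>

definition tensor_relations ::
  "('a, 'b) monoid_scheme \<Rightarrow> ('a \<times> rat \<Rightarrow>\<^sub>0 int) set" where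
  "tensor_relations A =
     {frag_of (a \<otimes>\<^bsub>A\<^esub> b, q) - (frag_of (a, q) + frag_of (b, q)) | a b q.
        a \<in> carrier A \<and> b \<in> carrier A} \<union>
     {frag_of (a, p + q) - (frag_of (a, p) + frag_of (a, q)) | a p q. a \<in> carrier A}"

definition tensor_free_group ::
  "('a, 'b) monoid_scheme \<Rightarrow> ('a \<times> rat \<Rightarrow>\<^sub>0 int) monoid" where
  "tensor_free_group A = free_Abelian_group (carrier A \<times> UNIV)"

definition tensor_kernel :: "('a, 'b) monoid_scheme \<Rightarrow> ('a \<times> rat \<Rightarrow>\<^sub>0 int) set" where
  "tensor_kernel A = generate (tensor_free_group A) (tensor_relations A)"

definition tensor_scale :: "rat \<Rightarrow> ('a \<times> rat \<Rightarrow>\<^sub>0 int) \<Rightarrow> ('a \<times> rat \<Rightarrow>\<^sub>0 int)" where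
  "tensor_scale p = frag_extend (\<lambda>(a, q). frag_of (a, p * q))"

text \<open>For \<open>p = 0\<close> the image of a coset under \<open>tensor_scale p\<close> is not itself a coset, so the
  kernel is added back.\<close>

definition tensor_Rat ::
  "('a, 'b) monoid_scheme \<Rightarrow> (rat, ('a \<times> rat \<Rightarrow>\<^sub>0 int) set) module" where
  "tensor_Rat A =
     \<lparr>carrier = carrier (tensor_free_group A Mod tensor_kernel A),
      mult = undefined, one = undefined,
      zero = \<one>\<^bsub>tensor_free_group A Mod tensor_kernel A\<^esub>,
      add = (\<otimes>\<^bsub>tensor_free_group A Mod tensor_kernel A\<^esub>),
      smult = (\<lambda>p X. tensor_kernel A <#>\<^bsub>tensor_free_group A\<^esub> (tensor_scale p ` X))\<rparr>"

lemma tensor_scale_simps [simp]: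
  "tensor_scale p 0 = 0"
  "tensor_scale p (frag_of (a, q)) = frag_of (a, p * q)"
  "tensor_scale p (x + y) = tensor_scale p x + tensor_scale p y"
  "tensor_scale p (x - y) = tensor_scale p x - tensor_scale p y"
  "tensor_scale p (- x) = - tensor_scale p x"
  by (simp_all add: tensor_scale_def frag_extend_add frag_extend_diff frag_extend_minus)

lemma vectorspace_tensor_Rat:
  assumes A: "comm_group A"
  shows "vectorspace (class_ring :: rat ring) (tensor_Rat A)"
proof -
  interpret A: comm_group A by fact
  let ?F = "tensor_free_group A" and ?R = "tensor_kernel A"
  interpret F: comm_group ?F
    unfolding tensor_free_group_def by (rule abelian_free_Abelian_group)
  have F_simps [simp]: "x \<otimes>\<^bsub>?F\<^esub> y = x + y" "\<one>\<^bsub>?F\<^esub> = 0"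
    "x \<in> carrier ?F \<longleftrightarrow> Poly_Mapping.keys x \<subseteq> carrier A \<times> UNIV" for x y
    by (simp_all add: tensor_free_group_def)
  have F_inv: "inv\<^bsub>?F\<^esub> x = - x" if "x \<in> carrier ?F" for x
    using that by (simp add: tensor_free_group_def)
  have frag_in: "frag_of (a, q) \<in> carrier ?F" if "a \<in> carrier A" for a q
    using that by simp
  have add_in: "x + y \<in> carrier ?F" if "x \<in> carrier ?F" "y \<in> carrier ?F" for x y
    using F.m_closed[OF that] by simp
  have minus_in: "- x \<in> carrier ?F" if "x \<in> carrier ?F" for x
    using F.inv_closed[OF that] F_inv[OF that] by simp
  have diff_in: "x - y \<in> carrier ?F" if "x \<in> carrier ?F" "y \<in> carrier ?F" for x y
    using add_in[OF that(1) minus_in[OF that(2)]] by simp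
  have rel_in: "tensor_relations A \<subseteq> carrier ?F"
    unfolding tensor_relations_def
    by (auto simp del: F_simps intro!: diff_in add_in frag_in)
  have R: "subgroup ?R ?F"
    unfolding tensor_kernel_def by (rule F.generate_is_subgroup[OF rel_in])
  have Rn: "?R \<lhd> ?F"
    using R by (simp add: F.normal_iff_subgroup)
  have R0: "0 \<in> ?R" using subgroup.one_closed[OF R] by simp
  have Radd: "x \<in> ?R \<Longrightarrow> y \<in> ?R \<Longrightarrow> x + y \<in> ?R" for x y using subgroup.m_closed[OF R] by simp
  have Rin: "x \<in> ?R \<Longrightarrow> x \<in> carrier ?F" for x using subgroup.mem_carrier[OF R] .
  have Rneg: "x \<in> ?R \<Longrightarrow> - x \<in> ?R" for x using subgroup.m_inv_closed[OF R] F_inv Rin by metis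
  have Rdiff: "x \<in> ?R \<Longrightarrow> y \<in> ?R \<Longrightarrow> x - y \<in> ?R" for x y using Radd[OF _ Rneg] by fastforce
  have Rrel: "x \<in> tensor_relations A \<Longrightarrow> x \<in> ?R" for x unfolding tensor_kernel_def by (rule generate.incl)
  have induct: "P x" if "x \<in> carrier ?F" "P 0" "\<And>x y. x \<in> carrier ?F \<Longrightarrow> y \<in> carrier ?F \<Longrightarrow> P x \<Longrightarrow> P y \<Longrightarrow> P (x - y)"
    "\<And>a q. a \<in> carrier A \<Longrightarrow> P (frag_of (a, q))" for P x
    using free_Abelian_group_induct[of x "carrier A \<times> UNIV" P] that by auto
  have sc_in: "tensor_scale p x \<in> carrier ?F" if "x \<in> carrier ?F" for p x
    using that by (rule induct) (auto simp del: F_simps intro!: diff_in frag_in F.one_closed[simplified F_simps(2)])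
  have sc_rel: "tensor_scale p x \<in> tensor_relations A" if "x \<in> tensor_relations A" for p x
    using that unfolding tensor_relations_def
    by (auto simp: distrib_left) blast+
  have sc_R: "tensor_scale p x \<in> ?R" if "x \<in> ?R" for p x
    using that unfolding tensor_kernel_def
  proof (induction rule: generate.induct)
    case one show ?case using R0 by (simp add: tensor_kernel_def)
  next
    case (incl h) then show ?case using sc_rel Rrel by (simp add: tensor_kernel_def)
  next
    case (inv h)
    have "h \<in> carrier ?F" using rel_in inv by blast
    then show ?case using Rneg[OF Rrel[OF sc_rel[OF inv]]] by (simp add: F_inv tensor_kernel_def)
  next
    case (eng h1 h2) then show ?case using Radd by (simp add: tensor_kernel_def)
  qed
  let ?V = "tensor_Rat A"
  define c where "c x = ?R #>\<^bsub>?F\<^esub> x" for x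
  have c_eq_set: "c x = {y + x | y. y \<in> ?R}" for x by (auto simp: c_def r_coset_def)
  have carr: "carrier ?V = c ` carrier ?F"
    by (auto simp: tensor_Rat_def FactGroup_def RCOSETS_def c_def)
  have zero: "\<zero>\<^bsub>?V\<^esub> = c 0"
    by (auto simp: tensor_Rat_def c_eq_set)
  have add: "c x \<oplus>\<^bsub>?V\<^esub> c y = c (x + y)" if "x \<in> carrier ?F" "y \<in> carrier ?F" for x y
    using normal.rcos_sum[OF Rn that] by (simp add: tensor_Rat_def c_def)
  have smult: "p \<odot>\<^bsub>?V\<^esub> c x = c (tensor_scale p x)" if "x \<in> carrier ?F" for p x
  proof -
    have "r + tensor_scale p (s + x) \<in> c (tensor_scale p x)" if "r \<in> ?R" "s \<in> ?R" for r s
      unfolding c_eq_set using Radd[OF that(1) sc_R[OF that(2)]]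
      by (auto simp: add.assoc intro!: exI[of _ "r + tensor_scale p s"])
    moreover have "r + tensor_scale p x \<in> p \<odot>\<^bsub>?V\<^esub> c x" if "r \<in> ?R" for r
    proof -
      have "x \<in> c x" unfolding c_eq_set using R0 by (auto intro!: exI[of _ 0])
      then show ?thesis using that by (auto simp: tensor_Rat_def set_mult_def)
    qed
    moreover have "c x = (\<lambda>s. s + x) ` ?R"
      by (auto simp: c_eq_set)
    then have "p \<odot>\<^bsub>?V\<^esub> c x = (\<Union>r\<in>?R. \<Union>s\<in>?R. {r + tensor_scale p (s + x)})"
      by (simp add: tensor_Rat_def set_mult_def del: tensor_scale_simps)
    ultimately show ?thesis
      unfolding c_eq_set[of "tensor_scale p x"]
      by (intro equalityI subsetI) (auto simp del: tensor_scale_simps)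
  qed
  have c_eqI: "c x = c y" if "x - y \<in> ?R" for x y
  proof -
    have "r + x \<in> c y" if "r \<in> ?R" for r
      unfolding c_eq_set using Radd[OF that \<open>x - y \<in> ?R\<close>] by (auto intro!: exI[of _ "r + (x - y)"])
    moreover have "r + y \<in> c x" if "r \<in> ?R" for r
      unfolding c_eq_set using Rdiff[OF that \<open>x - y \<in> ?R\<close>] by (auto intro!: exI[of _ "r - (x - y)"])
    ultimately show ?thesis by (auto simp: c_eq_set)
  qed
  have F0: "0 \<in> carrier ?F" by simp
  have ab: "abelian_group ?V"
  proof (rule abelian_groupI; (unfold carr zero)?)
    show "\<exists>y\<in>c ` carrier ?F. y \<oplus>\<^bsub>?V\<^esub> x = c 0" if "x \<in> c ` carrier ?F" for x
    proof -
      obtain x' where x': "x = c x'" "x' \<in> carrier ?F" using \<open>x \<in> _\<close> by blast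
      have "c (- x') \<oplus>\<^bsub>?V\<^esub> c x' = c 0" using add[OF minus_in[OF x'(2)] x'(2)] by simp
      with x' minus_in[OF x'(2)] show ?thesis by blast
    qed
  qed (auto simp: add add_in F0 ac_simps simp del: F_simps)
  have sc_assoc: "tensor_scale (p * q) x = tensor_scale p (tensor_scale q x)" if "x \<in> carrier ?F" for p q x
    using that by (rule induct) (simp_all add: mult.assoc)
  have sc_one: "tensor_scale 1 x = x" if "x \<in> carrier ?F" for x
    using that by (rule induct) simp_all
  have sc_distr: "tensor_scale (p + q) x - (tensor_scale p x + tensor_scale q x) \<in> ?R" if "x \<in> carrier ?F" for p q x
    using that
  proof (rule induct)
    fix x y assume "tensor_scale (p + q) x - (tensor_scale p x + tensor_scale q x) \<in> ?R"
      "tensor_scale (p + q) y - (tensor_scale p y + tensor_scale q y) \<in> ?R"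
    from Rdiff[OF this] show "tensor_scale (p + q) (x - y) - (tensor_scale p (x - y) + tensor_scale q (x - y)) \<in> ?R"
      by (simp add: algebra_simps)
  next
    fix a s assume "a \<in> carrier A"
    then show "tensor_scale (p + q) (frag_of (a, s)) - (tensor_scale p (frag_of (a, s)) + tensor_scale q (frag_of (a, s))) \<in> ?R"
      unfolding tensor_relations_def tensor_scale_simps distrib_right by (intro Rrel[unfolded tensor_relations_def]) blast
  qed (use R0 in simp)
  have "module (class_ring :: rat ring) ?V"
  proof (rule moduleI)
    show "cring (class_ring :: rat ring)" by (rule class_cring.cring_axioms)
    show "abelian_group ?V" by (rule ab)
    show "(p \<oplus>\<^bsub>class_ring\<^esub> q) \<odot>\<^bsub>?V\<^esub> x = p \<odot>\<^bsub>?V\<^esub> x \<oplus>\<^bsub>?V\<^esub> q \<odot>\<^bsub>?V\<^esub> x" if x: "x \<in> carrier ?V" for p q :: rat and x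
    proof -
      obtain y where y: "x = c y" "y \<in> carrier ?F" using x[unfolded carr image_iff] by blast
      then show ?thesis using c_eqI[OF sc_distr[OF y(2)], of p q] by (simp add: smult add sc_in del: F_simps)
    qed
  qed (auto simp: carr smult add add_in sc_in sc_assoc sc_one simp del: F_simps)
  then show ?thesis
    by (intro vectorspace.intro class_field.field_axioms)
qed

text \<open>Finite dimensionality is required explicitly because \<open>vectorspace.dim\<close> is a \<open>LEAST\<close> over the
  sizes of finite generating sets and hence unspecified when there are none.\<close>

definition has_rank :: "('a, 'b) monoid_scheme \<Rightarrow> nat \<Rightarrow> bool" where
  "has_rank A n \<longleftrightarrow>
     vectorspace.fin_dim (class_ring :: rat ring) (tensor_Rat A) \<and>
     vectorspace.dim (class_ring :: rat ring) (tensor_Rat A) = n"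

end

theory Submission
  imports Defs
begin

text \<open>
  An isolated positive cone \<open>P\<close> is the only positive cone that contains a certain finite set \<open>F \<subseteq> P\<close>. Every
  way of changing \<open>P\<close> into another positive cone must therefore be noticed by \<open>F\<close>. The proof plays four such
  changes against \<open>F\<close>; isolation passes to convex subgroups and to quotients by normal convex
  subgroups, so that they can be applied in each layer of \<open>G\<close>.

  \<^item> The order may be reversed between two convex subgroups \<open>C \<subset> D\<close> (\<open>flip_layer\<close>). So \<open>F\<close> meets \<open>D - C\<close>, and
    there are only finitely many convex subgroups (\<open>finite_convex_subgroups\<close>).

  \<^item> Conjugation by \<open>h\<close> with \<open>1 < h \<le> min F\<close> gives a cone that contains \<open>F\<close>. If \<open>G\<close> has no proper
    nontrivial convex subgroup, it follows that the ordering is bi-invariant and Archimedean, and \<open>G\<close> is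
    abelian by Hoelder's theorem.

  \<^item> In an abelian group, a semigroup without \<open>1\<close> extends to a cone. So every positive element has a
    power in the semigroup generated by \<open>F\<close>; removal of redundant generators leaves a single one, and
    \<open>G\<close> has rank one (\<open>isolated_simple_rank_one\<close>).

  \<^item> Let \<open>K\<close> be a convex normal subgroup such that \<open>K\<close> and \<open>G / K\<close> have rank one and conjugation preserves
    the order of \<open>K\<close>. If the action on \<open>K\<close> is not trivial, then \<open>G\<close> acts by affine maps on a rational line
    with \<open>K\<close> as translations, and the orderings defined by base points that tend to infinity converge to
    \<open>P\<close>; if it is trivial, then \<open>G\<close> is abelian of rank greater than one. So \<open>P\<close> is not isolated
    (\<open>positive_action_not_isolated\<close>).

  The smallest nontrivial convex subgroup is thus abelian of rank one and lies in both souls. If the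
  bi-ordered soul had another nontrivial convex subgroup, its two lowest layers would form an action as in
  the fourth item, because bi-orderings are invariant under conjugation. So it has none, and it is abelian
  of rank one.

  In the finite chain of convex subgroups of the Conradian soul each one is normal in the next by
  Conrad's theorem, so all layers are abelian of rank one. By the fourth item, for consecutive convex
  subgroups \<open>M \<subset> N \<subset> D\<close> some \<open>t \<in> D\<close> reverses the order of \<open>N / M\<close>. In any left ordering of \<open>D\<close> let
  \<open>t > 1\<close> (otherwise take the inverse of \<open>t\<close>). If \<open>b \<in> N - M\<close> is positive, then so is
  \<open>b\<inverse> t = t (t\<inverse> b\<inverse> t)\<close>; hence \<open>t\<close> exceeds all of \<open>N\<close>, and \<open>N\<close> is convex in that ordering. By
  induction all left orderings of the soul have the same convex subgroups; each one is determined by the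
  signs of finitely many elements, one in each layer
  (\<open>isolated_Conradian_rigid\<close>).
\<close>

section \<open>Positive cones and convex subgroups\<close>

text \<open>
  It is enough to test \<open>1 < g < c\<close> with \<open>c \<in> C\<close>: an element \<open>g\<close> with \<open>f < g < h\<close> and \<open>f, h \<in> C\<close>
  gives \<open>1 < f\<inverse>g < f\<inverse>h\<close>.
\<close>
definition cone_convex :: "('a, 'b) monoid_scheme \<Rightarrow> 'a set \<Rightarrow> 'a set \<Rightarrow> bool" where
  "cone_convex G P C \<longleftrightarrow> subgroup C G \<and> (\<forall>c\<in>C. \<forall>g\<in>P. inv\<^bsub>G\<^esub> g \<otimes>\<^bsub>G\<^esub> c \<in> P \<longrightarrow> g \<in> C)"

text \<open>
  A basic neighbourhood in the power set may also prescribe finitely many non-members of a cone, but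
  \<open>g \<notin> P\<close> means \<open>g\<inverse> \<in> P\<close> or \<open>g = 1\<close>, so finitely many members suffice.
\<close>
definition isolated_cone :: "('a, 'b) monoid_scheme \<Rightarrow> 'a set \<Rightarrow> bool" where
  "isolated_cone G P \<longleftrightarrow>
     P \<in> LO G \<and> (\<exists>F. finite F \<and> F \<subseteq> P \<and> (\<forall>Q\<in>LO G. F \<subseteq> Q \<longrightarrow> Q = P))"

definition reverse_cone :: "('a, 'b) monoid_scheme \<Rightarrow> 'a set \<Rightarrow> 'a set" where
  "reverse_cone G P = {g \<in> carrier G. inv\<^bsub>G\<^esub> g \<in> P}"

abbreviation restricted :: "('a, 'b) monoid_scheme \<Rightarrow> 'a set \<Rightarrow> ('a, 'b) monoid_scheme" where
  "restricted G C \<equiv> G\<lparr>carrier := C\<rparr>"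

lemma (in group) inv_mult_cancel:
  assumes "x \<in> carrier G" "y \<in> carrier G"
  shows "inv x \<otimes> (x \<otimes> y) = y" "x \<otimes> (inv x \<otimes> y) = y"
  using assms by (simp_all flip: m_assoc)

lemmas (in group) word_simps = m_assoc inv_mult_group inv_mult_cancel

lemma LO_restricted_iff:
  assumes G: "Group.group G" and C: "subgroup C G"
  shows "Q \<in> LO (restricted G C) \<longleftrightarrow>
    Q \<subseteq> C \<and> (\<forall>g\<in>Q. \<forall>h\<in>Q. g \<otimes>\<^bsub>G\<^esub> h \<in> Q) \<and> \<one>\<^bsub>G\<^esub> \<notin> Q \<and>
    (\<forall>g\<in>C. g \<noteq> \<one>\<^bsub>G\<^esub> \<longrightarrow> (g \<in> Q \<longleftrightarrow> inv\<^bsub>G\<^esub> g \<notin> Q))"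
proof -
  interpret Group.group G by fact
  have "Group.group (restricted G C)" by (rule subgroup.subgroup_is_group[OF C G])
  note iff = LO_iff[OF this, of Q]
  have ops: "carrier (restricted G C) = C" "mult (restricted G C) = mult G" "one (restricted G C) = one G"
    by simp_all
  have "(\<forall>g\<in>C. g \<noteq> \<one>\<^bsub>G\<^esub> \<longrightarrow> (g \<in> Q \<longleftrightarrow> inv\<^bsub>restricted G C\<^esub> g \<notin> Q)) \<longleftrightarrow>
    (\<forall>g\<in>C. g \<noteq> \<one>\<^bsub>G\<^esub> \<longrightarrow> (g \<in> Q \<longleftrightarrow> inv\<^bsub>G\<^esub> g \<notin> Q))"
    by (rule ball_cong[OF refl]) (simp only: m_inv_consistent[OF C])
  then show ?thesis unfolding iff ops by (rule arg_cong)
qed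

locale left_ordered = Group.group G for G (structure) + fixes P assumes cone: "P \<in> LO G"
begin

lemmas cone_axioms = cone[unfolded LO_iff[OF is_group]]

lemma cone_carrier: "x \<in> P \<Longrightarrow> x \<in> carrier G"
  using cone_axioms[THEN conjunct1] by blast

lemma cone_mult: "x \<in> P \<Longrightarrow> y \<in> P \<Longrightarrow> x \<otimes> y \<in> P"
  using cone_axioms[THEN conjunct2, THEN conjunct1] by blast

lemma one_notin_cone: "\<one> \<notin> P"
  using cone_axioms by (elim conjE)

lemma inv_in_cone_iff: "x \<in> carrier G \<Longrightarrow> x \<noteq> \<one> \<Longrightarrow> inv x \<in> P \<longleftrightarrow> x \<notin> P"
  using bspec[OF cone_axioms[THEN conjunct2, THEN conjunct2, THEN conjunct2], of x] by blast

lemma cone_cases: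
  assumes "x \<in> carrier G"
  obtains "x \<in> P" | "x = \<one>" | "inv x \<in> P"
  using inv_in_cone_iff[OF assms] by blast

lemma cone_inv: "x \<in> P \<Longrightarrow> inv x \<notin> P"
  using cone_mult[of x "inv x"] one_notin_cone cone_carrier[of x] by auto

lemma cone_pow: "x \<in> P \<Longrightarrow> 0 < n \<Longrightarrow> x [^] (n::nat) \<in> P"
proof (induction n)
  case (Suc n)
  then show ?case using cone_carrier by (cases n) (auto simp: cone_mult)
qed simp

lemma pow_eq_one:
  assumes "x \<in> carrier G" "x [^] (n::nat) = \<one>" "0 < n"
  shows "x = \<one>"
proof (rule cone_cases[OF assms(1)])
  assume "x \<in> P" from cone_pow[OF this assms(3)] show ?thesis using assms one_notin_cone by simp
next
  assume "inv x \<in> P" from cone_pow[OF this assms(3)] show ?thesis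
    using assms one_notin_cone by (simp add: nat_pow_inv)
qed

lemma pow_in_cone_iff:
  assumes "x \<in> carrier G" "0 < n"
  shows "x [^] (n::nat) \<in> P \<longleftrightarrow> x \<in> P"
proof (rule cone_cases[OF assms(1)])
  assume "inv x \<in> P"
  from cone_pow[OF this assms(2)] show ?thesis
    using cone_inv[OF \<open>inv x \<in> P\<close>] cone_inv[of "inv x [^] n"] assms by (simp add: nat_pow_inv)
qed (use assms one_notin_cone cone_pow in auto)

lemma cone_eqI:
  assumes "Q \<in> LO G" "P \<subseteq> Q"
  shows "Q = P"
proof -
  interpret Q: left_ordered G Q by unfold_locales fact
  show ?thesis using assms(2) Q.cone_carrier Q.cone_inv Q.one_notin_cone cone_cases by blast
qed

lemma convex_subgroupD: "cone_convex G P C \<Longrightarrow> subgroup C G"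
  by (simp add: cone_convex_def)

lemma convex_cone_memD:
  "cone_convex G P C \<Longrightarrow> c \<in> C \<Longrightarrow> g \<in> P \<Longrightarrow> inv g \<otimes> c \<in> P \<Longrightarrow> g \<in> C"
  by (auto simp: cone_convex_def)

text \<open>
  The elements above a convex subgroup \<open>C\<close> stay above it when multiplied by \<open>C\<close> on either side. If
  \<open>x c < 1\<close> then \<open>1 < (x c)\<inverse> < c\<inverse>\<close>, and if \<open>c x < 1\<close> then \<open>1 < x < c\<inverse>\<close>; both put \<open>x\<close> in \<open>C\<close>.
\<close>
lemma convex_absorb:
  assumes C: "cone_convex G P C" and x: "x \<in> P" "x \<notin> C" and c: "c \<in> C"
  shows "x \<otimes> c \<in> P" "x \<otimes> c \<notin> C" "c \<otimes> x \<in> P" "c \<otimes> x \<notin> C"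
proof -
  interpret C: subgroup C G using C by (rule convex_subgroupD)
  have xc: "x \<in> carrier G" and cc: "c \<in> carrier G" using x c cone_carrier by auto
  have xe: "x = (x \<otimes> c) \<otimes> inv c" "x = inv c \<otimes> (c \<otimes> x)" using xc cc by (simp_all add: word_simps)
  show n1: "x \<otimes> c \<notin> C" using xe(1) C.m_closed[OF _ C.m_inv_closed[OF c]] x(2) by metis
  show n2: "c \<otimes> x \<notin> C" using xe(2) C.m_closed[OF C.m_inv_closed[OF c]] x(2) by metis
  show "x \<otimes> c \<in> P"
  proof (rule cone_cases[of "x \<otimes> c"])
    assume i: "inv (x \<otimes> c) \<in> P"
    have "inv (inv (x \<otimes> c)) \<otimes> inv c \<in> P" using x xc cc by (simp add: word_simps)
    then have "inv (x \<otimes> c) \<in> C" using convex_cone_memD[OF C C.m_inv_closed[OF c] i] by blast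
    then have "x \<otimes> c \<in> C" using C.m_inv_closed[of "inv (x \<otimes> c)"] xc cc by simp
    then show ?thesis using n1 by blast
  qed (use xc cc n1 C.one_closed in auto)
  show "c \<otimes> x \<in> P"
  proof (rule cone_cases[of "c \<otimes> x"])
    assume i: "inv (c \<otimes> x) \<in> P"
    then have "inv x \<otimes> inv c \<in> P" using xc cc by (simp add: word_simps)
    then have "x \<in> C" using convex_cone_memD[OF C C.m_inv_closed[OF c] x(1)] by blast
    then show ?thesis using x by blast
  qed (use xc cc n2 C.one_closed in auto)
qed

lemma convex_root:
  assumes C: "cone_convex G P C" and x: "x \<in> carrier G" "x [^] (n::nat) \<in> C" "0 < n"
  shows "x \<in> C"
proof -
  interpret C: subgroup C G using C by (rule convex_subgroupD)
  have *: "x \<in> C" if x: "x \<in> P" "x [^] n \<in> C" for x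
  proof (cases "n = 1")
    case True then show ?thesis using x cone_carrier by simp
  next
    case False
    then have "x [^] (n - 1) \<in> P" using cone_pow[OF x(1)] assms(4) by simp
    moreover have "x [^] n = x \<otimes> x [^] (n - 1)"
      using \<open>0 < n\<close> x cone_carrier[OF x(1)] nat_pow_mult[of x 1 "n-1"] by simp
    ultimately have "inv x \<otimes> x [^] n \<in> P" using cone_carrier[OF x(1)] by (simp add: word_simps)
    then show ?thesis using convex_cone_memD[OF C x(2) x(1)] by blast
  qed
  show ?thesis
  proof (rule cone_cases[OF x(1)])
    assume i: "inv x \<in> P"
    have "inv x [^] n \<in> C" using C.m_inv_closed[OF x(2)] x(1) by (simp add: nat_pow_inv)
    from C.m_inv_closed[OF *[OF i this]] show ?thesis using x by simp
  qed (use * x C.one_closed in auto)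
qed

lemma convex_one: "cone_convex G P {\<one>}"
  using triv_subgroup cone_inv cone_carrier by (auto simp: cone_convex_def)

lemma convex_carrier: "cone_convex G P (carrier G)"
  using subgroup_self cone_carrier by (auto simp: cone_convex_def)

lemma convex_pos_diff:
  assumes "subgroup C G" "subgroup D G" "C \<subset> D"
  obtains x where "x \<in> P" "x \<in> D" "x \<notin> C"
proof -
  obtain y where y: "y \<in> D" "y \<notin> C" using assms by blast
  then have yc: "y \<in> carrier G" using subgroup.mem_carrier[OF assms(2)] by blast
  show ?thesis
  proof (rule cone_cases[OF yc])
    assume "inv y \<in> P"
    moreover have "inv y \<in> D" "inv y \<notin> C"
      using y subgroup.m_inv_closed[OF assms(2)] subgroup.m_inv_closed[OF assms(1), of "inv y"] yc by auto
    ultimately show ?thesis using that by blast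
  qed (use y that subgroup.one_closed[OF assms(1)] in auto)
qed

lemma restrict_cone:
  assumes C: "subgroup C G"
  shows "left_ordered (restricted G C) (P \<inter> C)"
proof -
  interpret C: subgroup C G by fact
  have "P \<inter> C \<in> LO (restricted G C)"
    unfolding LO_restricted_iff[OF is_group C]
    using cone_mult one_notin_cone inv_in_cone_iff C.mem_carrier by simp
  then show ?thesis
    by (simp add: left_ordered_def left_ordered_axioms_def subgroup.subgroup_is_group[OF C is_group])
qed

lemma inv_restricted: "subgroup C G \<Longrightarrow> x \<in> C \<Longrightarrow> inv\<^bsub>restricted G C\<^esub> x = inv x"
  by (rule m_inv_consistent)

lemma restricted_convex_iff:
  assumes C: "subgroup C G"
  shows "cone_convex (restricted G C) (Q \<inter> C) D \<longleftrightarrow>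
    subgroup D G \<and> D \<subseteq> C \<and> (\<forall>c\<in>D. \<forall>g\<in>Q \<inter> C. inv g \<otimes> c \<in> Q \<longrightarrow> g \<in> D)"
proof -
  interpret C: subgroup C G by fact
  have "subgroup D (restricted G C) \<longleftrightarrow> subgroup D G \<and> D \<subseteq> C"
    using incl_subgroup[OF C, of D] subgroup_incl[OF _ C, of D] subgroup.subset[of D "restricted G C"] by auto
  then show ?thesis unfolding cone_convex_def using inv_restricted[OF C] C.m_closed C.m_inv_closed
    by (auto 0 4 simp: subset_iff)
qed

lemma convex_restrict:
  assumes "cone_convex G P D" "subgroup C G" "D \<subseteq> C"
  shows "cone_convex (restricted G C) (P \<inter> C) D"
  using assms(1,3) unfolding restricted_convex_iff[OF assms(2)] by (auto simp: cone_convex_def)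

lemma convex_trans:
  assumes C: "cone_convex G P C" and D: "cone_convex (restricted G C) (P \<inter> C) D"
  shows "cone_convex G P D" "D \<subseteq> C"
proof -
  have D': "subgroup D G" "D \<subseteq> C" "\<And>c g. c \<in> D \<Longrightarrow> g \<in> P \<inter> C \<Longrightarrow> inv g \<otimes> c \<in> P \<Longrightarrow> g \<in> D"
    using D restricted_convex_iff[OF convex_subgroupD[OF C]] by auto
  show "D \<subseteq> C" by fact
  show "cone_convex G P D" unfolding cone_convex_def
    using D' convex_cone_memD[OF C] by blast
qed

lemma reverse_cone: "left_ordered G (reverse_cone G P)"
proof -
  have "reverse_cone G P \<in> LO G"
    unfolding LO_iff[OF is_group] reverse_cone_def
    by (auto simp: inv_mult_group cone_mult one_notin_cone inv_in_cone_iff)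
  then show ?thesis by unfold_locales
qed

lemma reverse_convex:
  assumes C: "cone_convex G P C"
  shows "cone_convex G (reverse_cone G P) C"
proof -
  interpret C: subgroup C G using C by (rule convex_subgroupD)
  have "g \<in> C" if "c \<in> C" "g \<in> carrier G" "inv g \<in> P" "inv (inv g \<otimes> c) \<in> P" for c g
  proof (rule ccontr)
    assume "g \<notin> C"
    then have n: "inv g \<notin> C" using C.m_inv_closed[of "inv g"] that by auto
    show False using convex_absorb(1)[OF C that(3) n that(1)] cone_inv that(4) by blast
  qed
  then show ?thesis unfolding cone_convex_def reverse_cone_def using C.subgroup_axioms by blast
qed

text \<open>
  The ordering inside a convex subgroup can be chosen freely, because multiplication by elements of
  \<open>C\<close> maps \<open>P - C\<close> to itself.
\<close>
lemma glue_cone: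
  assumes C: "cone_convex G P C" and Q: "Q \<in> LO (restricted G C)"
  shows "Q \<union> (P - C) \<in> LO G"
proof -
  interpret C: subgroup C G using C by (rule convex_subgroupD)
  note Q_axioms = Q[unfolded LO_restricted_iff[OF is_group C.subgroup_axioms]]
  have Q': "Q \<subseteq> C" "\<And>g h. g \<in> Q \<Longrightarrow> h \<in> Q \<Longrightarrow> g \<otimes> h \<in> Q" "\<one> \<notin> Q"
    "\<And>g. g \<in> C \<Longrightarrow> g \<noteq> \<one> \<Longrightarrow> g \<in> Q \<longleftrightarrow> inv g \<notin> Q"
    using Q_axioms by (elim conjE; blast)+
  show ?thesis unfolding LO_iff[OF is_group]
  proof (intro conjI ballI impI)
    show "Q \<union> (P - C) \<subseteq> carrier G" using Q'(1) cone_carrier C.mem_carrier by blast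
    show "\<one> \<notin> Q \<union> (P - C)" using Q' by simp
    fix g h assume g: "g \<in> Q \<union> (P - C)" and h: "h \<in> Q \<union> (P - C)"
    consider "g \<in> Q" "h \<in> Q" | "g \<in> Q" "h \<in> P - C" | "g \<in> P - C" "h \<in> Q" | "g \<in> P - C" "h \<in> P - C"
      using g h by blast
    then show "g \<otimes> h \<in> Q \<union> (P - C)"
    proof cases
      case 4
      have "g \<otimes> h \<notin> C"
      proof
        assume "g \<otimes> h \<in> C"
        then have "g \<in> C" using convex_cone_memD[OF C, of "g \<otimes> h" g] 4 cone_carrier by (simp add: word_simps)
        then show False using 4 by blast
      qed
      then show ?thesis using 4 cone_mult by blast
    next
      case 1 then show ?thesis using Q'(2) by simp
    next
      case 2 then show ?thesis using convex_absorb(3,4)[OF C, of h g] Q'(1) by auto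
    next
      case 3 then show ?thesis using convex_absorb(1,2)[OF C, of g h] Q'(1) by auto
    qed
  next
    fix g assume g: "g \<in> carrier G" "g \<noteq> \<one>"
    have "inv g \<in> C \<longleftrightarrow> g \<in> C" using g C.m_inv_closed[of g] C.m_inv_closed[of "inv g"] by auto
    then show "g \<in> Q \<union> (P - C) \<longleftrightarrow> inv g \<notin> Q \<union> (P - C)"
      using Q'(1) Q'(4)[of g] g inv_in_cone_iff[OF g] by (cases "g \<in> C") auto
  qed
qed

text \<open>
  Reverse the order on \<open>D\<close>, then restore it on \<open>C\<close>.
\<close>
lemma flip_layer:
  assumes C: "cone_convex G P C" and D: "cone_convex G P D" and CD: "C \<subseteq> D"
  shows "(P - D) \<union> (reverse_cone G P \<inter> (D - C)) \<union> (P \<inter> C) \<in> LO G"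
proof -
  interpret D: left_ordered "restricted G D" "P \<inter> D" by (rule restrict_cone[OF convex_subgroupD[OF D]])
  interpret R: left_ordered G "reverse_cone G P" by (rule reverse_cone)
  interpret RD: left_ordered "restricted G D" "reverse_cone G P \<inter> D"
    by (rule R.restrict_cone[OF convex_subgroupD[OF D]])
  have C': "cone_convex (restricted G D) (reverse_cone G P \<inter> D) C"
    by (rule R.convex_restrict[OF reverse_convex[OF C] convex_subgroupD[OF D] CD])
  have "P \<inter> C \<in> LO (restricted G C)"
    using left_ordered.cone[OF restrict_cone[OF convex_subgroupD[OF C]]] .
  then have "P \<inter> C \<union> (reverse_cone G P \<inter> D - C) \<in> LO (restricted G D)"
    using RD.glue_cone[OF C'] by simp
  from glue_cone[OF D this] show ?thesis by (rule back_subst) blast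
qed

lemma convex_chain:
  assumes C: "cone_convex G P C" and D: "cone_convex G P D"
  shows "C \<subseteq> D \<or> D \<subseteq> C"
proof (rule ccontr)
  assume n: "\<not> ?thesis"
  interpret C: subgroup C G using C by (rule convex_subgroupD)
  interpret D: subgroup D G using D by (rule convex_subgroupD)
  have I: "subgroup (C \<inter> D) G" using subgroups_Inter_pair C.subgroup_axioms D.subgroup_axioms by blast
  have "C \<inter> D \<subset> C" "C \<inter> D \<subset> D" using n by auto
  then obtain c d where c: "c \<in> P" "c \<in> C" "c \<notin> D" and d: "d \<in> P" "d \<in> D" "d \<notin> C"
    by (metis convex_pos_diff[OF I C.subgroup_axioms] convex_pos_diff[OF I D.subgroup_axioms] IntI)
  have car: "c \<in> carrier G" "d \<in> carrier G" using c d cone_carrier by auto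
  show False
  proof (rule cone_cases[of "inv c \<otimes> d"])
    assume "inv c \<otimes> d = \<one>"
    then have "c = d" using car inv_mult_cancel(2)[of c d] by simp
    then show False using c d by simp
  next
    assume "inv (inv c \<otimes> d) \<in> P"
    then show False using convex_cone_memD[OF C c(2) d(1)] car d by (simp add: word_simps)
  qed (use convex_cone_memD[OF D d(2) c(1)] c car in auto)
qed

end

text \<open>
  If \<open>F\<close> determines \<open>P\<close> then \<open>F \<inter> C\<close> determines \<open>P \<inter> C\<close>, since every ordering of \<open>C\<close> extends to \<open>G\<close>
  by gluing.
\<close>
lemma isolated_cone_restrict:
  assumes "Group.group G" and iso: "isolated_cone G P" and C: "cone_convex G P C"
  shows "isolated_cone (restricted G C) (P \<inter> C)"
proof -
  interpret left_ordered G P using assms by (simp add: left_ordered_def left_ordered_axioms_def isolated_cone_def)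
  obtain F where F: "finite F" "F \<subseteq> P" "\<And>Q. Q \<in> LO G \<Longrightarrow> F \<subseteq> Q \<Longrightarrow> Q = P"
    using iso by (auto simp: isolated_cone_def)
  have "Q = P \<inter> C" if Q: "Q \<in> LO (restricted G C)" "F \<inter> C \<subseteq> Q" for Q
  proof -
    have "Q \<union> (P - C) = P" using F(3)[OF glue_cone[OF C Q(1)]] Q(2) F(2) by blast
    moreover have "Q \<subseteq> C" using Q(1)[unfolded LO_restricted_iff[OF is_group convex_subgroupD[OF C]]] by (elim conjE)
    ultimately show ?thesis by blast
  qed
  then show ?thesis unfolding isolated_cone_def
    using F left_ordered.cone[OF restrict_cone[OF convex_subgroupD[OF C]]]
    by (intro conjI exI[of _ "F \<inter> C"]) auto
qed

text \<open>
  Let \<open>F\<close> be a finite set that determines \<open>P\<close>. If \<open>C \<subset> D\<close> are convex and \<open>F\<close> misses \<open>D - C\<close>, then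
  reversing the layer \<open>D - C\<close> is not noticed by \<open>F\<close>. Hence convex subgroups have different traces on
  \<open>F\<close>.
\<close>
lemma finite_convex_subgroups:
  assumes "Group.group G" and iso: "isolated_cone G P"
  shows "finite {C. cone_convex G P C}"
proof -
  interpret left_ordered G P using assms by (simp add: left_ordered_def left_ordered_axioms_def isolated_cone_def)
  obtain F where F: "finite F" "F \<subseteq> P" "\<And>Q. Q \<in> LO G \<Longrightarrow> F \<subseteq> Q \<Longrightarrow> Q = P"
    using iso by (auto simp: isolated_cone_def)
  have *: "C = D" if C: "cone_convex G P C" and D: "cone_convex G P D" and "C \<subseteq> D" "F \<inter> C = F \<inter> D" for C D
  proof (rule ccontr)
    let ?Q = "(P - D) \<union> (reverse_cone G P \<inter> (D - C)) \<union> (P \<inter> C)"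
    assume "C \<noteq> D"
    with that have "C \<subset> D" by blast
    then obtain x where x: "x \<in> P" "x \<in> D" "x \<notin> C"
      by (rule convex_pos_diff[OF convex_subgroupD[OF C] convex_subgroupD[OF D]])
    have "?Q = P"
      by (rule F(3)[OF flip_layer[OF C D \<open>C \<subseteq> D\<close>]]) (use F(2) that(4) in blast)
    then have "x \<in> reverse_cone G P" using x by blast
    then show False using cone_inv[OF x(1)] by (simp add: reverse_cone_def)
  qed
  have inj: "inj_on (\<lambda>C. F \<inter> C) {C. cone_convex G P C}"
  proof (rule inj_onI, clarsimp)
    fix C D assume "cone_convex G P C" "cone_convex G P D" "F \<inter> C = F \<inter> D"
    then show "C = D" using *[of C D] *[of D C] convex_chain[of C D] by auto
  qed
  show ?thesis by (rule inj_on_finite[OF inj, of "Pow F"]) (use F(1) in auto)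
qed

section \<open>Conradian orderings and Archimedean orderings\<close>

definition Conradian_cone :: "('a, 'b) monoid_scheme \<Rightarrow> 'a set \<Rightarrow> bool" where
  "Conradian_cone G P \<longleftrightarrow>
     (\<forall>f\<in>P. \<forall>g\<in>P. \<exists>n::nat. inv\<^bsub>G\<^esub> f \<otimes>\<^bsub>G\<^esub> (g \<otimes>\<^bsub>G\<^esub> f [^]\<^bsub>G\<^esub> n) \<in> P)"

context left_ordered
begin

definition prec :: "'a \<Rightarrow> 'a \<Rightarrow> bool" (infix \<open><\<^sub>P\<close> 50) where
  "x <\<^sub>P y \<longleftrightarrow> x \<in> carrier G \<and> y \<in> carrier G \<and> inv x \<otimes> y \<in> P"

abbreviation preceq :: "'a \<Rightarrow> 'a \<Rightarrow> bool" (infix \<open>\<le>\<^sub>P\<close> 50) where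
  "x \<le>\<^sub>P y \<equiv> x <\<^sub>P y \<or> x = y"

lemma prec_carrier: "x <\<^sub>P y \<Longrightarrow> x \<in> carrier G" "x <\<^sub>P y \<Longrightarrow> y \<in> carrier G"
  by (simp_all add: prec_def)

lemma prec_trans [trans]:
  assumes "x <\<^sub>P y" "y <\<^sub>P z"
  shows "x <\<^sub>P z"
proof -
  have "(inv x \<otimes> y) \<otimes> (inv y \<otimes> z) \<in> P" using assms cone_mult unfolding prec_def by blast
  then show ?thesis using assms by (simp add: prec_def word_simps)
qed

lemma prec_irrefl: "\<not> x <\<^sub>P x"
  using one_notin_cone by (auto simp: prec_def)

lemma prec_asym: "x <\<^sub>P y \<Longrightarrow> \<not> y \<le>\<^sub>P x"
  using prec_irrefl prec_trans by blast

lemma prec_linear: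
  assumes "x \<in> carrier G" "y \<in> carrier G"
  shows "x <\<^sub>P y \<or> x = y \<or> y <\<^sub>P x"
proof (rule cone_cases[of "inv x \<otimes> y"])
  assume "inv x \<otimes> y = \<one>"
  then have "x = y" using assms inv_mult_cancel(2)[of x y] by simp
  then show ?thesis by simp
qed (use assms in \<open>auto simp: prec_def inv_mult_group\<close>)

lemma prec_mult_left: "x <\<^sub>P y \<Longrightarrow> a \<in> carrier G \<Longrightarrow> a \<otimes> x <\<^sub>P a \<otimes> y"
  by (simp add: prec_def word_simps)

lemma preceq_mult_left: "x \<le>\<^sub>P y \<Longrightarrow> a \<in> carrier G \<Longrightarrow> a \<otimes> x \<le>\<^sub>P a \<otimes> y"
  using prec_mult_left by blast

lemma one_prec_iff: "\<one> <\<^sub>P x \<longleftrightarrow> x \<in> P"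
  using cone_carrier by (auto simp: prec_def)

lemma prec_mult_cone: "a \<in> carrier G \<Longrightarrow> x \<in> P \<Longrightarrow> a <\<^sub>P a \<otimes> x"
  using cone_carrier by (simp add: prec_def word_simps)

lemma prec_pow: "e \<in> P \<Longrightarrow> m < n \<Longrightarrow> e [^] (m::nat) <\<^sub>P e [^] (n::nat)"
proof -
  assume e: "e \<in> P" and "m < n"
  then have "e [^] n = e [^] m \<otimes> e [^] (n - m)" using cone_carrier[OF e] by (simp add: nat_pow_mult)
  then show ?thesis using prec_mult_cone[of "e [^] m" "e [^] (n - m)"] cone_pow[OF e, of "n-m"] \<open>m < n\<close> cone_carrier[OF e]
    by simp
qed

lemma preceq_pow: "e \<in> P \<Longrightarrow> m \<le> n \<Longrightarrow> e [^] (m::nat) \<le>\<^sub>P e [^] (n::nat)"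
  using prec_pow by (cases "m = n") auto

lemma Conradian_coneD:
  assumes "Conradian_cone G P" "f \<in> P" "g \<in> P"
  obtains n :: nat where "f <\<^sub>P g \<otimes> f [^] n"
  using assms cone_carrier unfolding Conradian_cone_def prec_def by fastforce

text \<open>
  The exponent \<open>2\<close> always works in the Conradian condition. Otherwise \<open>h = f g\<close> satisfies \<open>h g \<le> g\<close>, so
  all powers of \<open>h\<close> stay below \<open>g\<close>, and \<open>f h\<^sup>n < f g = h\<close> for all \<open>n\<close> contradicts the condition for the
  pair \<open>h, f\<close>.
\<close>
lemma Conradian_no_crossing:
  assumes con: "Conradian_cone G P" and f: "f \<in> P" and g: "g \<in> P"
  shows "g <\<^sub>P f \<otimes> g \<otimes> g"
proof (rule ccontr)
  assume n: "\<not> ?thesis"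
  have fg: "f \<in> carrier G" "g \<in> carrier G" using f g cone_carrier by auto
  define h where "h = f \<otimes> g"
  have h: "h \<in> P" "h \<in> carrier G" using f g fg by (auto simp: h_def cone_mult)
  have hg: "h \<otimes> g \<le>\<^sub>P g" using n prec_linear[of g "h \<otimes> g"] fg h by (auto simp: h_def)
  have "h [^] n \<otimes> g \<le>\<^sub>P g" for n :: nat
  proof (induction n)
    case (Suc n)
    have "h [^] Suc n \<otimes> g = h [^] n \<otimes> (h \<otimes> g)" using h fg by (simp add: m_assoc)
    then show ?case using Suc preceq_mult_left[OF hg, of "h [^] n"] h prec_trans by auto
  qed (use fg in simp)
  then have *: "h [^] n <\<^sub>P g" for n :: nat
    using prec_mult_cone[of "h [^] n" g] h g prec_trans by (metis nat_pow_closed)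
  obtain n :: nat where "h <\<^sub>P f \<otimes> h [^] n" using Conradian_coneD[OF con h(1) f] .
  moreover have "f \<otimes> h [^] n <\<^sub>P h" using prec_mult_left[OF *] fg by (simp add: h_def)
  ultimately show False using prec_asym by blast
qed

text \<open>
  Again the exponent \<open>2\<close> works. For \<open>f, g < 1\<close> the element \<open>f' = f\<inverse> g f\<^sup>2\<close> has to be negative; if it
  were positive, then \<open>Conradian_no_crossing\<close> for \<open>f'\<close> and \<open>f\<inverse>\<close> would give \<open>g > 1\<close>.
\<close>
lemma Conradian_reverse:
  assumes con: "Conradian_cone G P"
  shows "Conradian_cone G (reverse_cone G P)"
  unfolding Conradian_cone_def
proof (intro ballI)
  fix f g assume "f \<in> reverse_cone G P" "g \<in> reverse_cone G P"
  then have f: "f \<in> carrier G" "inv f \<in> P" and g: "g \<in> carrier G" "inv g \<in> P" by (auto simp: reverse_cone_def)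
  define f' where "f' = inv f \<otimes> (g \<otimes> (f \<otimes> f))"
  have f': "f' \<in> carrier G" using f g by (simp add: f'_def)
  have "inv f' \<in> P"
  proof (rule cone_cases[OF f'])
    assume "f' \<in> P"
    from Conradian_no_crossing[OF con this f(2)] have "g \<in> P"
      using f g by (simp add: f'_def prec_def word_simps)
    then show ?thesis using g cone_inv by blast
  next
    assume "f' = \<one>"
    then have "f \<otimes> f' \<otimes> inv f \<otimes> inv f = inv f" using f by (simp add: word_simps)
    then have "g = inv f" using f g by (simp add: f'_def word_simps)
    then show ?thesis using f g cone_inv[of "inv f"] by simp
  qed
  moreover have "f' = inv f \<otimes> (g \<otimes> f [^] (2::nat))" using f by (simp add: f'_def numeral_2_eq_2)
  ultimately show "\<exists>n::nat. inv f \<otimes> (g \<otimes> f [^] n) \<in> reverse_cone G P"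
    using f' unfolding reverse_cone_def by blast
qed

text \<open>
  This is \<open>Conradian_no_crossing\<close> for the positive elements \<open>x\<inverse> e\<close> and \<open>e\<close>. It bounds products: if
  \<open>x, y < e\<close> then \<open>x y < x e < e\<^sup>3\<close>.
\<close>
lemma Conradian_shift:
  assumes con: "Conradian_cone G P" and e: "e \<in> P" and x: "x <\<^sub>P e"
  shows "x \<otimes> e <\<^sub>P e [^] (3::nat)"
proof -
  have c: "x \<in> carrier G" "e \<in> carrier G" using x prec_carrier by auto
  have "inv x \<otimes> e \<in> P" using x by (simp add: prec_def)
  from prec_mult_left[OF Conradian_no_crossing[OF con this e] c(1)]
  show ?thesis using c by (simp add: word_simps numeral_3_eq_3)
qed

text \<open>
  The convex hull of the powers of \<open>e\<close>. The lower bound on \<open>x\<close> is an upper bound on its inverse, which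
  makes closure under inverses evident; all that has to be supplied is that products of bounded
  elements are bounded.
\<close>
lemma power_hull_convex:
  assumes e: "e \<in> P" and S: "subgroup S G"
    and prod: "\<And>x y (n::nat). x <\<^sub>P e [^] n \<Longrightarrow> y <\<^sub>P e [^] n \<Longrightarrow> 0 < n \<Longrightarrow> \<exists>k::nat. x \<otimes> y <\<^sub>P e [^] k"
    and bounded: "\<And>x (n::nat). x \<in> P \<Longrightarrow> x <\<^sub>P e [^] n \<Longrightarrow> x \<in> S"
  defines "A \<equiv> {x \<in> S. \<exists>n::nat. x <\<^sub>P e [^] n \<and> inv x <\<^sub>P e [^] n}"
  shows "cone_convex G P A" "e \<in> A"
proof -
  interpret S: subgroup S G by fact
  have ec: "e \<in> carrier G" using e cone_carrier by blast
  have up: "x <\<^sub>P e [^] n" if "x <\<^sub>P e [^] m" "m \<le> n" for x and m n :: nat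
    using that preceq_pow[OF e that(2)] prec_trans by auto
  have pos: "x \<in> A" if x: "x \<in> P" "x <\<^sub>P e [^] n" for x and n :: nat
  proof -
    have "inv x <\<^sub>P \<one>" using x cone_carrier by (simp add: prec_def)
    then have "inv x <\<^sub>P e [^] n" using up[of "inv x" 0 n] by simp
    then show ?thesis using x bounded by (auto simp: A_def)
  qed
  show "e \<in> A" using pos[OF e, of 2] prec_pow[OF e, of 1 2] ec by simp
  have "subgroup A G"
  proof (rule subgroupI)
    show "A \<subseteq> carrier G" "A \<noteq> {}" using \<open>e \<in> A\<close> S.mem_carrier by (auto simp: A_def)
    show "inv x \<in> A" if "x \<in> A" for x using that S.m_inv_closed S.mem_carrier by (auto simp: A_def)
    fix x y assume "x \<in> A" "y \<in> A"
    then obtain m n :: nat where xy: "x \<in> S" "y \<in> S"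
      "x <\<^sub>P e [^] m" "inv x <\<^sub>P e [^] m" "y <\<^sub>P e [^] n" "inv y <\<^sub>P e [^] n" by (auto simp: A_def)
    let ?k = "Suc (m + n)"
    have "x <\<^sub>P e [^] ?k" "inv x <\<^sub>P e [^] ?k" "y <\<^sub>P e [^] ?k" "inv y <\<^sub>P e [^] ?k"
      using xy up[of _ m ?k] up[of _ n ?k] by (simp_all del: nat_pow_Suc)
    then obtain i j :: nat where "x \<otimes> y <\<^sub>P e [^] i" "inv y \<otimes> inv x <\<^sub>P e [^] j"
      using prod[of x ?k y] prod[of "inv y" ?k "inv x"] by blast
    then have "x \<otimes> y <\<^sub>P e [^] (i + j)" "inv y \<otimes> inv x <\<^sub>P e [^] (i + j)"
      using up[of _ i "i + j"] up[of _ j "i + j"] by simp_all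
    then show "x \<otimes> y \<in> A" using xy S.m_closed S.mem_carrier unfolding A_def by (auto simp: inv_mult_group)
  qed
  moreover have "g \<in> A" if c: "c \<in> A" "g \<in> P" "inv g \<otimes> c \<in> P" for c g
  proof -
    obtain n :: nat where n: "c <\<^sub>P e [^] n" "c \<in> carrier G" using c S.mem_carrier by (auto simp: A_def)
    then have "g <\<^sub>P e [^] n" using c cone_carrier prec_trans[of g c] by (simp add: prec_def)
    then show ?thesis by (rule pos[OF c(2)])
  qed
  ultimately show "cone_convex G P A" by (auto simp: cone_convex_def)
qed

lemma Conradian_power_hull_convex:
  assumes con: "Conradian_cone G P" and e: "e \<in> P"
  shows "cone_convex G P {x \<in> carrier G. \<exists>n::nat. x <\<^sub>P e [^] n \<and> inv x <\<^sub>P e [^] n}"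
    and "e \<in> {x \<in> carrier G. \<exists>n::nat. x <\<^sub>P e [^] n \<and> inv x <\<^sub>P e [^] n}"
proof -
  have prod: "\<exists>k::nat. x \<otimes> y <\<^sub>P e [^] k" if "x <\<^sub>P e [^] n" "y <\<^sub>P e [^] n" "0 < n" for x y and n :: nat
  proof -
    have "x \<otimes> y <\<^sub>P x \<otimes> e [^] n" using that prec_mult_left prec_carrier by blast
    also have "\<dots> <\<^sub>P (e [^] n) [^] (3::nat)" using Conradian_shift[OF con cone_pow[OF e]] that by blast
    finally show ?thesis using e cone_carrier by (auto simp: nat_pow_pow)
  qed
  show "cone_convex G P {x \<in> carrier G. \<exists>n::nat. x <\<^sub>P e [^] n \<and> inv x <\<^sub>P e [^] n}"
    by (rule power_hull_convex(1)[OF e subgroup_self]) (use prod cone_carrier in blast)+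
  show "e \<in> {x \<in> carrier G. \<exists>n::nat. x <\<^sub>P e [^] n \<and> inv x <\<^sub>P e [^] n}"
    by (rule power_hull_convex(2)[OF e subgroup_self]) (use prod cone_carrier in blast)+
qed

lemma Conradian_simple_archimedean:
  assumes con: "Conradian_cone G P"
    and simple: "\<And>C. cone_convex G P C \<Longrightarrow> C = {\<one>} \<or> C = carrier G"
    and e: "e \<in> P" and x: "x \<in> carrier G"
  obtains n :: nat where "x <\<^sub>P e [^] n"
proof -
  note A = Conradian_power_hull_convex[OF con e]
  have "e \<noteq> \<one>" using e one_notin_cone by blast
  then have "x \<in> {x \<in> carrier G. \<exists>n::nat. x <\<^sub>P e [^] n \<and> inv x <\<^sub>P e [^] n}"
    using simple[OF A(1)] A(2) x by blast
  then show ?thesis using that by blast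
qed

lemma invariant_Conradian:
  assumes "\<And>h x. h \<in> carrier G \<Longrightarrow> x \<in> P \<Longrightarrow> h \<otimes> x \<otimes> inv h \<in> P"
  shows "Conradian_cone G P"
  unfolding Conradian_cone_def
proof (intro ballI exI[of _ 1])
  fix f g assume fg: "f \<in> P" "g \<in> P"
  then have "f \<in> carrier G" "g \<in> carrier G" using cone_carrier by auto
  then show "inv f \<otimes> (g \<otimes> f [^] (1::nat)) \<in> P" using assms[of "inv f" g] fg by (simp add: m_assoc)
qed

lemma archimedean_floor:
  assumes e: "e \<in> P" and x: "x \<in> P \<or> x = \<one>" and bound: "x <\<^sub>P e [^] (k::nat)"
  obtains p :: nat where "e [^] p \<le>\<^sub>P x" "x <\<^sub>P e [^] Suc p"
proof -
  define n where "n = (LEAST n::nat. x <\<^sub>P e [^] n)"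
  have n: "x <\<^sub>P e [^] n" unfolding n_def by (rule LeastI, rule bound)
  have "n \<noteq> 0"
  proof
    assume "n = 0"
    then have "x <\<^sub>P \<one>" using n by simp
    moreover have "\<one> \<le>\<^sub>P x" using x one_prec_iff by auto
    ultimately show False using prec_asym by blast
  qed
  then obtain p where p: "n = Suc p" using not0_implies_Suc by blast
  have "\<not> x <\<^sub>P e [^] p" using not_less_Least[of p "\<lambda>n. x <\<^sub>P e [^] n"] p n_def by simp
  then have "e [^] p \<le>\<^sub>P x" using prec_linear[of x "e [^] p"] x e cone_carrier by auto
  then show ?thesis using that n p by blast
qed

lemma cone_commutes_imp_comm:
  assumes PP: "\<And>x y. x \<in> P \<Longrightarrow> y \<in> P \<Longrightarrow> x \<otimes> y = y \<otimes> x"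
  shows "comm_group G"
proof -
  have invc: "x \<otimes> y = y \<otimes> x" if "x \<in> carrier G" "y \<in> carrier G" "inv x \<otimes> y = y \<otimes> inv x" for x y
  proof -
    have "x \<otimes> (inv x \<otimes> y) \<otimes> x = x \<otimes> (y \<otimes> inv x) \<otimes> x" using that by simp
    then show ?thesis using that(1,2) by (simp add: word_simps)
  qed
  have PG: "x \<otimes> y = y \<otimes> x" if "x \<in> P" "y \<in> carrier G" for x y
  proof (rule cone_cases[OF that(2)])
    assume "inv y \<in> P"
    then show ?thesis using invc[of y x] PP[of x "inv y"] that cone_carrier by simp
  qed (use that PP cone_carrier in auto)
  show ?thesis
  proof (rule group_comm_groupI)
    fix x y assume xy: "x \<in> carrier G" "y \<in> carrier G"
    show "x \<otimes> y = y \<otimes> x"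
    proof (rule cone_cases[OF xy(1)])
      assume "inv x \<in> P"
      then show ?thesis using invc[of x y] PG[of "inv x" y] xy by simp
    qed (use xy PG in auto)
  qed
qed

text \<open>
  Hoelder's theorem. Suppose \<open>c = (y x)\<inverse> (x y) > 1\<close>. If some \<open>d > 1\<close> has \<open>d\<^sup>2 \<le> c\<close>, choose
  \<open>d\<^sup>p \<le> x < d\<^sup>p\<^sup>+\<^sup>1\<close> and \<open>d\<^sup>q \<le> y < d\<^sup>q\<^sup>+\<^sup>1\<close>; then \<open>x y < d\<^sup>p\<^sup>+\<^sup>q\<^sup>+\<^sup>2 \<le> y x c = x y\<close>. If there is no such \<open>d\<close>
  then \<open>c\<close> is the least positive element, because \<open>d < c\<close> would make one of \<open>d\<close>, \<open>d\<inverse> c\<close> small enough;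
  so \<open>x\<close> and \<open>y\<close> are powers of \<open>c\<close> and commute.
\<close>
lemma archimedean_invariant_comm:
  assumes inv: "\<And>h x. h \<in> carrier G \<Longrightarrow> x \<in> P \<Longrightarrow> h \<otimes> x \<otimes> inv h \<in> P"
    and arch: "\<And>e x. e \<in> P \<Longrightarrow> x \<in> P \<Longrightarrow> \<exists>n::nat. x <\<^sub>P e [^] n"
  shows "comm_group G"
proof -
  have right: "x \<otimes> a <\<^sub>P y \<otimes> a" if "x <\<^sub>P y" "a \<in> carrier G" for x y a
    using inv[of "inv a" "inv x \<otimes> y"] that by (simp add: prec_def word_simps)
  then have righteq: "x \<otimes> a \<le>\<^sub>P y \<otimes> a" if "x \<le>\<^sub>P y" "a \<in> carrier G" for x y a using that by blast
  have not_less: False if xy: "x \<in> P" "y \<in> P" "y \<otimes> x <\<^sub>P x \<otimes> y" for x y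
  proof -
    have c: "x \<in> carrier G" "y \<in> carrier G" using xy cone_carrier by auto
    define c where "c = inv (y \<otimes> x) \<otimes> (x \<otimes> y)"
    have cP: "c \<in> P" using xy(3) by (simp add: prec_def c_def)
    then have cc: "c \<in> carrier G" using cone_carrier by blast
    show False
    proof (cases "\<exists>d\<in>P. d \<otimes> d \<le>\<^sub>P c")
      case True
      then obtain d where d: "d \<in> P" "d \<otimes> d \<le>\<^sub>P c" by blast
      have dc: "d \<in> carrier G" using d cone_carrier by blast
      obtain p :: nat where p: "d [^] p \<le>\<^sub>P x" "x <\<^sub>P d [^] Suc p"
        using arch[OF d(1) xy(1)] archimedean_floor[OF d(1)] xy(1) by metis
      obtain q :: nat where q: "d [^] q \<le>\<^sub>P y" "y <\<^sub>P d [^] Suc q"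
        using arch[OF d(1) xy(2)] archimedean_floor[OF d(1)] xy(2) by metis
      have "x \<otimes> y <\<^sub>P x \<otimes> d [^] Suc q" using prec_mult_left[OF q(2) c(1)] .
      also have "\<dots> <\<^sub>P d [^] Suc p \<otimes> d [^] Suc q" using right[OF p(2)] dc by blast
      also have "\<dots> = d [^] (q + p) \<otimes> (d \<otimes> d)"
        using dc nat_pow_mult[of d "Suc p" "Suc q"] nat_pow_mult[of d "q + p" 2] nat_pow_mult[of d 1 1]
        by (simp add: ac_simps numeral_2_eq_2 m_assoc)
      finally have 1: "x \<otimes> y <\<^sub>P d [^] (q + p) \<otimes> (d \<otimes> d)" .
      have 2: "d [^] (q + p) \<otimes> (d \<otimes> d) \<le>\<^sub>P d [^] (q + p) \<otimes> c"
        using preceq_mult_left[OF d(2)] dc by blast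
      have "d [^] q \<otimes> d [^] p \<le>\<^sub>P d [^] q \<otimes> x" using preceq_mult_left[OF p(1)] dc by blast
      moreover have "d [^] q \<otimes> x \<le>\<^sub>P y \<otimes> x" using righteq[OF q(1)] c by blast
      ultimately have "d [^] (q + p) \<le>\<^sub>P y \<otimes> x" using dc prec_trans by (metis nat_pow_mult)
      then have 3: "d [^] (q + p) \<otimes> c \<le>\<^sub>P (y \<otimes> x) \<otimes> c" by (rule righteq[OF _ cc])
      have "(y \<otimes> x) \<otimes> c = x \<otimes> y" using c by (simp add: c_def word_simps)
      moreover have "x \<otimes> y <\<^sub>P d [^] (q + p) \<otimes> c" using 1 2 prec_trans[OF 1] by auto
      ultimately have "x \<otimes> y <\<^sub>P x \<otimes> y" using 3 prec_trans[of "x \<otimes> y" "d [^] (q + p) \<otimes> c"] by auto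
      then show False using prec_irrefl by blast
    next
      case no: False
      have least: "\<not> d <\<^sub>P c" if d: "d \<in> P" for d
      proof
        assume "d <\<^sub>P c"
        define d' where "d' = inv d \<otimes> c"
        have dc: "d \<in> carrier G" using d cone_carrier by blast
        have d': "d' \<in> P" "d' \<in> carrier G" "d \<otimes> d' = c"
          using \<open>d <\<^sub>P c\<close> dc cc by (auto simp: d'_def prec_def word_simps)
        have "c <\<^sub>P d \<otimes> d" using no d prec_linear[of c "d \<otimes> d"] cc dc by blast
        then have "d' <\<^sub>P d" 
          using prec_mult_left[of c "d \<otimes> d" "inv d"] dc by (simp add: inv_mult_cancel d'_def)
        then have "d' \<otimes> d' <\<^sub>P c" using right[OF _ d'(2)] d'(3) by metis
        then show False using no d'(1) by blast
      qed
      have pow: "\<exists>p::nat. z = c [^] p" if z: "z \<in> P" for z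
      proof -
        have zc: "z \<in> carrier G" using z cone_carrier by blast
        obtain p :: nat where p: "c [^] p \<le>\<^sub>P z" "z <\<^sub>P c [^] Suc p"
          using arch[OF cP z] archimedean_floor[OF cP] z by metis
        have "z <\<^sub>P c [^] p \<otimes> c" using p(2) by simp
        then have "inv (c [^] p) \<otimes> z <\<^sub>P c"
          using prec_mult_left[of z "c [^] p \<otimes> c" "inv (c [^] p)"] cc by (simp add: word_simps)
        then have "inv (c [^] p) \<otimes> z \<notin> P" using least by blast
        then have "z = c [^] p" using p(1) by (auto simp: prec_def)
        then show ?thesis by blast
      qed
      obtain p q :: nat where "x = c [^] p" "y = c [^] q" using pow xy by metis
      then have "y \<otimes> x = x \<otimes> y" using cc by (simp add: nat_pow_mult ac_simps)
      then show False using xy(3) prec_irrefl by simp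
    qed
  qed
  have "x \<otimes> y = y \<otimes> x" if "x \<in> P" "y \<in> P" for x y
    using not_less[of x y] not_less[of y x] prec_linear[of "x \<otimes> y" "y \<otimes> x"] that cone_carrier by blast
  then show ?thesis by (rule cone_commutes_imp_comm)
qed

end

section \<open>Isolated orderings without proper convex subgroups\<close>

lemma conjugate_cone:
  fixes G (structure)
  assumes G: "Group.group G" and N: "N \<lhd> G" and Q: "Q \<in> LO (restricted G N)" and d: "d \<in> carrier G"
  shows "{x \<in> N. inv d \<otimes> x \<otimes> d \<in> Q} \<in> LO (restricted G N)" (is "?Q \<in> _")
proof -
  interpret Group.group G by fact
  interpret N: normal N G by fact
  have sub: "subgroup N G" by (rule N.subgroup_axioms)
  note Q_axioms = Q[unfolded LO_restricted_iff[OF G sub]]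
  have Q': "\<And>g h. g \<in> Q \<Longrightarrow> h \<in> Q \<Longrightarrow> g \<otimes> h \<in> Q" "\<one> \<notin> Q"
    "\<And>g. g \<in> N \<Longrightarrow> g \<noteq> \<one> \<Longrightarrow> g \<in> Q \<longleftrightarrow> inv g \<notin> Q"
    using Q_axioms by (elim conjE; blast)+
  show ?thesis unfolding LO_restricted_iff[OF G sub]
  proof (intro conjI ballI impI)
    show "?Q \<subseteq> N" by blast
    show "\<one> \<notin> ?Q" using Q'(2) d by simp
    fix g h assume gh: "g \<in> ?Q" "h \<in> ?Q"
    then have c: "g \<in> carrier G" "h \<in> carrier G" "g \<in> N" "h \<in> N" using N.mem_carrier by auto
    have "(inv d \<otimes> g \<otimes> d) \<otimes> (inv d \<otimes> h \<otimes> d) \<in> Q"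
      using gh Q'(1) by blast
    then show "g \<otimes> h \<in> ?Q" using c d N.m_closed[OF c(3,4)] by (simp add: word_simps)
  next
    fix g assume g: "g \<in> N" "g \<noteq> \<one>"
    have c: "g \<in> carrier G" using g N.mem_carrier by blast
    let ?y = "inv d \<otimes> g \<otimes> d"
    have y: "?y \<in> N" using N.inv_op_closed1[OF d g(1)] .
    have "?y \<noteq> \<one>"
    proof
      assume "?y = \<one>"
      then have "d \<otimes> ?y \<otimes> inv d = \<one>" using d by simp
      then show False using g c d by (simp add: word_simps)
    qed
    then have "?y \<in> Q \<longleftrightarrow> inv ?y \<notin> Q" using Q'(3) y by blast
    moreover have "inv ?y = inv d \<otimes> inv g \<otimes> d" using c d by (simp add: word_simps)
    ultimately show "g \<in> ?Q \<longleftrightarrow> inv g \<notin> ?Q" using g N.m_inv_closed[OF g(1)] by simp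
  qed
qed

context left_ordered
begin

lemma finite_cone_least:
  assumes "finite S" "S \<noteq> {}" "S \<subseteq> carrier G"
  obtains m where "m \<in> S" "\<And>x. x \<in> S \<Longrightarrow> m \<le>\<^sub>P x"
proof -
  have "\<exists>m\<in>S. \<forall>x\<in>S. m \<le>\<^sub>P x" using assms
  proof (induction S rule: finite_ne_induct)
    case (insert a S)
    then obtain m where m: "m \<in> S" "\<forall>x\<in>S. m \<le>\<^sub>P x" by auto
    have "a <\<^sub>P m \<or> m \<le>\<^sub>P a" using prec_linear[of a m] insert m by auto
    then show ?case
    proof
      assume "a <\<^sub>P m"
      then have "\<forall>x\<in>insert a S. a \<le>\<^sub>P x" using m(2) prec_trans by blast
      then show ?case by blast
    qed (use m in blast)
  qed simp
  then show ?thesis using that by blast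
qed

text \<open>
  Let \<open>m\<close> be the least element of a finite set \<open>F\<close> that determines \<open>P\<close>. If \<open>1 < h \<le> m\<close> then
  \<open>h\<inverse> g h > 1\<close> for all \<open>g \<in> F\<close>, because \<open>h\<inverse> g \<ge> 1\<close>; so the cone \<open>h P h\<inverse>\<close> contains \<open>F\<close> and equals
  \<open>P\<close>. The stabilizer \<open>H\<close> of \<open>P\<close> therefore contains the interval from \<open>1\<close> to \<open>m\<close>, hence everything
  between two powers of \<open>m\<close>, and this convex hull is all of \<open>G\<close>.
\<close>
lemma isolated_simple_invariant:
  assumes iso: "isolated_cone G P"
    and simple: "\<And>C. cone_convex G P C \<Longrightarrow> C = {\<one>} \<or> C = carrier G"
    and h: "h \<in> carrier G" and x: "x \<in> P"
  shows "h \<otimes> x \<otimes> inv h \<in> P"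
proof -
  obtain F where F: "finite F" "F \<subseteq> P" "\<And>Q. Q \<in> LO G \<Longrightarrow> F \<subseteq> Q \<Longrightarrow> Q = P"
    using iso by (auto simp: isolated_cone_def)
  obtain m where m: "m \<in> insert x F" and least: "\<And>g. g \<in> insert x F \<Longrightarrow> m \<le>\<^sub>P g"
    by (rule finite_cone_least[of "insert x F"]) (use F x cone_carrier in auto)
  have mP: "m \<in> P" and mc: "m \<in> carrier G" using m F x cone_carrier by auto
  define H where "H = {h \<in> carrier G. \<forall>x\<in>P. h \<otimes> x \<otimes> inv h \<in> P \<and> inv h \<otimes> x \<otimes> h \<in> P}"
  have Hc: "h \<in> H \<Longrightarrow> h \<in> carrier G" for h by (simp add: H_def)
  have one_H: "\<one> \<in> H" using cone_carrier by (simp add: H_def)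
  have H_mult: "g \<otimes> h \<in> H" if gh: "g \<in> H" "h \<in> H" for g h
  proof -
    have c: "g \<in> carrier G" "h \<in> carrier G" using gh Hc by auto
    have "g \<otimes> h \<otimes> x \<otimes> inv (g \<otimes> h) \<in> P \<and> inv (g \<otimes> h) \<otimes> x \<otimes> (g \<otimes> h) \<in> P" if x: "x \<in> P" for x
    proof -
      have "g \<otimes> (h \<otimes> x \<otimes> inv h) \<otimes> inv g \<in> P" "inv h \<otimes> (inv g \<otimes> x \<otimes> g) \<otimes> h \<in> P"
        using gh x unfolding H_def by auto
      then show ?thesis using c cone_carrier[OF x] by (simp add: word_simps)
    qed
    then show ?thesis using c unfolding H_def by blast
  qed
  have H_inv: "inv h \<in> H" if "h \<in> H" for h using that by (simp add: H_def)
  have right: "a \<otimes> h <\<^sub>P b \<otimes> h" if "h \<in> H" "a <\<^sub>P b" for a b h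
  proof -
    have "inv h \<otimes> (inv a \<otimes> b) \<otimes> h \<in> P" using that unfolding H_def prec_def by blast
    then show ?thesis using that Hc by (simp add: prec_def word_simps)
  qed
  have small: "h \<in> H" if h: "h \<in> P" "h \<le>\<^sub>P m" for h
  proof -
    have hc: "h \<in> carrier G" using h cone_carrier by blast
    let ?Q = "{x \<in> carrier G. inv h \<otimes> x \<otimes> h \<in> P}"
    have "normal (carrier G) G" using subgroup_self by (simp add: normal_inv_iff)
    then have Q: "?Q \<in> LO G" using conjugate_cone[OF is_group, of "carrier G" P h] hc cone by simp
    have "g \<in> ?Q" if g: "g \<in> F" for g
    proof -
      have gP: "g \<in> P" "g \<in> carrier G" using F g cone_carrier by auto
      have "h \<le>\<^sub>P g" using least[of g] g h(2) prec_trans by blast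
      then have "inv h \<otimes> g \<in> P \<or> inv h \<otimes> g = \<one>" using hc by (auto simp: prec_def)
      then have "inv h \<otimes> g \<otimes> h \<in> P" using cone_mult[of "inv h \<otimes> g" h] h hc by auto
      then show ?thesis using gP by simp
    qed
    then have QP: "?Q = P" using F(3)[OF Q] by blast
    have "h \<otimes> y \<otimes> inv h \<in> P \<and> inv h \<otimes> y \<otimes> h \<in> P" if y: "y \<in> P" for y
    proof
      show "inv h \<otimes> y \<otimes> h \<in> P" using QP y by blast
      have "h \<otimes> y \<otimes> inv h \<in> ?Q" using y hc cone_carrier[OF y] by (simp add: word_simps)
      then show "h \<otimes> y \<otimes> inv h \<in> P" using QP by blast
    qed
    then show ?thesis using hc by (simp add: H_def)
  qed
  have mH: "m \<in> H" using small mP by blast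
  have mpH: "m [^] (n::nat) \<in> H" for n by (induction n) (auto simp: one_H H_mult mH)
  have bounded: "z \<in> H" if "z \<in> P" "z \<le>\<^sub>P m [^] (n::nat)" for n z
    using that
  proof (induction n arbitrary: z)
    case 0
    then have "z \<le>\<^sub>P \<one>" "\<one> <\<^sub>P z" by (auto simp: one_prec_iff)
    then show ?case using prec_asym by blast
  next
    case (Suc n)
    have zc: "z \<in> carrier G" using Suc.prems cone_carrier by blast
    show ?case
    proof (cases "z \<le>\<^sub>P m")
      case False
      then have "m <\<^sub>P z" using prec_linear[OF zc mc] by blast
      then have p: "inv m \<otimes> z \<in> P" by (simp add: prec_def)
      have "m [^] Suc n = m \<otimes> m [^] n" using mc nat_pow_mult[of m 1 n] by simp
      then have "inv m \<otimes> m [^] Suc n = m [^] n" using mc by (simp only: inv_mult_cancel nat_pow_closed)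
      then have "inv m \<otimes> z \<le>\<^sub>P m [^] n" using preceq_mult_left[OF Suc.prems(2) inv_closed[OF mc]] by metis
      from H_mult[OF mH Suc.IH[OF p this]] show ?thesis using mc zc by (simp add: inv_mult_cancel)
    qed (use small Suc in blast)
  qed
  have sH: "subgroup H G" by (rule subgroupI) (use one_H H_mult H_inv Hc in auto)
  have prod: "\<exists>k::nat. a \<otimes> b <\<^sub>P m [^] k" if "a <\<^sub>P m [^] n" "b <\<^sub>P m [^] n" for a b and n :: nat
  proof -
    have "a \<otimes> b <\<^sub>P a \<otimes> m [^] n" using that prec_mult_left prec_carrier by blast
    also have "\<dots> <\<^sub>P m [^] n \<otimes> m [^] n" using right[OF mpH] that by blast
    finally show ?thesis using mc by (auto simp: nat_pow_mult)
  qed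
  have A: "cone_convex G P {x \<in> H. \<exists>n::nat. x <\<^sub>P m [^] n \<and> inv x <\<^sub>P m [^] n}"
      "m \<in> {x \<in> H. \<exists>n::nat. x <\<^sub>P m [^] n \<and> inv x <\<^sub>P m [^] n}"
    by (rule power_hull_convex[OF mP sH]; use prod bounded in blast)+
  have "m \<noteq> \<one>" using mP one_notin_cone by blast
  then have "carrier G \<subseteq> H" using simple[OF A(1)] A(2) by blast
  then show ?thesis using h x unfolding H_def by blast
qed

end

inductive_set semigroup_generated :: "('a, 'b) monoid_scheme \<Rightarrow> 'a set \<Rightarrow> 'a set" for G F where
  incl: "x \<in> F \<Longrightarrow> x \<in> semigroup_generated G F"
| mult: "x \<in> semigroup_generated G F \<Longrightarrow> y \<in> semigroup_generated G F \<Longrightarrow> x \<otimes>\<^bsub>G\<^esub> y \<in> semigroup_generated G F"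

lemma (in monoid) semigroup_generated_pow:
  assumes "x \<in> semigroup_generated G F" "0 < n" "x \<in> carrier G"
  shows "x [^] (n::nat) \<in> semigroup_generated G F"
  using assms(2)
proof (induction n)
  case (Suc n)
  then show ?case using assms semigroup_generated.mult[of "x [^] n" G F x] by (cases n) auto
qed simp

lemma semigroup_generated_least:
  assumes "F \<subseteq> S" "\<And>x y. x \<in> S \<Longrightarrow> y \<in> S \<Longrightarrow> x \<otimes>\<^bsub>G\<^esub> y \<in> S"
  shows "semigroup_generated G F \<subseteq> S"
proof
  fix x assume "x \<in> semigroup_generated G F"
  then show "x \<in> S" by induction (use assms in auto)
qed

lemma (in comm_monoid) semigroup_generated_insert:
  assumes "y \<in> semigroup_generated G (insert a F)" and a: "a \<in> carrier G" and F: "F \<subseteq> carrier G"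
  shows "\<exists>(k::nat) s. s \<in> carrier G \<and> y = a [^] k \<otimes> s \<and> (s \<in> semigroup_generated G F \<or> (s = \<one> \<and> 0 < k))"
  using assms(1)
proof induction
  case (incl x)
  show ?case
  proof (cases "x = a")
    case True
    then show ?thesis using a by (intro exI[of _ 1] exI[of _ \<one>]) auto
  next
    case False
    then show ?thesis using incl F by (intro exI[of _ 0] exI[of _ x]) (auto intro: semigroup_generated.incl)
  qed
next
  case (mult x y)
  then obtain k s l t where s: "s \<in> carrier G" "x = a [^] k \<otimes> s" "s \<in> semigroup_generated G F \<or> (s = \<one> \<and> 0 < (k::nat))"
    and t: "t \<in> carrier G" "y = a [^] l \<otimes> t" "t \<in> semigroup_generated G F \<or> (t = \<one> \<and> 0 < (l::nat))" by blast
  have "x \<otimes> y = a [^] (k + l) \<otimes> (s \<otimes> t)"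
    using s t a by (simp add: m_ac flip: nat_pow_mult)
  moreover have "s \<otimes> t \<in> semigroup_generated G F \<or> (s \<otimes> t = \<one> \<and> 0 < k + l)"
    using s t semigroup_generated.mult[of s G F t] by auto
  ultimately show ?case using s t by (intro exI[of _ "k + l"] exI[of _ "s \<otimes> t"]) auto
qed

text \<open>
  Take a maximal semigroup \<open>M\<close> without \<open>1\<close> that contains \<open>S\<close>. If \<open>x \<notin> M\<close> then \<open>1\<close> lies in the semigroup
  generated by \<open>M\<close> and \<open>x\<close>, so that a power of \<open>x\<inverse>\<close> lies in \<open>M\<close>. If \<open>M\<close> contained neither \<open>x\<close> nor
  \<open>x\<inverse>\<close>, it would contain a power of each of them, hence \<open>1\<close>.
\<close>
lemma (in comm_group) semigroup_extends_to_cone: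
  assumes torsion_free: "\<And>x (n::nat). x \<in> carrier G \<Longrightarrow> x [^] n = \<one> \<Longrightarrow> 0 < n \<Longrightarrow> x = \<one>"
    and S: "S \<subseteq> carrier G" "\<And>x y. x \<in> S \<Longrightarrow> y \<in> S \<Longrightarrow> x \<otimes> y \<in> S" "\<one> \<notin> S"
  obtains Q where "Q \<in> LO G" "S \<subseteq> Q"
proof -
  define \<A> where "\<A> = {T. S \<subseteq> T \<and> T \<subseteq> carrier G \<and> (\<forall>x\<in>T. \<forall>y\<in>T. x \<otimes> y \<in> T) \<and> \<one> \<notin> T}"
  have "\<exists>M\<in>\<A>. \<forall>X\<in>\<A>. M \<subseteq> X \<longrightarrow> X = M"
  proof (rule subset_Zorn_nonempty)
    show "\<A> \<noteq> {}" using S by (auto simp: \<A>_def)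
    fix \<C> assume ne: "\<C> \<noteq> {}" and ch: "subset.chain \<A> \<C>"
    have sub: "\<C> \<subseteq> \<A>" and lin: "\<And>X Y. X \<in> \<C> \<Longrightarrow> Y \<in> \<C> \<Longrightarrow> X \<subseteq> Y \<or> Y \<subseteq> X"
      using ch by (auto simp: subset.chain_def subset_chain_def)
    have "x \<otimes> y \<in> \<Union>\<C>" if xy: "x \<in> \<Union>\<C>" "y \<in> \<Union>\<C>" for x y
    proof -
      obtain X Y where XY: "X \<in> \<C>" "Y \<in> \<C>" "x \<in> X" "y \<in> Y" using xy by blast
      then obtain Z where "Z \<in> \<C>" "x \<in> Z" "y \<in> Z" using lin[of X Y] by blast
      then show ?thesis using sub unfolding \<A>_def by blast
    qed
    then show "\<Union>\<C> \<in> \<A>" using ne sub unfolding \<A>_def by blast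
  qed
  then obtain M where M: "M \<in> \<A>" and max: "\<And>X. X \<in> \<A> \<Longrightarrow> M \<subseteq> X \<Longrightarrow> X = M" by blast
  have Mc: "x \<in> M \<Longrightarrow> x \<in> carrier G" and Mm: "x \<in> M \<Longrightarrow> y \<in> M \<Longrightarrow> x \<otimes> y \<in> M" and M1: "\<one> \<notin> M" and SM: "S \<subseteq> M"
    for x y using M by (auto simp: \<A>_def)
  have Mp: "x [^] n \<in> M" if "x \<in> M" "0 < n" for x and n :: nat using that(2)
  proof (induction n)
    case (Suc n) then show ?case using that(1) Mm Mc by (cases n) auto
  qed simp
  have root: "\<exists>n>0. inv x [^] (n::nat) \<in> M" if x: "x \<in> carrier G" "x \<notin> M" "x \<noteq> \<one>" for x
  proof (rule ccontr)
    assume no: "\<not> ?thesis"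
    let ?X = "semigroup_generated G (insert x M)"
    have sg: "semigroup_generated G M \<subseteq> M" by (rule semigroup_generated_least) (use Mm in auto)
    have sgX: "?X \<subseteq> carrier G" by (rule semigroup_generated_least) (use Mc x in auto)
    have "\<one> \<notin> ?X"
    proof
      assume "\<one> \<in> ?X"
      then obtain k :: nat and s where s: "s \<in> carrier G" "\<one> = x [^] k \<otimes> s" "s \<in> M \<or> (s = \<one> \<and> 0 < k)"
        using semigroup_generated_insert[of \<one> x M] x Mc sg by blast
      have "s = inv (x [^] k)" using s x by (metis inv_equality inv_inv m_comm nat_pow_closed)
      then have s': "s = inv x [^] k" using x by (simp add: nat_pow_inv)
      show False
      proof (cases "s = \<one>")
        case True
        then have "0 < k" using s(3) M1 by blast
        moreover have "x [^] k = \<one>" using s(2) True x by simp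
        ultimately show False using torsion_free x by blast
      next
        case False
        then have "k \<noteq> 0" using s' by (metis nat_pow_0)
        then show False using no s s' False by blast
      qed
    qed
    then have "?X \<in> \<A>" using SM sgX unfolding \<A>_def by (auto intro: semigroup_generated.intros)
    then have "?X = M" by (rule max) (auto intro: semigroup_generated.incl)
    then show False using x(2) semigroup_generated.incl[of x "insert x M" G] by blast
  qed
  have "M \<in> LO G" unfolding LO_iff[OF is_group]
  proof (intro conjI ballI impI)
    fix x assume x: "x \<in> carrier G" "x \<noteq> \<one>"
    have "\<not> (x \<in> M \<and> inv x \<in> M)" using Mm[of x "inv x"] M1 x by auto
    moreover have "x \<in> M \<or> inv x \<in> M"
    proof (rule ccontr)
      assume n: "\<not> ?thesis"
      have "inv x \<noteq> \<one>" using x by simp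
      then obtain m :: nat where m: "x [^] m \<in> M" "0 < m" using root[of "inv x"] x n by auto
      obtain k :: nat where k: "inv x [^] k \<in> M" "0 < k" using root[of x] x n by auto
      have "(x [^] m) [^] k \<in> M" "(inv x [^] k) [^] m \<in> M" using Mp m k by auto
      then have "(x [^] m) [^] k \<otimes> (inv x [^] k) [^] m \<in> M" by (rule Mm)
      then show False using M1 x by (simp add: nat_pow_pow nat_pow_inv mult.commute)
    qed
    ultimately show "x \<in> M \<longleftrightarrow> inv x \<notin> M" by blast
  qed (use Mc Mm M1 in auto)
  then show ?thesis using that SM by blast
qed

text \<open>
  Let \<open>F\<close> be a finite set that determines \<open>P\<close>. Since semigroups without \<open>1\<close> extend to cones, every
  \<open>x > 1\<close> has a power in the semigroup generated by \<open>F\<close>; otherwise \<open>F\<close> and \<open>x\<inverse>\<close> would lie in a common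
  cone. Let \<open>E\<close> be a smallest finite set with this property. Two elements \<open>a, b \<in> E\<close> with \<open>a > b\<close> make
  \<open>a\<close> redundant: \<open>(a b\<inverse>)\<^sup>k = a\<^sup>j s\<close> with \<open>s\<close> generated by the others forces \<open>j < k\<close>, and then
  \<open>a\<^sup>k\<^sup>-\<^sup>j = b\<^sup>k s\<close>. So \<open>E\<close> is a singleton and any two positive elements have a common power.
\<close>
lemma (in left_ordered) isolated_abelian_commensurable:
  assumes comm: "comm_group G" and iso: "isolated_cone G P" and x: "x \<in> P" and y: "y \<in> P"
  shows "\<exists>m>0. \<exists>n>0. x [^] (m::nat) = y [^] (n::nat)"
proof -
  interpret comm_group G by fact
  define spans where "spans F \<longleftrightarrow> finite F \<and> F \<subseteq> P \<and> (\<forall>x\<in>P. \<exists>k>0. x [^] (k::nat) \<in> semigroup_generated G F)" for F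
  have sgP: "semigroup_generated G F \<subseteq> P" if "F \<subseteq> P" for F
    by (rule semigroup_generated_least) (use that cone_mult in auto)
  have Pc: "P \<subseteq> carrier G" using cone_carrier by blast
  obtain F where F: "finite F" "F \<subseteq> P" "\<And>Q. Q \<in> LO G \<Longrightarrow> F \<subseteq> Q \<Longrightarrow> Q = P"
    using iso by (auto simp: isolated_cone_def)
  have "\<exists>k>0. x [^] (k::nat) \<in> semigroup_generated G F" if x: "x \<in> P" for x
  proof (rule ccontr)
    assume no: "\<not> ?thesis"
    have xc: "x \<in> carrier G" using x cone_carrier by blast
    let ?T = "semigroup_generated G (insert (inv x) F)"
    have nT: "\<one> \<notin> ?T"
    proof
      assume "\<one> \<in> ?T"
      then obtain k :: nat and s where s: "s \<in> carrier G" "\<one> = inv x [^] k \<otimes> s"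
        "s \<in> semigroup_generated G F \<or> (s = \<one> \<and> 0 < k)"
        using semigroup_generated_insert[of \<one> "inv x" F] xc F(2) Pc by blast
      have "x [^] k \<otimes> (inv x [^] k \<otimes> s) = s" using s(1) xc by (simp add: nat_pow_inv inv_mult_cancel)
      then have sx: "s = x [^] k" using s(2) xc by (metis nat_pow_closed r_one)
      have "0 < k" using s(3) sx sgP[OF F(2)] one_notin_cone by (cases k) auto
      then have "x [^] k \<notin> semigroup_generated G F" using no by blast
      then have "x [^] k = \<one>" using s(3) unfolding sx by (elim disjE conjE) simp_all
      then show False using pow_eq_one[OF xc _ \<open>0 < k\<close>] x one_notin_cone by blast
    qed
    have Tc: "?T \<subseteq> carrier G" by (rule semigroup_generated_least) (use F(2) Pc xc in auto)
    obtain Q where Q: "Q \<in> LO G" "?T \<subseteq> Q"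
      by (rule semigroup_extends_to_cone[OF pow_eq_one Tc semigroup_generated.mult nT])
    have inc: "insert (inv x) F \<subseteq> ?T" by (auto intro: semigroup_generated.incl)
    then have "Q = P" using F(3)[OF Q(1)] Q(2) by blast
    then show False using Q(2) inc cone_inv[OF x] by blast
  qed
  then have "spans F" using F by (simp add: spans_def)
  then obtain E where E: "spans E" and min: "\<And>E'. spans E' \<Longrightarrow> card E \<le> card E'"
    using ex_has_least_nat[of spans F card] by blast
  have EP: "E \<subseteq> P" and Ef: "finite E" using E by (auto simp: spans_def)
  have redundant: False if ab: "a \<in> E" "b \<in> E" "a \<otimes> inv b \<in> P" for a b
  proof -
    let ?E = "E - {a}"
    have E': "E = insert a ?E" using ab by blast
    have c: "a \<in> carrier G" "b \<in> carrier G" "?E \<subseteq> carrier G" using ab EP Pc by auto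
    have "a \<noteq> b" using ab c one_notin_cone by auto
    then have b: "b \<in> semigroup_generated G ?E" using ab by (auto intro: semigroup_generated.incl)
    obtain k where k: "0 < k" "(a \<otimes> inv b) [^] (k::nat) \<in> semigroup_generated G E"
      using E ab(3) by (auto simp: spans_def)
    obtain j :: nat and s where s: "s \<in> carrier G" "(a \<otimes> inv b) [^] k = a [^] j \<otimes> s"
        "s \<in> semigroup_generated G ?E \<or> (s = \<one> \<and> 0 < j)"
      using semigroup_generated_insert[of "(a \<otimes> inv b) [^] k" a ?E] k(2) E' c by auto
    have sP: "s \<in> P \<or> s = \<one>" using s(3) sgP[of ?E] EP by blast
    have "(a \<otimes> inv b) [^] k \<otimes> b [^] k = a [^] k"
      using c by (simp add: nat_pow_distrib nat_pow_inv m_assoc)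
    then have ak: "a [^] k = a [^] j \<otimes> (s \<otimes> b [^] k)" using s c by (simp add: m_assoc)
    have bk: "b [^] k \<in> P" using ab(2) EP k(1) cone_pow by blast
    then have sb: "s \<otimes> b [^] k \<in> P" using sP cone_mult cone_carrier[OF bk] by auto
    have "j < k"
    proof (rule ccontr)
      assume "\<not> j < k"
      then have "a [^] k \<otimes> (a [^] (j - k) \<otimes> (s \<otimes> b [^] k)) = a [^] k"
        using c s(1) nat_pow_mult[of a k "j - k"] by (simp add: ak[symmetric] flip: m_assoc[of "a [^] k"])
      then have "inv (a [^] k) \<otimes> (a [^] k \<otimes> (a [^] (j - k) \<otimes> (s \<otimes> b [^] k))) = inv (a [^] k) \<otimes> a [^] k" by simp
      then have one: "\<one> = a [^] (j - k) \<otimes> (s \<otimes> b [^] k)"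
        using c s(1) by (simp only: inv_mult_cancel nat_pow_closed m_closed l_inv)
      have "a [^] (j - k) \<in> P \<or> a [^] (j - k) = \<one>" using cone_pow[of a "j - k"] ab(1) EP by (cases "j - k") auto
      then have "a [^] (j - k) \<otimes> (s \<otimes> b [^] k) \<in> P" using sb cone_mult cone_carrier[OF sb] by auto
      then show False using one one_notin_cone by simp
    qed
    define q where "q = k - j"
    have q: "0 < q" using \<open>j < k\<close> by (simp add: q_def)
    have "a [^] k = a [^] j \<otimes> a [^] q" using c \<open>j < k\<close> by (simp add: nat_pow_mult q_def)
    then have "inv (a [^] j) \<otimes> (a [^] j \<otimes> a [^] q) = inv (a [^] j) \<otimes> (a [^] j \<otimes> (s \<otimes> b [^] k))"
      using ak by simp
    then have "a [^] q = s \<otimes> b [^] k"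
      using c s(1) by (simp only: inv_mult_cancel nat_pow_closed m_closed)
    moreover have "b [^] k \<in> semigroup_generated G ?E" using semigroup_generated_pow[OF b k(1)] c by blast
    ultimately have aq: "a [^] q \<in> semigroup_generated G ?E"
      using s(3) semigroup_generated.mult[of s G ?E "b [^] k"] c by auto
    have "\<exists>l>0. x [^] (l::nat) \<in> semigroup_generated G ?E" if x: "x \<in> P" for x
    proof -
      have xc: "x \<in> carrier G" using x cone_carrier by blast
      obtain l where l: "0 < l" "x [^] (l::nat) \<in> semigroup_generated G E"
        using E x by (auto simp: spans_def)
      obtain i :: nat and t where t: "t \<in> carrier G" "x [^] l = a [^] i \<otimes> t"
          "t \<in> semigroup_generated G ?E \<or> (t = \<one> \<and> 0 < i)"
        using semigroup_generated_insert[of "x [^] l" a ?E] l(2) E' c by auto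
      have "x [^] (l * q) = (a [^] i \<otimes> t) [^] q" using t(2) xc by (simp flip: nat_pow_pow)
      also have "\<dots> = (a [^] q) [^] i \<otimes> t [^] q" using c t by (simp add: nat_pow_distrib nat_pow_pow mult.commute)
      finally have e: "x [^] (l * q) = (a [^] q) [^] i \<otimes> t [^] q" .
      have ai: "(a [^] q) [^] i \<in> semigroup_generated G ?E" if "0 < i"
        using semigroup_generated_pow[OF aq that] c by simp
      have tq: "t [^] q \<in> semigroup_generated G ?E" if "t \<in> semigroup_generated G ?E"
        using semigroup_generated_pow[OF that q] t by simp
      have "x [^] (l * q) \<in> semigroup_generated G ?E"
      proof (cases "0 < i")
        case True
        then show ?thesis unfolding e using t(3) ai tq semigroup_generated.mult c by fastforce
      next
        case False
        then show ?thesis unfolding e using t(3) t(1) tq by auto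
      qed
      then show ?thesis using l q by (intro exI[of _ "l * q"]) simp
    qed
    then have "spans ?E" using EP Ef by (auto simp: spans_def)
    from min[OF this] show False using ab(1) Ef by (metis card_Diff1_less leD)
  qed
  have eq: "a = b" if "a \<in> E" "b \<in> E" for a b
  proof -
    have c: "a \<in> carrier G" "b \<in> carrier G" using that EP Pc by auto
    show ?thesis
    proof (rule cone_cases[of "a \<otimes> inv b"])
      assume "a \<otimes> inv b = \<one>" then show ?thesis using c by (metis inv_equality inv_inv inv_closed)
    next
      assume "inv (a \<otimes> inv b) \<in> P"
      then show ?thesis using redundant[OF that(2,1)] c by (simp add: inv_mult_group)
    qed (use redundant that c in auto)
  qed
  have single: "\<exists>i>0. z = a [^] (i::nat)" if "z \<in> semigroup_generated G E" "a \<in> E" for z a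
    using that(1)
  proof induction
    case (incl x) then show ?case using eq[OF _ that(2)] that(2) EP Pc by (intro exI[of _ 1]) auto
  next
    case (mult x y)
    then obtain i j :: nat where "x = a [^] i" "y = a [^] j" "0 < i" by blast
    then show ?case using that(2) EP Pc by (intro exI[of _ "i + j"]) (auto simp: nat_pow_mult)
  qed
  obtain k l :: nat where k: "0 < k" "x [^] k \<in> semigroup_generated G E" and l: "0 < l" "y [^] l \<in> semigroup_generated G E"
    using E x y unfolding spans_def by blast
  have "E \<noteq> {}" using k(2) semigroup_generated_least[of E "{}" G] by auto
  then obtain a where a: "a \<in> E" by blast
  then have ac: "a \<in> carrier G" using EP Pc by blast
  obtain i j :: nat where i: "0 < i" "x [^] k = a [^] i" and j: "0 < j" "y [^] l = a [^] j"
    using single[OF k(2) a] single[OF l(2) a] by blast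
  have "x [^] (k * j) = (a [^] i) [^] j" using i cone_carrier[OF x] by (simp flip: nat_pow_pow)
  also have "\<dots> = (a [^] j) [^] i" using ac by (simp add: nat_pow_pow mult.commute)
  also have "\<dots> = y [^] (l * i)" using j cone_carrier[OF y] by (simp flip: nat_pow_pow)
  finally show ?thesis using k l i j by (intro exI[of _ "k * j"] conjI exI[of _ "l * i"]) auto
qed

text \<open>
  Invariance gives the Conradian condition, that and the absence of convex subgroups give the
  Archimedean property, and Hoelder's theorem makes the group abelian.
\<close>
lemma (in left_ordered) isolated_simple_rank_one:
  assumes iso: "isolated_cone G P"
    and simple: "\<And>C. cone_convex G P C \<Longrightarrow> C = {\<one>} \<or> C = carrier G"
  shows "comm_group G" "\<And>x y. x \<in> P \<Longrightarrow> y \<in> P \<Longrightarrow> \<exists>m>0. \<exists>n>0. x [^] (m::nat) = y [^] (n::nat)"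
proof -
  note inv = isolated_simple_invariant[OF iso simple]
  show comm: "comm_group G"
  proof (rule archimedean_invariant_comm)
    show "\<exists>n::nat. x <\<^sub>P e [^] n" if "e \<in> P" "x \<in> P" for e x
      using Conradian_simple_archimedean[OF invariant_Conradian[OF inv] simple] that cone_carrier by metis
  qed (rule inv)
  show "\<exists>m>0. \<exists>n>0. x [^] (m::nat) = y [^] (n::nat)" if "x \<in> P" "y \<in> P" for x y
    by (rule isolated_abelian_commensurable[OF comm iso that])
qed

section \<open>Quotients, and jumps of isolated Conradian orderings\<close>

lemma (in group) subgroup_nat_pow_closed:
  assumes "subgroup C G" "x \<in> C"
  shows "x [^] (n::nat) \<in> C"
  by (induction n) (use assms subgroup.one_closed subgroup.m_closed in auto)

lemma (in comm_group) commutator_eq_one: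
  assumes "x \<in> carrier G" "y \<in> carrier G"
  shows "x \<otimes> y \<otimes> inv x \<otimes> inv y = \<one>"
proof -
  have "x \<otimes> y = y \<otimes> x" using assms by (rule m_comm)
  then show ?thesis using assms by (simp add: word_simps)
qed

text \<open>
  A surjective homomorphism with convex kernel; orderings pass along it in both directions.
\<close>
locale ordered_epi = G?: left_ordered G P + group_hom G H h
  for G (structure) and P and H (structure) and h +
  assumes surj: "h ` carrier G = carrier H"
    and kernel_convex: "cone_convex G P (kernel G H h)"
begin

abbreviation "N \<equiv> kernel G H h"

definition "image_cone = h ` (P - N)"

lemma in_kernel_iff: "x \<in> carrier G \<Longrightarrow> x \<in> N \<longleftrightarrow> h x = \<one>\<^bsub>H\<^esub>"
  by (simp add: kernel_def)

lemma image_coneI: "x \<in> P \<Longrightarrow> x \<notin> N \<Longrightarrow> h x \<in> image_cone"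
  by (simp add: image_cone_def)

lemma in_image_cone_iff:
  assumes x: "x \<in> carrier G"
  shows "h x \<in> image_cone \<longleftrightarrow> x \<in> P \<and> x \<notin> N"
proof
  assume "h x \<in> image_cone"
  then obtain y where y: "y \<in> P" "y \<notin> N" "h x = h y" by (auto simp: image_cone_def)
  have yc: "y \<in> carrier G" using y cone_carrier by blast
  have "h (inv y \<otimes> x) = \<one>\<^bsub>H\<^esub>" using x y yc by simp
  then have "inv y \<otimes> x \<in> N" using x yc by (simp add: in_kernel_iff)
  from convex_absorb(1,2)[OF kernel_convex y(1,2) this] show "x \<in> P \<and> x \<notin> N"
    using x yc by (simp add: G.inv_mult_cancel)
qed (use image_coneI in blast)

lemma image_cone: "image_cone \<in> LO H"
  unfolding LO_iff[OF H.is_group]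
proof (intro conjI ballI impI)
  show "image_cone \<subseteq> carrier H" using cone_carrier by (auto simp: image_cone_def)
  show "\<one>\<^bsub>H\<^esub> \<notin> image_cone" using cone_carrier by (auto simp: image_cone_def kernel_def)
  fix a b assume "a \<in> image_cone" "b \<in> image_cone"
  then obtain x y where xy: "x \<in> P" "x \<notin> N" "a = h x" "y \<in> P" "y \<notin> N" "b = h y" by (auto simp: image_cone_def)
  then have c: "x \<in> carrier G" "y \<in> carrier G" using cone_carrier by auto
  have "x \<otimes> y \<notin> N"
  proof
    assume "x \<otimes> y \<in> N"
    from convex_cone_memD[OF kernel_convex this xy(1)] show False using xy c by (simp add: G.inv_mult_cancel)
  qed
  then have "h (x \<otimes> y) \<in> image_cone" using cone_mult xy by (intro image_coneI)
  then show "a \<otimes>\<^bsub>H\<^esub> b \<in> image_cone" using xy c by simp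
next
  fix a assume a: "a \<in> carrier H" "a \<noteq> \<one>\<^bsub>H\<^esub>"
  then obtain x where x: "x \<in> carrier G" "a = h x" using surj by blast
  have xN: "x \<notin> N" using a x by (simp add: in_kernel_iff)
  then have "inv x \<notin> N" using a x by (simp add: in_kernel_iff)
  moreover have "x \<noteq> \<one>" using a x by auto
  ultimately have "h x \<in> image_cone \<longleftrightarrow> h (inv x) \<notin> image_cone"
    using in_image_cone_iff[of x] in_image_cone_iff[of "inv x"] inv_in_cone_iff[of x] x xN by auto
  then show "a \<in> image_cone \<longleftrightarrow> inv\<^bsub>H\<^esub> a \<notin> image_cone" using x by simp
qed

text \<open>
  Lexicographic orderings: the sign is read off in the image, and on the kernel from \<open>P\<close>.
\<close>
lemma preimage_cone:
  assumes Q: "Q \<in> LO H"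
  shows "{x \<in> carrier G. h x \<in> Q} \<union> (P \<inter> N) \<in> LO G" (is "?Q \<in> _")
  unfolding LO_iff[OF G.is_group]
proof -
  interpret Q: left_ordered H Q by unfold_locales (rule Q)
  show "?Q \<subseteq> carrier G \<and> (\<forall>g\<in>?Q. \<forall>h\<in>?Q. g \<otimes> h \<in> ?Q) \<and> \<one> \<notin> ?Q \<and>
    (\<forall>g\<in>carrier G. g \<noteq> \<one> \<longrightarrow> (g \<in> ?Q \<longleftrightarrow> inv g \<notin> ?Q))"
  proof (intro conjI ballI impI)
    show "?Q \<subseteq> carrier G" using cone_carrier by blast
    show "\<one> \<notin> ?Q" using one_notin_cone Q.one_notin_cone by simp
    fix x y assume xy: "x \<in> ?Q" "y \<in> ?Q"
    then have c: "x \<in> carrier G" "y \<in> carrier G" using cone_carrier by auto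
    have N: "x \<otimes> y \<in> P \<inter> N" if "x \<in> P \<inter> N" "y \<in> P \<inter> N"
      using that cone_mult c by (auto simp: in_kernel_iff)
    consider "h x \<in> Q" "h y \<in> Q" | "x \<in> P \<inter> N" "h y \<in> Q" | "h x \<in> Q" "y \<in> P \<inter> N" | "x \<in> P \<inter> N" "y \<in> P \<inter> N"
      using xy by blast
    then show "x \<otimes> y \<in> ?Q"
    proof cases
      case 1 then show ?thesis using c Q.cone_mult by simp
    next
      case 2 then show ?thesis using c in_kernel_iff[of x] by simp
    next
      case 3 then show ?thesis using c in_kernel_iff[of y] by simp
    next
      case 4 then show ?thesis using N by blast
    qed
  next
    fix x assume x: "x \<in> carrier G" "x \<noteq> \<one>"
    show "x \<in> ?Q \<longleftrightarrow> inv x \<notin> ?Q"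
    proof (cases "x \<in> N")
      case True
      then have "h x = \<one>\<^bsub>H\<^esub>" "inv x \<in> N" using x by (auto simp: in_kernel_iff)
      then show ?thesis using True Q.one_notin_cone inv_in_cone_iff[OF x] x by simp
    next
      case False
      then have "h x \<noteq> \<one>\<^bsub>H\<^esub>" "inv x \<notin> N" using x by (auto simp: in_kernel_iff)
      then show ?thesis using False Q.inv_in_cone_iff[of "h x"] x by simp
    qed
  qed
qed

lemma image_isolated:
  assumes "isolated_cone G P"
  shows "isolated_cone H image_cone"
proof -
  obtain F where F: "finite F" "F \<subseteq> P" "\<And>Q. Q \<in> LO G \<Longrightarrow> F \<subseteq> Q \<Longrightarrow> Q = P"
    using assms by (auto simp: isolated_cone_def)
  have "Q = image_cone" if Q: "Q \<in> LO H" "h ` (F - N) \<subseteq> Q" for Q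
  proof -
    interpret Q: left_ordered H Q by unfold_locales (rule Q)
    have "F \<subseteq> {x \<in> carrier G. h x \<in> Q} \<union> (P \<inter> N)" using F(2) Q(2) cone_carrier by blast
    from F(3)[OF preimage_cone[OF Q(1)] this]
    have eq: "{x \<in> carrier G. h x \<in> Q} \<union> (P \<inter> N) = P" .
    have "image_cone \<subseteq> Q"
    proof
      fix a assume "a \<in> image_cone"
      then obtain x where "x \<in> P" "x \<notin> N" "a = h x" by (auto simp: image_cone_def)
      then show "a \<in> Q" using eq by blast
    qed
    interpret I: left_ordered H image_cone by unfold_locales (rule image_cone)
    show ?thesis by (rule I.cone_eqI[OF Q(1)]) fact
  qed
  moreover have "h ` (F - N) \<subseteq> image_cone" using F(2) by (auto simp: image_cone_def)
  moreover have "finite (h ` (F - N))" using F(1) by simp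
  ultimately show ?thesis unfolding isolated_cone_def using image_cone by blast
qed

lemma preimage_convex:
  assumes D: "cone_convex H image_cone D"
  shows "cone_convex G P {x \<in> carrier G. h x \<in> D}"
proof -
  interpret D: subgroup D H using D by (simp add: cone_convex_def)
  have "subgroup {x \<in> carrier G. h x \<in> D} G"
    by (rule G.subgroupI) (auto intro: exI[of _ "\<one>"])
  moreover have "h g \<in> D" if c: "c \<in> carrier G" "h c \<in> D" "g \<in> P" "inv g \<otimes> c \<in> P" for c g
  proof -
    have g: "g \<in> carrier G" using c cone_carrier by blast
    show ?thesis
    proof (cases "g \<in> N \<or> inv g \<otimes> c \<in> N")
      case True
      then show ?thesis
      proof
        assume "g \<in> N" then show ?thesis using in_kernel_iff[OF g] by simp
      next
        assume "inv g \<otimes> c \<in> N"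
        then have "inv\<^bsub>H\<^esub> h g \<otimes>\<^bsub>H\<^esub> h c = \<one>\<^bsub>H\<^esub>" using g c by (simp add: in_kernel_iff)
        then have "h g \<otimes>\<^bsub>H\<^esub> (inv\<^bsub>H\<^esub> h g \<otimes>\<^bsub>H\<^esub> h c) = h g" using g by simp
        then have "h c = h g" using g c by (simp add: H.inv_mult_cancel)
        then show ?thesis using c by simp
      qed
    next
      case False
      then have "h g \<in> image_cone" "h (inv g \<otimes> c) \<in> image_cone" using c image_coneI by auto
      then show ?thesis using D c g unfolding cone_convex_def by simp
    qed
  qed
  ultimately show ?thesis using cone_carrier by (auto simp: cone_convex_def)
qed

lemma image_convex:
  assumes C: "cone_convex G P C" and sub: "N \<subseteq> C"
  shows "cone_convex H image_cone (h ` C)"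
proof -
  have sC: "subgroup C G" using C by (rule convex_subgroupD)
  have "h g \<in> h ` C" if "c \<in> C" "g \<in> P" "g \<notin> N" "inv\<^bsub>H\<^esub> h g \<otimes>\<^bsub>H\<^esub> h c \<in> image_cone" for c g
  proof -
    have cg: "c \<in> carrier G" "g \<in> carrier G" using that subgroup.mem_carrier[OF sC] cone_carrier by auto
    then have "inv g \<otimes> c \<in> P" using in_image_cone_iff[of "inv g \<otimes> c"] that by simp
    then show ?thesis using convex_cone_memD[OF C] that by blast
  qed
  then show ?thesis unfolding cone_convex_def using subgroup_img_is_subgroup[OF sC]
    by (auto simp: image_cone_def)
qed

end

lemma (in left_ordered) natural_epi:
  assumes N: "N \<lhd> G" and conv: "cone_convex G P N"
  shows "ordered_epi G P (G Mod N) (\<lambda>x. N #> x)" "kernel G (G Mod N) (\<lambda>x. N #> x) = N"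
proof -
  interpret N: normal N G by fact
  have hom: "group_hom G (G Mod N) (\<lambda>x. N #> x)"
    by (intro group_hom.intro group_hom_axioms.intro is_group N.factorgroup_is_group N.r_coset_hom_Mod)
  show k: "kernel G (G Mod N) (\<lambda>x. N #> x) = N"
    unfolding kernel_def using N.rcos_const N.subset coset_join1[OF _ _ N.subgroup_axioms] 
    by (auto simp: FactGroup_def N.mem_carrier)
  show "ordered_epi G P (G Mod N) (\<lambda>x. N #> x)"
    by (intro ordered_epi.intro ordered_epi_axioms.intro hom left_ordered_axioms)
      (use k conv in \<open>auto simp: FactGroup_def RCOSETS_def\<close>)
qed

lemma (in left_ordered) Conradian_restrict:
  assumes con: "Conradian_cone G P" and C: "subgroup C G"
  shows "Conradian_cone (restricted G C) (P \<inter> C)"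
  unfolding Conradian_cone_def
proof (intro ballI)
  interpret C: subgroup C G by fact
  fix f g assume fg: "f \<in> P \<inter> C" "g \<in> P \<inter> C"
  then obtain n :: nat where n: "inv f \<otimes> (g \<otimes> f [^] n) \<in> P"
    using con unfolding Conradian_cone_def by blast
  moreover have "inv f \<otimes> (g \<otimes> f [^] n) \<in> C"
    using fg C.m_closed C.m_inv_closed subgroup_nat_pow_closed[OF C] by simp
  ultimately show "\<exists>n::nat. inv\<^bsub>restricted G C\<^esub> f \<otimes>\<^bsub>restricted G C\<^esub> (g \<otimes>\<^bsub>restricted G C\<^esub> f [^]\<^bsub>restricted G C\<^esub> n) \<in> P \<inter> C"
    using fg inv_restricted[OF C] by (auto simp flip: nat_pow_consistent)
qed

text \<open>
  Suppose \<open>e = d c d\<inverse>\<close> lies outside \<open>C\<close>, say \<open>e > 1\<close>. The hull of the powers of \<open>e\<close> is the whole group, so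
  \<open>d < E\<close> for some power \<open>E = e\<^sup>n\<close>. On the other hand \<open>E\<^sup>2 d = d c\<^sup>2\<^sup>n\<close>, which says that
  \<open>p = d\<inverse> E > 1\<close> satisfies \<open>p E d = c\<^sup>2\<^sup>n \<in> C\<close>. As \<open>1 < p < p E < p E d\<close>, convexity puts \<open>p\<close>, \<open>p E\<close> and hence
  \<open>E\<close> and \<open>e\<close> in \<open>C\<close>.
\<close>
lemma (in left_ordered) Conradian_jump_conjugate:
  assumes con: "Conradian_cone G P" and C: "cone_convex G P C"
    and jump: "\<And>D. cone_convex G P D \<Longrightarrow> C \<subseteq> D \<Longrightarrow> D = C \<or> D = carrier G"
    and d: "d \<in> P" and c: "c \<in> C"
  shows "d \<otimes> c \<otimes> inv d \<in> C"
proof -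
  interpret C: subgroup C G using C by (rule convex_subgroupD)
  have dc: "d \<in> carrier G" using d cone_carrier by blast
  have *: False if c: "c \<in> C" and e: "e = d \<otimes> c \<otimes> inv d" "e \<in> P" "e \<notin> C" for c e
  proof -
    have cc: "c \<in> carrier G" "e \<in> carrier G" using c e cone_carrier by auto
    note A = Conradian_power_hull_convex[OF con e(2)]
    let ?A = "{x \<in> carrier G. \<exists>n::nat. x <\<^sub>P e [^] n \<and> inv x <\<^sub>P e [^] n}"
    have "C \<subseteq> ?A" using convex_chain[OF C A(1)] A(2) e(3) by blast
    then have "?A = carrier G" using jump[OF A(1)] A(2) e(3) by blast
    then obtain n :: nat where n: "d <\<^sub>P e [^] n" using dc by blast
    have "0 < n"
    proof (rule ccontr)
      assume "\<not> 0 < n"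
      then have "d <\<^sub>P \<one>" "\<one> <\<^sub>P d" using n d by (auto simp: one_prec_iff)
      then show False using prec_asym by blast
    qed
    define E where "E = e [^] n"
    have E: "E \<in> P" "E \<in> carrier G" using cone_pow[OF e(2) \<open>0 < n\<close>] cc by (auto simp: E_def)
    define k where "k = c [^] (n + n)"
    have k: "k \<in> C" "k \<in> carrier G" unfolding k_def using c cc subgroup_nat_pow_closed[OF C.subgroup_axioms] by auto
    have pow: "e [^] (m::nat) \<otimes> d = d \<otimes> c [^] m" for m
    proof (induction m)
      case (Suc m)
      have "e [^] Suc m \<otimes> d = e [^] m \<otimes> d \<otimes> c" using cc dc by (simp add: e(1) word_simps)
      then show ?case using Suc cc dc by (simp add: m_assoc)
    qed (use dc in simp)
    \<comment> \<open>The relation \<open>e d = d c\<close>, raised to the power \<open>2 n\<close>.\<close>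
    have EE: "E \<otimes> (E \<otimes> d) = d \<otimes> k"
      using pow[of "n + n"] cc dc by (simp add: E_def k_def m_assoc flip: nat_pow_mult)
    define p where "p = inv d \<otimes> E"
    have p: "p \<in> P" "p \<in> carrier G" using n dc E by (auto simp: p_def prec_def E_def)
    have "k = (p \<otimes> E) \<otimes> d"
      using arg_cong[OF EE, of "\<lambda>z. inv d \<otimes> z"] dc E k by (simp add: p_def word_simps)
    then have "inv (p \<otimes> E) \<otimes> k = d" using p E dc by (simp add: word_simps)
    then have "p \<otimes> E \<in> C" using convex_cone_memD[OF C k(1) cone_mult[OF p(1) E(1)]] d by simp
    moreover have "inv p \<otimes> (p \<otimes> E) \<in> P" using p E by (simp add: inv_mult_cancel)
    ultimately have "p \<in> C" using convex_cone_memD[OF C _ p(1)] by blast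
    then have "inv p \<otimes> (p \<otimes> E) \<in> C" using C.m_closed C.m_inv_closed \<open>p \<otimes> E \<in> C\<close> by blast
    then have "E \<in> C" using p E by (simp add: inv_mult_cancel)
    then have "e \<in> C" using convex_root[OF C cc(2) _ \<open>0 < n\<close>] by (simp add: E_def)
    then show False using e by blast
  qed
  have cc: "c \<in> carrier G" using c by (rule C.mem_carrier)
  show ?thesis
  proof (rule cone_cases[of "d \<otimes> c \<otimes> inv d"])
    assume i: "inv (d \<otimes> c \<otimes> inv d) \<in> P"
    have "inv (d \<otimes> c \<otimes> inv d) = d \<otimes> inv c \<otimes> inv d" using dc cc by (simp add: word_simps)
    then have "inv (d \<otimes> c \<otimes> inv d) \<in> C" using *[of "inv c"] C.m_inv_closed[OF c] i by auto
    then have "inv (inv (d \<otimes> c \<otimes> inv d)) \<in> C" by (rule C.m_inv_closed)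
    then show ?thesis using dc cc by simp
  qed (use * c dc cc in auto)
qed

lemma reverse_reverse_cone:
  assumes "Group.group G" "P \<subseteq> carrier G"
  shows "reverse_cone G (reverse_cone G P) = P"
proof -
  interpret Group.group G by fact
  show ?thesis using assms(2) by (auto simp: reverse_cone_def)
qed

text \<open>
  Conrad's theorem. For conjugation by a negative element, use the reversed ordering, which is
  Conradian with the same convex subgroups.
\<close>
lemma (in left_ordered) Conradian_jump_normal:
  assumes con: "Conradian_cone G P" and C: "cone_convex G P C"
    and jump: "\<And>D. cone_convex G P D \<Longrightarrow> C \<subseteq> D \<Longrightarrow> D = C \<or> D = carrier G"
  shows "C \<lhd> G"
  unfolding normal_inv_iff
proof (intro conjI ballI)
  show sC: "subgroup C G" using C by (rule convex_subgroupD)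
  fix d c assume d: "d \<in> carrier G" and c: "c \<in> C"
  interpret R: left_ordered G "reverse_cone G P" by (rule reverse_cone)
  have rr: "reverse_cone G (reverse_cone G P) = P"
    by (rule reverse_reverse_cone[OF is_group]) (use cone_carrier in blast)
  have jump': "D = C \<or> D = carrier G" if "cone_convex G (reverse_cone G P) D" "C \<subseteq> D" for D
    using jump[of D] R.reverse_convex[OF that(1)] that(2) rr by simp
  show "d \<otimes> c \<otimes> inv d \<in> C"
  proof (rule cone_cases[OF d])
    assume "d \<in> P" from Conradian_jump_conjugate[OF con C jump this c] show ?thesis by blast
  next
    assume "inv d \<in> P"
    then have "d \<in> reverse_cone G P" using d by (simp add: reverse_cone_def)
    from R.Conradian_jump_conjugate[OF Conradian_reverse[OF con] reverse_convex[OF C] jump' this c]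
    show ?thesis by blast
  next
    assume "d = \<one>" then show ?thesis using c subgroup.mem_carrier[OF sC] by simp
  qed
qed

text \<open>
  The quotient \<open>G / N\<close> carries an isolated ordering without proper convex subgroups. The conclusions
  say, without mentioning the quotient, that it is abelian of rank one.
\<close>
lemma (in left_ordered) isolated_Conradian_jump:
  assumes iso: "isolated_cone G P" and con: "Conradian_cone G P" and N: "cone_convex G P N"
    and jump: "\<And>D. cone_convex G P D \<Longrightarrow> N \<subseteq> D \<Longrightarrow> D = N \<or> D = carrier G"
  shows "N \<lhd> G"
    and "\<And>x y. x \<in> carrier G \<Longrightarrow> y \<in> carrier G \<Longrightarrow> x \<otimes> y \<otimes> inv x \<otimes> inv y \<in> N"
    and "\<And>x y. x \<in> P - N \<Longrightarrow> y \<in> P - N \<Longrightarrow> \<exists>m>0. \<exists>n>0. inv (y [^] (n::nat)) \<otimes> x [^] (m::nat) \<in> N"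
proof -
  show normal: "N \<lhd> G" by (rule Conradian_jump_normal[OF con N jump])
  let ?h = "\<lambda>x. N #> x"
  interpret q: ordered_epi G P "G Mod N" ?h by (rule natural_epi(1)[OF normal N])
  note ker = natural_epi(2)[OF normal N]
  interpret H: left_ordered "G Mod N" q.image_cone by unfold_locales (rule q.image_cone)
  have simple: "D = {\<one>\<^bsub>G Mod N\<^esub>} \<or> D = carrier (G Mod N)" if D: "cone_convex (G Mod N) q.image_cone D" for D
  proof -
    interpret D: subgroup D "G Mod N" using D by (rule H.convex_subgroupD)
    have sub: "N \<subseteq> {x \<in> carrier G. ?h x \<in> D}"
    proof
      fix x assume x: "x \<in> N"
      then have xc: "x \<in> carrier G" using convex_subgroupD[OF N] subgroup.mem_carrier by metis
      then have "?h x = \<one>\<^bsub>G Mod N\<^esub>" using q.in_kernel_iff[OF xc] x unfolding ker by blast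
      then show "x \<in> {x \<in> carrier G. ?h x \<in> D}" using D.one_closed xc by simp
    qed
    have D_eq: "D = ?h ` {x \<in> carrier G. ?h x \<in> D}"
      using D.subset unfolding q.surj[symmetric] by (auto simp: image_iff subset_iff)
    from jump[OF q.preimage_convex[OF D] sub] show ?thesis
    proof
      assume eq: "{x \<in> carrier G. ?h x \<in> D} = N"
      have "D \<subseteq> {\<one>\<^bsub>G Mod N\<^esub>}" 
      proof
        fix a assume "a \<in> D"
        then obtain x where x: "x \<in> carrier G" "?h x = a" "x \<in> N" using D_eq eq by (metis (no_types, lifting) image_iff mem_Collect_eq)
        then show "a \<in> {\<one>\<^bsub>G Mod N\<^esub>}" using q.in_kernel_iff[OF x(1)] unfolding ker by simp
      qed
      then show ?thesis using D.one_closed by blast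
    next
      assume "{x \<in> carrier G. ?h x \<in> D} = carrier G"
      then show ?thesis using D_eq q.surj by argo
    qed
  qed
  note rank = H.isolated_simple_rank_one[OF q.image_isolated[OF iso] simple]
  interpret C: comm_group "G Mod N" by (rule rank(1))
  show "x \<otimes> y \<otimes> inv x \<otimes> inv y \<in> N" if xy: "x \<in> carrier G" "y \<in> carrier G" for x y
  proof -
    have "?h (x \<otimes> y \<otimes> inv x \<otimes> inv y) = ?h x \<otimes>\<^bsub>G Mod N\<^esub> ?h y \<otimes>\<^bsub>G Mod N\<^esub> inv\<^bsub>G Mod N\<^esub> ?h x \<otimes>\<^bsub>G Mod N\<^esub> inv\<^bsub>G Mod N\<^esub> ?h y"
      using xy by (simp only: q.hom_mult q.hom_inv m_closed inv_closed)
    also have "\<dots> = \<one>\<^bsub>G Mod N\<^esub>"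
      using xy by (intro C.commutator_eq_one q.hom_closed)
    finally show ?thesis using q.in_kernel_iff[of "x \<otimes> y \<otimes> inv x \<otimes> inv y"] xy unfolding ker by blast
  qed
  show "\<exists>m>0. \<exists>n>0. inv (y [^] (n::nat)) \<otimes> x [^] (m::nat) \<in> N" if xy: "x \<in> P - N" "y \<in> P - N" for x y
  proof -
    have c: "x \<in> carrier G" "y \<in> carrier G" using xy cone_carrier by auto
    have "?h x \<in> q.image_cone" "?h y \<in> q.image_cone" using xy q.image_coneI unfolding ker by auto
    then obtain m n :: nat where mn: "0 < m" "0 < n" "?h x [^]\<^bsub>G Mod N\<^esub> m = ?h y [^]\<^bsub>G Mod N\<^esub> n" using rank(2) by blast
    then have "?h (x [^] m) = ?h (y [^] n)" using c by (simp only: q.hom_nat_pow)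
    then have "?h (inv (y [^] n) \<otimes> x [^] m) = \<one>\<^bsub>G Mod N\<^esub>"
      using c q.hom_closed[of "y [^] n"] by (simp only: q.hom_mult q.hom_inv nat_pow_closed inv_closed group.l_inv[OF comm_group.axioms(2)[OF rank(1)]])
    then have "inv (y [^] n) \<otimes> x [^] m \<in> N" using q.in_kernel_iff[of "inv (y [^] n) \<otimes> x [^] m"] c unfolding ker by blast
    then show ?thesis using mn by blast
  qed
qed

section \<open>Order-preserving actions on a convex subgroup of rank one\<close>

text \<open>
  A convex normal subgroup \<open>K\<close> on which \<open>G\<close> acts by order-preserving automorphisms, with \<open>K\<close> and
  \<open>G / K\<close> abelian of rank one. Embedding \<open>K\<close> in \<open>\<rat>\<close>, conjugation by \<open>h\<close> is multiplication by a positive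
  rational number.
\<close>
locale positive_action = left_ordered +
  fixes K
  assumes K_convex: "cone_convex G P K"
    and K_normal: "K \<lhd> G"
    and K_comm: "\<And>x y. x \<in> K \<Longrightarrow> y \<in> K \<Longrightarrow> x \<otimes> y = y \<otimes> x"
    and K_rank_one: "\<And>x y. x \<in> P \<inter> K \<Longrightarrow> y \<in> P \<inter> K \<Longrightarrow> \<exists>m>0. \<exists>n>0. x [^] (m::nat) = y [^] (n::nat)"
    and commutator_in_K: "\<And>x y. x \<in> carrier G \<Longrightarrow> y \<in> carrier G \<Longrightarrow> x \<otimes> y \<otimes> inv x \<otimes> inv y \<in> K"
    and quotient_rank_one: "\<And>x y. x \<in> P - K \<Longrightarrow> y \<in> P - K \<Longrightarrow>
        \<exists>m>0. \<exists>n>0. inv (y [^] (n::nat)) \<otimes> x [^] (m::nat) \<in> K"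
    and action_positive: "\<And>h k. h \<in> carrier G \<Longrightarrow> k \<in> P \<inter> K \<Longrightarrow> h \<otimes> k \<otimes> inv h \<in> P"
begin

sublocale K: normal K G by (rule K_normal)

lemma K_carrier: "k \<in> K \<Longrightarrow> k \<in> carrier G"
  by (rule K.mem_carrier)

lemma K_pow: "k \<in> K \<Longrightarrow> k [^] (n::nat) \<in> K"
  using subgroup_nat_pow_closed K.subgroup_axioms by blast

definition conjugate :: "'a \<Rightarrow> 'a \<Rightarrow> 'a" where
  "conjugate h k = h \<otimes> k \<otimes> inv h"

lemma conjugate_in_K: "h \<in> carrier G \<Longrightarrow> k \<in> K \<Longrightarrow> conjugate h k \<in> K"
  unfolding conjugate_def by (rule K.inv_op_closed2)

lemma conjugate_mult: "h \<in> carrier G \<Longrightarrow> a \<in> carrier G \<Longrightarrow> b \<in> carrier G \<Longrightarrow> conjugate h (a \<otimes> b) = conjugate h a \<otimes> conjugate h b"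
  by (simp add: conjugate_def word_simps)

lemma conjugate_inv: "h \<in> carrier G \<Longrightarrow> a \<in> carrier G \<Longrightarrow> conjugate h (inv a) = inv (conjugate h a)"
  by (simp add: conjugate_def word_simps)

lemma conjugate_pow: "h \<in> carrier G \<Longrightarrow> a \<in> carrier G \<Longrightarrow> conjugate h (a [^] (n::nat)) = conjugate h a [^] n"
  by (induction n) (simp_all add: conjugate_mult, simp add: conjugate_def)

lemma conjugate_conjugate: "g \<in> carrier G \<Longrightarrow> h \<in> carrier G \<Longrightarrow> k \<in> carrier G \<Longrightarrow> conjugate g (conjugate h k) = conjugate (g \<otimes> h) k"
  by (simp add: conjugate_def word_simps)

lemma conjugate_inv_cancel: "h \<in> carrier G \<Longrightarrow> k \<in> carrier G \<Longrightarrow> conjugate (inv h) (conjugate h k) = k"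
  by (simp add: conjugate_def word_simps)

lemma conjugate_by_K: "c \<in> K \<Longrightarrow> k \<in> K \<Longrightarrow> conjugate c k = k"
  using K_comm[of c k] K_carrier by (simp add: conjugate_def m_assoc)

lemma conjugate_closed [simp]: "h \<in> carrier G \<Longrightarrow> k \<in> carrier G \<Longrightarrow> conjugate h k \<in> carrier G"
  by (simp add: conjugate_def)

lemma conjugate_less:
  assumes "h \<in> carrier G" "a \<in> K" "b \<in> K" "a <\<^sub>P b"
  shows "conjugate h a <\<^sub>P conjugate h b"
proof -
  have "inv a \<otimes> b \<in> P \<inter> K" using assms K.m_closed K.m_inv_closed by (simp add: prec_def)
  then have "conjugate h (inv a \<otimes> b) \<in> P" using action_positive assms(1) unfolding conjugate_def by blast
  then show ?thesis using assms K_carrier by (simp add: prec_def conjugate_mult conjugate_inv)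
qed

lemma pow_less_iff:
  assumes "a \<in> K" "b \<in> K" "0 < n"
  shows "a [^] (n::nat) <\<^sub>P b [^] n \<longleftrightarrow> a <\<^sub>P b"
proof -
  have c: "a \<in> carrier G" "b \<in> carrier G" using assms K_carrier by auto
  have "(inv a \<otimes> b) [^] n = inv a [^] n \<otimes> b [^] n"
    by (rule pow_mult_distrib) (use assms c K_comm K.m_inv_closed in auto)
  then have "inv (a [^] n) \<otimes> b [^] n = (inv a \<otimes> b) [^] n" using c by (simp add: nat_pow_inv)
  then show ?thesis using c pow_in_cone_iff[of "inv a \<otimes> b" n] assms(3) by (simp add: prec_def)
qed

text \<open>
  Any two elements of \<open>K\<close> have a common power, so it does not matter on which of them a contraction is
  tested.
\<close>
lemma contracting_independent:
  assumes h: "h \<in> carrier G" and k: "k \<in> P \<inter> K" "k' \<in> P \<inter> K" and less: "conjugate h k <\<^sub>P k"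
  shows "conjugate h k' <\<^sub>P k'"
proof -
  obtain m n :: nat where mn: "0 < m" "0 < n" "k [^] m = k' [^] n" using K_rank_one[OF k] by blast
  have c: "k \<in> carrier G" "k' \<in> carrier G" using k K_carrier by auto
  have "conjugate h k [^] m <\<^sub>P k [^] m" using pow_less_iff[of "conjugate h k" k m] less k h mn conjugate_in_K by auto
  moreover have "conjugate h k [^] m = conjugate h k' [^] n" using mn(3) h c by (simp flip: conjugate_pow)
  ultimately have "conjugate h k' [^] n <\<^sub>P k' [^] n" using mn(3) by simp
  then show ?thesis using pow_less_iff[of "conjugate h k'" k' n] k h mn conjugate_in_K by auto
qed

lemma expanding_inv_contracting:
  assumes h: "h \<in> carrier G" and k: "k \<in> K"
  shows "k <\<^sub>P conjugate h k \<longleftrightarrow> conjugate (inv h) k <\<^sub>P k"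
proof
  assume "k <\<^sub>P conjugate h k"
  from conjugate_less[OF inv_closed[OF h] k conjugate_in_K[OF h k] this]
  show "conjugate (inv h) k <\<^sub>P k" using h K_carrier[OF k] by (simp add: conjugate_inv_cancel)
next
  assume "conjugate (inv h) k <\<^sub>P k"
  from conjugate_less[OF h conjugate_in_K[OF inv_closed[OF h] k] k this]
  show "k <\<^sub>P conjugate h k" using h K_carrier[OF k] conjugate_inv_cancel[of "inv h" k] by simp
qed

lemma conjugate_pow_cases:
  assumes h: "h \<in> carrier G" and k: "k \<in> K" and n: "0 < (n::nat)"
  shows "conjugate h k <\<^sub>P k \<Longrightarrow> conjugate (h [^] n) k <\<^sub>P k"
    and "k <\<^sub>P conjugate h k \<Longrightarrow> k <\<^sub>P conjugate (h [^] n) k"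
    and "conjugate h k = k \<Longrightarrow> conjugate (h [^] n) k = k"
proof -
  have step: "conjugate (h [^] Suc m) k = conjugate (h [^] m) (conjugate h k)" for m :: nat
    using h K_carrier[OF k] by (simp add: conjugate_conjugate)
  have one: "conjugate \<one> k = k" using K_carrier[OF k] by (simp add: conjugate_def)
  show "conjugate (h [^] n) k <\<^sub>P k" if a: "conjugate h k <\<^sub>P k" using n
  proof (induction n)
    case (Suc m)
    show ?case
    proof (cases "m = 0")
      case False
      then show ?thesis
        using Suc.IH conjugate_less[OF _ conjugate_in_K[OF h k] k a, of "h [^] m"] h prec_trans unfolding step by blast
    qed (use a h in simp)
  qed simp
  show "k <\<^sub>P conjugate (h [^] n) k" if a: "k <\<^sub>P conjugate h k" using n
  proof (induction n)
    case (Suc m)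
    show ?case
    proof (cases "m = 0")
      case False
      then show ?thesis
        using Suc.IH conjugate_less[OF _ k conjugate_in_K[OF h k] a, of "h [^] m"] h prec_trans unfolding step by blast
    qed (use a h in simp)
  qed simp
  show "conjugate (h [^] n) k = k" if "conjugate h k = k"
  proof (induction n)
    case (Suc m)
    then show ?case unfolding step that by blast
  qed (simp add: one)
qed

text \<open>
  The positive elements outside \<open>K\<close> have common powers modulo \<open>K\<close>, and \<open>K\<close> acts trivially on itself.
  Therefore they all contract \<open>K\<close>, or they all expand it, or they all act trivially.
\<close>
lemma contracting_transfer:
  assumes h: "h \<in> P - K" and s: "s \<in> P - K" and k: "k \<in> K"
  shows "conjugate s k <\<^sub>P k \<Longrightarrow> conjugate h k <\<^sub>P k" "k <\<^sub>P conjugate s k \<Longrightarrow> k <\<^sub>P conjugate h k"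
proof -
  have c: "h \<in> carrier G" "s \<in> carrier G" "k \<in> carrier G" using h s cone_carrier K_carrier[OF k] by auto
  obtain m n :: nat where mn: "0 < m" "0 < n" "inv (s [^] n) \<otimes> h [^] m \<in> K"
    using quotient_rank_one[OF h s] by blast
  have "h [^] m = s [^] n \<otimes> (inv (s [^] n) \<otimes> h [^] m)" using c by (simp add: inv_mult_cancel)
  then have "conjugate (h [^] m) k = conjugate (s [^] n) (conjugate (inv (s [^] n) \<otimes> h [^] m) k)" using c by (simp add: conjugate_conjugate)
  then have eq: "conjugate (h [^] m) k = conjugate (s [^] n) k" using conjugate_by_K[OF mn(3) k] by simp
  note hp = conjugate_pow_cases[OF c(1) k mn(1)] and sp = conjugate_pow_cases[OF c(2) k mn(2)]
  have lin: "conjugate h k <\<^sub>P k \<or> conjugate h k = k \<or> k <\<^sub>P conjugate h k" using prec_linear c by simp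
  show "conjugate h k <\<^sub>P k" if "conjugate s k <\<^sub>P k"
    using sp(1)[OF that] hp lin prec_asym prec_irrefl unfolding eq by metis
  show "k <\<^sub>P conjugate h k" if "k <\<^sub>P conjugate s k"
    using sp(2)[OF that] hp lin prec_asym prec_irrefl unfolding eq by metis
qed

text \<open>
  The Archimedean property of \<open>K\<close>: if \<open>w\<^sup>-\<^sup>m = u\<^sup>n\<close> then \<open>(u\<^sup>N w)\<^sup>m = u\<^sup>N\<^sup>m\<^sup>-\<^sup>n\<close>.
\<close>
lemma power_dominates:
  assumes u: "u \<in> P \<inter> K" and w: "w \<in> K"
  shows "\<exists>N0. \<forall>N\<ge>N0. u [^] (N::nat) \<otimes> w \<in> P"
proof -
  have c: "u \<in> carrier G" "w \<in> carrier G" using u w K_carrier by auto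
  show ?thesis
  proof (rule cone_cases[OF c(2)])
    assume "w \<in> P"
    then have "u [^] N \<otimes> w \<in> P" if "N \<ge> 1" for N :: nat using cone_mult cone_pow[of u N] u that by simp
    then show ?thesis by blast
  next
    assume "w = \<one>"
    then have "u [^] N \<otimes> w \<in> P" if "N \<ge> 1" for N :: nat using cone_pow[of u N] u c that by simp
    then show ?thesis by blast
  next
    assume "inv w \<in> P"
    then obtain m n :: nat where mn: "0 < m" "0 < n" "inv w [^] m = u [^] n"
      using K_rank_one[of "inv w" u] K.m_inv_closed[OF w] u by blast
    have "u [^] N \<otimes> w \<in> P" if N: "N \<ge> Suc n" for N
    proof -
      have "(u [^] N \<otimes> w) [^] m = (u [^] N) [^] m \<otimes> w [^] m"
        by (rule pow_mult_distrib) (use K_comm K_pow u w c in auto)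
      also have "w [^] m = inv (u [^] n)" using mn(3) c nat_pow_inv[of w m] by (metis inv_inv nat_pow_closed)
      also have "(u [^] N) [^] m \<otimes> inv (u [^] n) = u [^] (N * m - n)"
      proof -
        have "n \<le> N * m" using N mn(1) by (metis Suc_leD le_trans mult_le_mono1 mult.commute mult.right_neutral Suc_leI One_nat_def mult_le_mono2)
        then have "u [^] (N * m) = u [^] (N * m - n) \<otimes> u [^] n" using c by (simp add: nat_pow_mult)
        then show ?thesis using c by (simp add: nat_pow_pow m_assoc)
      qed
      finally have "(u [^] N \<otimes> w) [^] m = u [^] (N * m - n)" .
      moreover have "0 < N * m - n" using N mn(1)
        by (metis Suc_le_eq le_trans mult_le_mono2 nat_mult_1_right zero_less_diff One_nat_def Suc_leI)
      ultimately have "(u [^] N \<otimes> w) [^] m \<in> P" using cone_pow u by simp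
      then show ?thesis using pow_in_cone_iff[of "u [^] N \<otimes> w" m] c mn(1) by simp
    qed
    then show ?thesis by blast
  qed
qed

definition commutator :: "'a \<Rightarrow> 'a \<Rightarrow> 'a" where
  "commutator h t = h \<otimes> t \<otimes> inv h \<otimes> inv t"

lemma commutator_mem: "h \<in> carrier G \<Longrightarrow> t \<in> carrier G \<Longrightarrow> commutator h t \<in> K"
  unfolding commutator_def by (rule commutator_in_K)

text \<open>
  If \<open>t\<close> contracts \<open>K\<close>, then \<open>G\<close> acts on the rational line \<open>K \<otimes> \<rat>\<close> by affine maps, with \<open>K\<close> as
  translations and \<open>t\<close> fixing one point. Up to a constant positive factor the commutator of \<open>h\<close> and \<open>t\<close> is the
  displacement of this point under \<open>h\<close>, so the cone below is the ordering of \<open>G\<close> by the images of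
  a base point, with ties broken by \<open>P\<close>.
\<close>
definition commutator_cone :: "'a \<Rightarrow> 'a set" where
  "commutator_cone t = {h \<in> carrier G. commutator h t \<in> P \<or> (commutator h t = \<one> \<and> h \<in> P)}"

text \<open>
  Closure under products comes from the identity \<open>[g h, t] = (g [h, t] g\<inverse>) [g, t]\<close> and the assumption
  that conjugation preserves the sign of elements of \<open>K\<close>.
\<close>
lemma commutator_cone:
  assumes t: "t \<in> carrier G"
  shows "commutator_cone t \<in> LO G"
proof -
  have mult: "commutator (g \<otimes> h) t = conjugate g (commutator h t) \<otimes> commutator g t" if "g \<in> carrier G" "h \<in> carrier G" for g h
    using that t by (simp add: commutator_def conjugate_def word_simps)
  have inv: "commutator (inv h) t = conjugate (inv h) (inv (commutator h t))" if "h \<in> carrier G" for h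
    using that t by (simp add: commutator_def conjugate_def word_simps)
  have pos: "conjugate g k \<in> P" if "g \<in> carrier G" "k \<in> K" "k \<in> P" for g k
    using action_positive that unfolding conjugate_def by blast
  have one: "conjugate g \<one> = \<one>" if "g \<in> carrier G" for g using that by (simp add: conjugate_def)
  show ?thesis unfolding LO_iff[OF is_group]
  proof (intro conjI ballI impI)
    show "commutator_cone t \<subseteq> carrier G" by (auto simp: commutator_cone_def)
    show "\<one> \<notin> commutator_cone t" using t one_notin_cone by (simp add: commutator_cone_def commutator_def)
    fix g h assume g: "g \<in> commutator_cone t" and h: "h \<in> commutator_cone t"
    then have c: "g \<in> carrier G" "h \<in> carrier G" by (auto simp: commutator_cone_def)
    note Kg = commutator_mem[OF c(1) t] and Kh = commutator_mem[OF c(2) t]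
    have cc: "commutator g t \<in> carrier G" "commutator h t \<in> carrier G" using Kg Kh K_carrier by auto
    consider "commutator g t \<in> P" "commutator h t \<in> P" | "commutator g t = \<one>" "g \<in> P" "commutator h t \<in> P"
      | "commutator g t \<in> P" "commutator h t = \<one>" | "commutator g t = \<one>" "g \<in> P" "commutator h t = \<one>" "h \<in> P"
      using g h by (auto simp: commutator_cone_def)
    then have "commutator (g \<otimes> h) t \<in> P \<or> (commutator (g \<otimes> h) t = \<one> \<and> g \<otimes> h \<in> P)"
    proof cases
      case 1 then show ?thesis unfolding mult[OF c] using pos[OF c(1) Kh] cone_mult by blast
    next
      case 2 then show ?thesis unfolding mult[OF c] using pos[OF c(1) Kh] cc c by simp
    next
      case 3 then show ?thesis unfolding mult[OF c] using one[OF c(1)] cc by simp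
    next
      case 4 then show ?thesis unfolding mult[OF c] using one[OF c(1)] cone_mult by simp
    qed
    then show "g \<otimes> h \<in> commutator_cone t" using c by (simp add: commutator_cone_def)
  next
    fix h assume h: "h \<in> carrier G" "h \<noteq> \<one>"
    let ?k = "commutator h t"
    have k: "?k \<in> K" "?k \<in> carrier G" "inv ?k \<in> K" using commutator_mem[OF h(1) t] K_carrier K.m_inv_closed by auto
    have undo: "conjugate h (commutator (inv h) t) = inv ?k"
      unfolding inv[OF h(1)] using h k conjugate_inv_cancel[of "inv h"] by simp
    have Ki: "commutator (inv h) t \<in> K" using commutator_mem[OF inv_closed[OF h(1)] t] .
    show "h \<in> commutator_cone t \<longleftrightarrow> inv h \<notin> commutator_cone t"
    proof (rule cone_cases[OF k(2)])
      assume kP: "?k \<in> P"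
      have "commutator (inv h) t \<notin> P" using pos[OF h(1) Ki] undo cone_inv[OF kP] by auto
      moreover have "commutator (inv h) t \<noteq> \<one>"
      proof
        assume "commutator (inv h) t = \<one>"
        then have "inv ?k = \<one>" using undo one[OF h(1)] by simp
        then show False using kP k one_notin_cone by simp
      qed
      ultimately show ?thesis using kP h by (simp add: commutator_cone_def)
    next
      assume k1: "?k = \<one>"
      then have "commutator (inv h) t = \<one>" unfolding inv[OF h(1)] using one h by simp
      then show ?thesis using k1 h one_notin_cone inv_in_cone_iff[OF h] by (simp add: commutator_cone_def)
    next
      assume kP: "inv ?k \<in> P"
      then have "commutator (inv h) t \<in> P" unfolding inv[OF h(1)] using pos[of "inv h" "inv ?k"] h k by simp
      moreover have "?k \<notin> P" using cone_inv[of ?k] kP by blast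
      moreover have "?k \<noteq> \<one>" using kP one_notin_cone by auto
      ultimately show ?thesis using h by (simp add: commutator_cone_def)
    qed
  qed
qed

text \<open>
  For \<open>x, y \<notin> K\<close> put \<open>z = [x, y]\<close>, a central element. Some power \<open>x\<^sup>m\<close> equals \<open>y\<^sup>n k\<close> with \<open>k \<in> K\<close>, so it
  commutes with \<open>y\<close>; but its commutator with \<open>y\<close> is \<open>z\<^sup>m\<close>, and the group is torsion free.
\<close>
lemma central_imp_comm:
  assumes central: "\<And>h k. h \<in> carrier G \<Longrightarrow> k \<in> K \<Longrightarrow> conjugate h k = k"
  shows "comm_group G"
proof (rule cone_commutes_imp_comm)
  fix x y assume xy: "x \<in> P" "y \<in> P"
  then have c: "x \<in> carrier G" "y \<in> carrier G" using cone_carrier by auto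
  have cent: "h \<otimes> k = k \<otimes> h" if "h \<in> carrier G" "k \<in> K" for h k
  proof -
    have "conjugate h k \<otimes> h = h \<otimes> k" using that K_carrier[OF that(2)] by (simp add: conjugate_def m_assoc)
    then show ?thesis using central[OF that] by simp
  qed
  consider "x \<in> K" | "y \<in> K" | "x \<in> P - K" "y \<in> P - K" using xy by blast
  then show "x \<otimes> y = y \<otimes> x"
  proof cases
    case 1 then show ?thesis using cent[of y x] c by simp
  next
    case 2 then show ?thesis using cent[of x y] c by simp
  next
    case 3
    define z where "z = commutator x y"
    have z: "z \<in> K" "z \<in> carrier G" using commutator_mem[OF c] K_carrier by (auto simp: z_def)
    have xy_eq: "x \<otimes> y = z \<otimes> (y \<otimes> x)" using c by (simp add: z_def commutator_def word_simps)
    have pow: "x [^] j \<otimes> y = z [^] j \<otimes> (y \<otimes> x [^] j)" for j :: nat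
    proof (induction j)
      case (Suc j)
      have "x [^] Suc j \<otimes> y = x [^] j \<otimes> (z \<otimes> (y \<otimes> x))" using c by (simp add: m_assoc xy_eq)
      also have "\<dots> = z \<otimes> (x [^] j \<otimes> y) \<otimes> x"
        using c z cent[of "x [^] j" z] by (simp flip: m_assoc)
      also have "\<dots> = z [^] Suc j \<otimes> (y \<otimes> x [^] Suc j)"
        unfolding Suc using c z nat_pow_mult[of z 1 j] by (simp flip: m_assoc)
      finally show ?case .
    qed (use c in simp)
    obtain m n :: nat where mn: "0 < m" "0 < n" "inv (y [^] n) \<otimes> x [^] m \<in> K"
      using quotient_rank_one[OF 3] by blast
    define k where "k = inv (y [^] n) \<otimes> x [^] m"
    have k: "k \<in> K" "k \<in> carrier G" using mn K_carrier by (auto simp: k_def)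
    have xm: "x [^] m = y [^] n \<otimes> k" using c by (simp add: k_def inv_mult_cancel)
    have "y \<otimes> x [^] m = x [^] m \<otimes> y"
    proof -
      have "y \<otimes> (y [^] n \<otimes> k) = y [^] n \<otimes> (y \<otimes> k)" using c k nat_pow_mult[of y 1 n] nat_pow_mult[of y n 1] by (simp flip: m_assoc)
      then show ?thesis unfolding xm using c k cent[OF c(2) k(1)] by (simp add: m_assoc)
    qed
    then have "x [^] m \<otimes> y = z [^] m \<otimes> (x [^] m \<otimes> y)" using pow[of m] by simp
    then have "z [^] m = \<one>" using c z by (metis m_closed nat_pow_closed r_cancel_one')
    then have "z = \<one>" using pow_eq_one z(2) mn(1) by blast
    then show ?thesis using xy_eq c by simp
  qed
qed

text \<open>
  If the action is trivial then \<open>G\<close> is abelian with an isolated ordering, so elements of \<open>K\<close> and of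
  \<open>P - K\<close> have a common power, which is impossible for a convex \<open>K\<close>. Otherwise some \<open>t\<^sub>0\<close> contracts \<open>K\<close>.
  Replacing \<open>t\<^sub>0\<close> by \<open>t = k\<^sub>1\<^sup>N t\<^sub>0\<close> moves its fixed point along the line, and as the base point tends to
  the correct end of the line the orderings \<open>commutator_cone t\<close> converge to \<open>P\<close>. They differ from \<open>P\<close>:
  for \<open>k > 1\<close> in \<open>K\<close> the elements \<open>k t\<close> and \<open>k\<inverse> t\<close> have opposite signs in \<open>commutator_cone t\<close>, but the
  same sign in \<open>P\<close> because \<open>K\<close> is convex and \<open>t \<notin> K\<close>.
\<close>
lemma positive_action_not_isolated:
  assumes iso: "isolated_cone G P" and K1: "K \<noteq> {\<one>}" and K2: "K \<noteq> carrier G"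
  shows False
proof -
  have "{\<one>} \<subset> K" using K1 K.one_closed by blast
  then obtain k0 where "k0 \<in> P" "k0 \<in> K" using convex_pos_diff[OF triv_subgroup K.subgroup_axioms] by blast
  then have k0: "k0 \<in> P \<inter> K" "k0 \<in> K" "k0 \<in> P" "k0 \<in> carrier G" using K_carrier by auto
  have "K \<subset> carrier G" using K2 K.subset by blast
  then obtain x0 where "x0 \<in> P" "x0 \<notin> K" using convex_pos_diff[OF K.subgroup_axioms subgroup_self] by blast
  then have x0: "x0 \<in> P - K" by blast
  obtain F where F: "finite F" "F \<subseteq> P" "\<And>Q. Q \<in> LO G \<Longrightarrow> F \<subseteq> Q \<Longrightarrow> Q = P"
    using iso by (auto simp: isolated_cone_def)
  have "\<exists>t\<in>carrier G. conjugate t k0 <\<^sub>P k0"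
  proof (rule ccontr)
    assume no: "\<not> ?thesis"
    have posfix: "conjugate h k = k" if h: "h \<in> carrier G" and k: "k \<in> P \<inter> K" for h k
    proof -
      have "\<not> conjugate h k <\<^sub>P k" using contracting_independent[OF h k k0(1)] no h by blast
      moreover have "\<not> conjugate (inv h) k <\<^sub>P k"
        using contracting_independent[OF inv_closed[OF h] k k0(1)] no h by blast
      then have "\<not> k <\<^sub>P conjugate h k" using expanding_inv_contracting[OF h] k by blast
      ultimately show ?thesis using prec_linear[of "conjugate h k" k] h k K_carrier by auto
    qed
    have "conjugate h k = k" if h: "h \<in> carrier G" and k: "k \<in> K" for h k
    proof (rule cone_cases[OF K_carrier[OF k]])
      assume "inv k \<in> P"
      then have "inv (conjugate h k) = inv k" using posfix[OF h, of "inv k"] K.m_inv_closed[OF k] conjugate_inv[OF h] K_carrier[OF k] by simp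
      then show ?thesis using h K_carrier[OF k] by (metis conjugate_closed inv_inv)
    qed (use posfix h k in \<open>auto simp: conjugate_def\<close>)
    then have "comm_group G" by (rule central_imp_comm)
    from isolated_abelian_commensurable[OF this iso, of x0 k0]
    obtain m n :: nat where "0 < m" "x0 [^] m = k0 [^] n" using x0 k0 by blast
    then have "x0 \<in> K" using convex_root[OF K_convex, of x0 m] K_pow[OF k0(2)] x0 cone_carrier by auto
    then show False using x0 by blast
  qed
  then obtain t0 where t0: "t0 \<in> carrier G" "conjugate t0 k0 <\<^sub>P k0" by blast
  have t0K: "t0 \<notin> K" using conjugate_by_K[of t0 k0] k0 t0 prec_irrefl by auto
  \<comment> \<open>The direction in which the base point has to move: \<open>k\<^sub>0\<close> if positive elements expand \<open>K\<close>, its inverse if they contract it.\<close>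
  have "\<exists>k\<in>K. \<forall>h\<in>P - K. conjugate h k \<otimes> inv k \<in> P"
  proof (rule cone_cases[OF t0(1)])
    assume "t0 \<in> P"
    then have "conjugate h k0 <\<^sub>P k0" if "h \<in> P - K" for h using contracting_transfer(1)[OF that _ k0(2) t0(2)] t0K by blast
    then have "conjugate h (inv k0) \<otimes> inv (inv k0) \<in> P" if "h \<in> P - K" for h
      using that k0 cone_carrier by (simp add: conjugate_inv prec_def)
    then show ?thesis using K.m_inv_closed[OF k0(2)] by blast
  next
    assume "t0 = \<one>" then show ?thesis using t0K K.one_closed by blast
  next
    assume "inv t0 \<in> P"
    moreover have "inv t0 \<notin> K" using t0K K.m_inv_closed[of "inv t0"] t0 by auto
    moreover have "k0 <\<^sub>P conjugate (inv t0) k0" using expanding_inv_contracting[of "inv t0" k0] t0 k0 by simp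
    ultimately have up: "k0 <\<^sub>P conjugate h k0" if "h \<in> P - K" for h
      using contracting_transfer(2)[OF that _ k0(2)] by blast
    have "conjugate h k0 \<otimes> inv k0 \<in> P" if h: "h \<in> P - K" for h
    proof -
      have "h \<in> carrier G" using h cone_carrier by blast
      then have "inv k0 \<otimes> conjugate h k0 = conjugate h k0 \<otimes> inv k0"
        using K_comm[OF K.m_inv_closed[OF k0(2)]] conjugate_in_K k0 by blast
      moreover have "inv k0 \<otimes> conjugate h k0 \<in> P" using up[OF h] by (simp add: prec_def)
      ultimately show ?thesis by simp
    qed
    then show ?thesis using k0 by blast
  qed
  then obtain k1 where k1: "k1 \<in> K" and expand: "\<And>h. h \<in> P - K \<Longrightarrow> conjugate h k1 \<otimes> inv k1 \<in> P" by blast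
  have k1c: "k1 \<in> carrier G" using k1 K_carrier by blast
  have "\<forall>g\<in>F - K. \<exists>N0. \<forall>N\<ge>N0. (conjugate g k1 \<otimes> inv k1) [^] (N::nat) \<otimes> commutator g t0 \<in> P"
  proof
    fix g assume g: "g \<in> F - K"
    then have gc: "g \<in> carrier G" "g \<in> P - K" using F cone_carrier by auto
    then have "conjugate g k1 \<otimes> inv k1 \<in> P \<inter> K"
      using expand K.m_closed[OF conjugate_in_K[OF gc(1) k1] K.m_inv_closed[OF k1]] by blast
    then show "\<exists>N0. \<forall>N\<ge>N0. (conjugate g k1 \<otimes> inv k1) [^] (N::nat) \<otimes> commutator g t0 \<in> P"
      by (rule power_dominates[OF _ commutator_mem[OF gc(1) t0(1)]])
  qed
  then have "\<forall>g\<in>F - K. \<forall>\<^sub>F N in sequentially. (conjugate g k1 \<otimes> inv k1) [^] (N::nat) \<otimes> commutator g t0 \<in> P"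
    by (simp add: eventually_sequentially)
  then have "\<forall>\<^sub>F N in sequentially. \<forall>g\<in>F - K. (conjugate g k1 \<otimes> inv k1) [^] (N::nat) \<otimes> commutator g t0 \<in> P"
    using F(1) by (intro eventually_ball_finite) auto
  then obtain N :: nat where N: "\<And>g. g \<in> F - K \<Longrightarrow> (conjugate g k1 \<otimes> inv k1) [^] (N::nat) \<otimes> commutator g t0 \<in> P"
    unfolding eventually_sequentially by blast
  \<comment> \<open>A common exponent for the finitely many \<open>g \<in> F\<close> outside \<open>K\<close>: the commutator of \<open>g\<close> and \<open>t\<close> is the positive element tested by \<open>N\<close>.\<close>
  define t where "t = k1 [^] N \<otimes> t0"
  have k1N: "k1 [^] N \<in> K" "k1 [^] N \<in> carrier G" using K_pow[OF k1] k1c by auto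
  have t: "t \<in> carrier G" using t0 k1N by (simp add: t_def)
  have tK: "t \<notin> K"
  proof
    assume "t \<in> K"
    then have "inv (k1 [^] N) \<otimes> t \<in> K" using K.m_closed K.m_inv_closed k1N by blast
    then show False using t0K t0 k1N by (simp add: t_def inv_mult_cancel)
  qed
  have conjugate_t: "conjugate t k = conjugate t0 k" if k: "k \<in> K" for k
  proof -
    have "conjugate t k = conjugate (k1 [^] N) (conjugate t0 k)" using t0 k1N K_carrier[OF k] by (simp add: t_def conjugate_conjugate)
    then show ?thesis using conjugate_by_K[OF k1N(1) conjugate_in_K[OF t0(1) k]] by simp
  qed
  have pos: "commutator k t \<in> P" if k: "k \<in> P \<inter> K" for k
  proof -
    have kc: "k \<in> carrier G" using k K_carrier by blast
    have "conjugate t k <\<^sub>P k" using contracting_independent[OF t0(1) k0(1) k t0(2)] conjugate_t k by simp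
    then have "inv (conjugate t k) \<otimes> k \<in> P" by (simp add: prec_def)
    moreover have "inv (conjugate t k) \<otimes> k = k \<otimes> inv (conjugate t k)"
      using K_comm k conjugate_in_K[OF t] K.m_inv_closed by blast
    moreover have "k \<otimes> inv (conjugate t k) = commutator k t" using kc t by (simp add: conjugate_def commutator_def word_simps)
    ultimately show ?thesis by simp
  qed
  have "g \<in> commutator_cone t" if g: "g \<in> F" for g
  proof -
    have gc: "g \<in> carrier G" "g \<in> P" using g F cone_carrier by auto
    have "commutator g t \<in> P"
    proof (cases "g \<in> K")
      case False
      have w: "commutator g t0 \<in> K" "commutator g t0 \<in> carrier G" using commutator_mem[OF gc(1) t0(1)] K_carrier by auto
      have "commutator g t = conjugate g (k1 [^] N) \<otimes> (commutator g t0 \<otimes> inv (k1 [^] N))"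
        using gc t0 k1N by (simp add: t_def commutator_def conjugate_def word_simps)
      also have "commutator g t0 \<otimes> inv (k1 [^] N) = inv (k1 [^] N) \<otimes> commutator g t0"
        using K_comm[OF w(1) K.m_inv_closed[OF k1N(1)]] .
      also have "conjugate g (k1 [^] N) \<otimes> (inv (k1 [^] N) \<otimes> commutator g t0) =
          (conjugate g k1 [^] N \<otimes> inv k1 [^] N) \<otimes> commutator g t0"
        using gc k1c w by (simp add: conjugate_pow nat_pow_inv m_assoc)
      also have "conjugate g k1 [^] N \<otimes> inv k1 [^] N = (conjugate g k1 \<otimes> inv k1) [^] N"
        by (rule pow_mult_distrib[symmetric])
          (use K_comm[OF conjugate_in_K[OF gc(1) k1] K.m_inv_closed[OF k1]] gc k1c in auto)
      finally show ?thesis using N[of g] g False by simp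
    qed (use pos gc in blast)
    then show ?thesis using gc by (simp add: commutator_cone_def)
  qed
  then have QP: "commutator_cone t = P" using F(3)[OF commutator_cone[OF t]] by blast
  have "commutator (k0 \<otimes> t) t = commutator k0 t" using k0 t by (simp add: commutator_def word_simps)
  then have "k0 \<otimes> t \<in> commutator_cone t" using pos[OF k0(1)] k0 t by (simp add: commutator_cone_def)
  then have in1: "k0 \<otimes> t \<in> P" by (simp only: QP)
  have "commutator (inv k0 \<otimes> t) t = inv k0 \<otimes> (inv (commutator k0 t) \<otimes> k0)"
    using k0 t by (simp add: commutator_def word_simps)
  also have "\<dots> = inv (commutator k0 t)"
    using K_comm[OF K.m_inv_closed[OF commutator_mem[OF k0(4) t]] k0(2)] k0 K_carrier[OF commutator_mem[OF k0(4) t]]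
    by (simp add: inv_mult_cancel)
  finally have e: "commutator (inv k0 \<otimes> t) t = inv (commutator k0 t)" .
  have ck: "commutator k0 t \<in> P" using pos k0 by blast
  then have "commutator (inv k0 \<otimes> t) t \<notin> P" "commutator (inv k0 \<otimes> t) t \<noteq> \<one>"
    unfolding e using cone_inv[OF ck] one_notin_cone cone_carrier[OF ck] by auto
  then have "inv k0 \<otimes> t \<notin> commutator_cone t" by (simp add: commutator_cone_def)
  then have notin: "inv k0 \<otimes> t \<notin> P" by (simp only: QP not_False_eq_True)
  show False
  proof (rule cone_cases[OF t])
    assume "t \<in> P"
    then show False using convex_absorb(3)[OF K_convex _ tK K.m_inv_closed[OF k0(2)]] notin by blast
  next
    assume "t = \<one>" then show False using tK K.one_closed by blast
  next
    assume i: "inv t \<in> P"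
    have "inv t \<notin> K" using tK K.m_inv_closed[of "inv t"] t by auto
    then have "inv t \<otimes> inv k0 \<in> P" using convex_absorb(1)[OF K_convex i _ K.m_inv_closed[OF k0(2)]] by blast
    then show False using cone_inv[OF in1] k0 t by (simp add: inv_mult_group)
  qed
qed

end

section \<open>Orderings relative to a convex subgroup of corank one\<close>

text \<open>
  For normal convex \<open>N\<close> with abelian quotient: \<open>G / N\<close> has rank at most one.
\<close>
definition rank_one_over :: "('a, 'b) monoid_scheme \<Rightarrow> 'a set \<Rightarrow> 'a set \<Rightarrow> bool" where
  "rank_one_over G P N \<longleftrightarrow> (\<forall>x\<in>P - N. \<forall>y\<in>P - N. \<exists>m>0. \<exists>n>0.
     inv\<^bsub>G\<^esub> (y [^]\<^bsub>G\<^esub> (n::nat)) \<otimes>\<^bsub>G\<^esub> x [^]\<^bsub>G\<^esub> (m::nat) \<in> N)"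

lemma (in left_ordered) rank_one_over_same_sign:
  assumes rank: "rank_one_over G P N" and Q: "Q \<in> LO G" and N: "cone_convex G Q N"
    and xy: "x \<in> P - N" "y \<in> P - N" and x: "x \<in> Q"
  shows "y \<in> Q"
proof -
  interpret Q: left_ordered G Q by unfold_locales (rule Q)
  interpret N: subgroup N G using N by (rule Q.convex_subgroupD)
  have c: "x \<in> carrier G" "y \<in> carrier G" using xy cone_carrier by auto
  obtain m n :: nat where mn: "0 < m" "0 < n" "inv (y [^] n) \<otimes> x [^] m \<in> N"
    using rank xy unfolding rank_one_over_def by blast
  have 1: "x [^] m \<in> Q" "x [^] m \<notin> N" using Q.cone_pow[OF x mn(1)] Q.convex_root[OF N c(1) _ mn(1)] xy by auto
  have "y [^] n = x [^] m \<otimes> inv (inv (y [^] n) \<otimes> x [^] m)" using c by (simp add: word_simps)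
  then have "y [^] n \<in> Q" using Q.convex_absorb(1)[OF N 1 N.m_inv_closed[OF mn(3)]] by metis
  then show ?thesis using Q.pow_in_cone_iff[OF c(2) mn(2)] by blast
qed

text \<open>
  A group of rank one has only two orderings. So an ordering in which \<open>N\<close> is convex is determined by
  its restriction to \<open>N\<close> and the sign of one element outside \<open>N\<close>.
\<close>
lemma (in left_ordered) rank_one_over_cone_eqI:
  assumes rank: "rank_one_over G P N" and N: "cone_convex G P N" and t: "t \<in> P - N"
    and Q: "Q \<in> LO G" "cone_convex G Q N" and Q': "Q' \<in> LO G" "cone_convex G Q' N"
    and eq: "Q \<inter> N = Q' \<inter> N" "t \<in> Q \<longleftrightarrow> t \<in> Q'"
  shows "Q = Q'"
proof -
  interpret Q: left_ordered G Q by unfold_locales (rule Q(1))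
  interpret Q': left_ordered G Q' by unfold_locales (rule Q'(1))
  interpret N: subgroup N G using N by (rule convex_subgroupD)
  have pos: "x \<in> Q \<longleftrightarrow> x \<in> Q'" if x: "x \<in> P - N" for x
    using rank_one_over_same_sign[OF rank Q x t] rank_one_over_same_sign[OF rank Q t x]
      rank_one_over_same_sign[OF rank Q' x t] rank_one_over_same_sign[OF rank Q' t x] eq(2) by blast
  have "x \<in> Q'" if x: "x \<in> Q" for x
  proof (cases "x \<in> N")
    case True then show ?thesis using x eq(1) by blast
  next
    case False
    have xc: "x \<in> carrier G" using x Q.cone_carrier by blast
    show ?thesis
    proof (rule cone_cases[OF xc])
      assume "x \<in> P" then show ?thesis using pos x False by blast
    next
      assume "x = \<one>" then show ?thesis using False N.one_closed by blast
    next
      assume i: "inv x \<in> P"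
      have "inv x \<notin> N" using False N.m_inv_closed[of "inv x"] xc by auto
      then have "inv x \<notin> Q'" using pos[of "inv x"] i Q.cone_inv[OF x] by blast
      moreover have "x \<noteq> \<one>" using False N.one_closed by blast
      ultimately show ?thesis using Q'.inv_in_cone_iff[OF xc] by blast
    qed
  qed
  then show ?thesis using Q.cone_eqI[OF Q'(1)] by blast
qed

lemma (in left_ordered) rank_one_over_commensurable:
  assumes rank: "rank_one_over G P N" and N: "N \<lhd> G"
    and x: "x \<in> carrier G" "x \<notin> N" and y: "y \<in> carrier G" "y \<notin> N"
  obtains m n :: nat and k where "0 < m" "0 < n" "k \<in> N" "x [^] m = y [^] n \<otimes> k \<or> x [^] m = inv y [^] n \<otimes> k"
proof -
  interpret N: normal N G by fact
  have sgn: "\<exists>w. w \<in> P - N \<and> (w = z \<or> w = inv z)" if z: "z \<in> carrier G" "z \<notin> N" for z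
  proof -
    have "inv z \<notin> N" using z N.m_inv_closed[of "inv z"] by auto
    then show ?thesis using z N.one_closed by (cases rule: cone_cases[OF z(1)]) blast+
  qed
  obtain x' where x': "x' \<in> P - N" "x' = x \<or> x' = inv x" using sgn[OF x] by blast
  obtain y' where y': "y' \<in> P - N" "y' = y \<or> y' = inv y" using sgn[OF y] by blast
  obtain m n :: nat where mn: "0 < m" "0 < n" "inv (y' [^] n) \<otimes> x' [^] m \<in> N"
    using rank x'(1) y'(1) unfolding rank_one_over_def by blast
  define k where "k = inv (y' [^] n) \<otimes> x' [^] m"
  have c: "x' \<in> carrier G" "y' \<in> carrier G" using x' y' x y by auto
  have k: "k \<in> N" "k \<in> carrier G" using mn by (auto simp: k_def)
  have eq: "x' [^] m = y' [^] n \<otimes> k" using c by (simp add: k_def inv_mult_cancel)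
  from x'(2) show ?thesis
  proof
    assume "x' = x"
    then have "x [^] m = y [^] n \<otimes> k \<or> x [^] m = inv y [^] n \<otimes> k" using eq y'(2) by auto
    then show ?thesis by (rule that[OF mn(1,2) k(1)])
  next
    assume x'': "x' = inv x"
    define l where "l = y' [^] n \<otimes> inv k \<otimes> inv (y' [^] n)"
    have l: "l \<in> N" unfolding l_def using N.inv_op_closed2 k c N.m_inv_closed by simp
    have "x [^] m = inv (x' [^] m)" using x'' x by (simp add: nat_pow_inv)
    also have "\<dots> = inv (y' [^] n) \<otimes> l" unfolding eq l_def using c k by (simp add: word_simps)
    also have "inv (y' [^] n) = inv y' [^] n" using c by (simp add: nat_pow_inv)
    finally have "x [^] m = y [^] n \<otimes> l \<or> x [^] m = inv y [^] n \<otimes> l" using y'(2) y by auto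
    then show ?thesis by (rule that[OF mn(1,2) l])
  qed
qed

lemma (in left_ordered) largest_proper_convex:
  assumes fin: "finite {C. cone_convex G P C}" and nontrivial: "carrier G \<noteq> {\<one>}"
  obtains N where "cone_convex G P N" "N \<noteq> carrier G"
    "\<And>C. cone_convex G P C \<Longrightarrow> C \<noteq> carrier G \<Longrightarrow> C \<subseteq> N"
proof -
  let ?S = "{C. cone_convex G P C \<and> C \<noteq> carrier G}"
  have "finite ?S" using fin by (rule rev_finite_subset) blast
  moreover have "?S \<noteq> {}" using convex_one nontrivial by blast
  ultimately obtain N where N: "N \<in> ?S" "\<And>C. C \<in> ?S \<Longrightarrow> N \<subseteq> C \<Longrightarrow> N = C"
    using finite_has_maximal[of ?S] by metis
  have "C \<subseteq> N" if "cone_convex G P C" "C \<noteq> carrier G" for C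
    using convex_chain[of C N] N(1) N(2)[of C] that by blast
  then show ?thesis using that N(1) by blast
qed

text \<open>
  Without a sign change, \<open>G / M\<close> with its subgroup \<open>N / M\<close> would be a positive action with an isolated
  ordering. Some \<open>t\<close> must therefore reverse the order of \<open>N / M\<close>.
\<close>
lemma (in left_ordered) convex_jump_sign_change:
  assumes iso: "isolated_cone G P"
    and M: "cone_convex G P M" "M \<lhd> G" and N: "cone_convex G P N" "N \<lhd> G"
    and MN: "M \<subset> N" and NG: "N \<noteq> carrier G"
    and commN: "\<And>x y. x \<in> N \<Longrightarrow> y \<in> N \<Longrightarrow> x \<otimes> y \<otimes> inv x \<otimes> inv y \<in> M"
    and rankN: "rank_one_over (restricted G N) (P \<inter> N) M"
    and commG: "\<And>x y. x \<in> carrier G \<Longrightarrow> y \<in> carrier G \<Longrightarrow> x \<otimes> y \<otimes> inv x \<otimes> inv y \<in> N"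
    and rankG: "rank_one_over G P N"
  obtains t a where "t \<in> carrier G" "a \<in> P \<inter> N - M" "t \<otimes> a \<otimes> inv t \<notin> P"
proof (rule ccontr)
  assume "\<not> thesis"
  then have act: "t \<otimes> a \<otimes> inv t \<in> P" if "t \<in> carrier G" "a \<in> P \<inter> N - M" for t a
    using that(1,2) \<open>\<And>t a. t \<in> carrier G \<Longrightarrow> a \<in> P \<inter> N - M \<Longrightarrow> t \<otimes> a \<otimes> inv t \<notin> P \<Longrightarrow> thesis\<close> by blast
  let ?h = "\<lambda>x. M #> x" and ?H = "G Mod M"
  interpret M: normal M G by fact
  interpret N: normal N G by fact
  interpret q: ordered_epi G P ?H ?h by (rule natural_epi(1)[OF M(2,1)])
  note ker = natural_epi(2)[OF M(2,1)]
  note grpH = M.factorgroup_is_group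
  let ?K = "?h ` N"
  have to_one: "?h x = \<one>\<^bsub>?H\<^esub> \<longleftrightarrow> x \<in> M" if "x \<in> carrier G" for x
    using q.in_kernel_iff[OF that] unfolding ker by blast
  have in_K: "?h x \<in> ?K \<longleftrightarrow> x \<in> N" if x: "x \<in> carrier G" for x
  proof
    assume "?h x \<in> ?K"
    then obtain y where y: "y \<in> N" "?h x = ?h y" by blast
    then have yc: "y \<in> carrier G" using N.mem_carrier by blast
    have "?h (inv y \<otimes> x) = inv\<^bsub>?H\<^esub> ?h y \<otimes>\<^bsub>?H\<^esub> ?h x" using x yc by (simp only: q.hom_mult q.hom_inv inv_closed)
    also have "\<dots> = \<one>\<^bsub>?H\<^esub>" unfolding y(2) by (rule group.l_inv[OF grpH q.hom_closed[OF yc]])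
    finally have "inv y \<otimes> x \<in> N" using to_one[of "inv y \<otimes> x"] x yc MN by auto
    then have "y \<otimes> (inv y \<otimes> x) \<in> N" using y N.m_closed by blast
    then show "x \<in> N" using x yc by (simp add: inv_mult_cancel)
  qed blast
  have in_cone: "?h x \<in> q.image_cone \<longleftrightarrow> x \<in> P \<and> x \<notin> M" if "x \<in> carrier G" for x
    using q.in_image_cone_iff[OF that] unfolding ker by blast
  have pull: "\<exists>x. x \<in> P - M \<and> a = ?h x" if "a \<in> q.image_cone" for a
    using that unfolding q.image_cone_def ker by blast
  have pullG: "\<exists>x. x \<in> carrier G \<and> a = ?h x" if "a \<in> carrier ?H" for a
    using that unfolding q.surj[symmetric] by blast
  have hpow: "?h (x [^] (n::nat)) = ?h x [^]\<^bsub>?H\<^esub> n" if "x \<in> carrier G" for x n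
    using that by (rule q.hom_nat_pow)
  have hmult: "?h (x \<otimes> y) = ?h x \<otimes>\<^bsub>?H\<^esub> ?h y" if "x \<in> carrier G" "y \<in> carrier G" for x y
    using that by (rule q.hom_mult)
  have hinv: "?h (inv x) = inv\<^bsub>?H\<^esub> ?h x" if "x \<in> carrier G" for x
    using that by (rule q.hom_inv)
  note push = hmult hinv hpow m_closed inv_closed nat_pow_closed
  interpret A: positive_action ?H q.image_cone ?K
  proof (intro positive_action.intro left_ordered.intro left_ordered_axioms.intro positive_action_axioms.intro)
    show "Group.group ?H" by (rule grpH)
    show "q.image_cone \<in> LO ?H" by (rule q.image_cone)
    show Kconv: "cone_convex ?H q.image_cone ?K" by (rule q.image_convex[OF N(1)]) (use ker MN in blast)
    show "?K \<lhd> ?H" unfolding group.normal_inv_iff[OF grpH]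
    proof (intro conjI ballI)
      show "subgroup ?K ?H" using Kconv by (simp add: cone_convex_def)
      fix a k assume a: "a \<in> carrier ?H" and "k \<in> ?K"
      then obtain x n where xn: "x \<in> carrier G" "a = ?h x" "n \<in> N" "k = ?h n" using pullG by blast
      then have nc: "n \<in> carrier G" using N.mem_carrier by blast
      have "x \<otimes> n \<otimes> inv x \<in> N" using N.inv_op_closed2 xn by blast
      then have "?h (x \<otimes> n \<otimes> inv x) \<in> ?K" by blast
      moreover have "?h (x \<otimes> n \<otimes> inv x) = a \<otimes>\<^bsub>?H\<^esub> k \<otimes>\<^bsub>?H\<^esub> inv\<^bsub>?H\<^esub> a" using xn nc by (simp only: push)
      ultimately show "a \<otimes>\<^bsub>?H\<^esub> k \<otimes>\<^bsub>?H\<^esub> inv\<^bsub>?H\<^esub> a \<in> ?K" by (simp only:)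
    qed
    show "a \<otimes>\<^bsub>?H\<^esub> b = b \<otimes>\<^bsub>?H\<^esub> a" if ab: "a \<in> ?K" "b \<in> ?K" for a b
    proof -
      obtain x y where xy: "x \<in> N" "a = ?h x" "y \<in> N" "b = ?h y" using ab by blast
      then have c: "x \<in> carrier G" "y \<in> carrier G" using N.mem_carrier by auto
      have "x \<otimes> y = (x \<otimes> y \<otimes> inv x \<otimes> inv y) \<otimes> (y \<otimes> x)" using c by (simp add: word_simps)
      then have "?h (x \<otimes> y) = ?h (x \<otimes> y \<otimes> inv x \<otimes> inv y) \<otimes>\<^bsub>?H\<^esub> ?h (y \<otimes> x)"
        using hmult[of "x \<otimes> y \<otimes> inv x \<otimes> inv y" "y \<otimes> x"] c by (metis m_closed inv_closed)
      also have "?h (x \<otimes> y \<otimes> inv x \<otimes> inv y) = \<one>\<^bsub>?H\<^esub>" using to_one commN[OF xy(1,3)] M.mem_carrier by blast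
      also have "\<one>\<^bsub>?H\<^esub> \<otimes>\<^bsub>?H\<^esub> ?h (y \<otimes> x) = ?h (y \<otimes> x)"
        using q.hom_closed[of "y \<otimes> x"] c monoid.l_one[OF group.is_monoid[OF grpH]] by blast
      finally show ?thesis using c xy by (simp only: push)
    qed
    show "\<exists>m>0. \<exists>n>0. a [^]\<^bsub>?H\<^esub> (m::nat) = b [^]\<^bsub>?H\<^esub> (n::nat)"
      if ab: "a \<in> q.image_cone \<inter> ?K" "b \<in> q.image_cone \<inter> ?K" for a b
    proof -
      obtain x y where xy: "x \<in> P - M" "a = ?h x" "y \<in> P - M" "b = ?h y" using ab pull by blast
      then have c: "x \<in> carrier G" "y \<in> carrier G" using cone_carrier by auto
      have N': "x \<in> N" "y \<in> N" using in_K c xy ab by auto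
      then have "x \<in> P \<inter> N - M" "y \<in> P \<inter> N - M" using xy by auto
      then obtain m n :: nat where mn: "0 < m" "0 < n"
        "inv\<^bsub>restricted G N\<^esub> (y [^]\<^bsub>restricted G N\<^esub> n) \<otimes>\<^bsub>restricted G N\<^esub> x [^]\<^bsub>restricted G N\<^esub> m \<in> M"
        using rankN unfolding rank_one_over_def by blast
      have "inv (y [^] n) \<otimes> x [^] m \<in> M"
        using mn(3) inv_restricted[OF N.subgroup_axioms, of "y [^] n"] subgroup_nat_pow_closed[OF N.subgroup_axioms] N'
        by (simp flip: nat_pow_consistent)
      then have "?h (inv (y [^] n) \<otimes> x [^] m) = \<one>\<^bsub>?H\<^esub>" using to_one M.mem_carrier by blast
      then have "inv\<^bsub>?H\<^esub> (b [^]\<^bsub>?H\<^esub> n) \<otimes>\<^bsub>?H\<^esub> a [^]\<^bsub>?H\<^esub> m = \<one>\<^bsub>?H\<^esub>" using xy c by (simp only: push)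
      then have "a [^]\<^bsub>?H\<^esub> m = b [^]\<^bsub>?H\<^esub> n"
        using group.inv_equality[OF grpH] group.inv_inv[OF grpH] q.hom_closed c xy
          monoid.nat_pow_closed[OF group.is_monoid[OF grpH]] group.inv_closed[OF grpH] by metis
      then show ?thesis using mn by blast
    qed
    show "a \<otimes>\<^bsub>?H\<^esub> b \<otimes>\<^bsub>?H\<^esub> inv\<^bsub>?H\<^esub> a \<otimes>\<^bsub>?H\<^esub> inv\<^bsub>?H\<^esub> b \<in> ?K" if ab: "a \<in> carrier ?H" "b \<in> carrier ?H" for a b
    proof -
      obtain x y where xy: "x \<in> carrier G" "a = ?h x" "y \<in> carrier G" "b = ?h y" using ab pullG by metis
      have "?h (x \<otimes> y \<otimes> inv x \<otimes> inv y) \<in> ?K" using commG xy by blast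
      then show ?thesis using xy by (simp only: push)
    qed
    show "\<exists>m>0. \<exists>n>0. inv\<^bsub>?H\<^esub> (b [^]\<^bsub>?H\<^esub> (n::nat)) \<otimes>\<^bsub>?H\<^esub> a [^]\<^bsub>?H\<^esub> (m::nat) \<in> ?K"
      if ab: "a \<in> q.image_cone - ?K" "b \<in> q.image_cone - ?K" for a b
    proof -
      obtain x y where xy: "x \<in> P - M" "a = ?h x" "y \<in> P - M" "b = ?h y" using ab pull by blast
      then have c: "x \<in> carrier G" "y \<in> carrier G" using cone_carrier by auto
      have "x \<in> P - N" "y \<in> P - N" using in_K c xy ab by auto
      then obtain m n :: nat where mn: "0 < m" "0 < n" "inv (y [^] n) \<otimes> x [^] m \<in> N"
        using rankG unfolding rank_one_over_def by blast
      then have "?h (inv (y [^] n) \<otimes> x [^] m) \<in> ?K" by blast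
      then have "inv\<^bsub>?H\<^esub> (b [^]\<^bsub>?H\<^esub> n) \<otimes>\<^bsub>?H\<^esub> a [^]\<^bsub>?H\<^esub> m \<in> ?K" using xy c by (simp only: push)
      then show ?thesis using mn by blast
    qed
    show "a \<otimes>\<^bsub>?H\<^esub> k \<otimes>\<^bsub>?H\<^esub> inv\<^bsub>?H\<^esub> a \<in> q.image_cone" if a: "a \<in> carrier ?H" and k: "k \<in> q.image_cone \<inter> ?K" for a k
    proof -
      obtain t where t: "t \<in> carrier G" "a = ?h t" using pullG a by blast
      obtain x where x: "x \<in> P - M" "k = ?h x" using pull k by blast
      have xc: "x \<in> carrier G" using x cone_carrier by blast
      have xN: "x \<in> P \<inter> N - M" using in_K[OF xc] x k by blast
      have y: "t \<otimes> x \<otimes> inv t \<in> P" using act t xN by blast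
      have "t \<otimes> x \<otimes> inv t \<notin> M"
      proof
        assume "t \<otimes> x \<otimes> inv t \<in> M"
        from M.inv_op_closed1[OF t(1) this] have "x \<in> M" using t xc by (simp add: word_simps)
        then show False using x by blast
      qed
      then have "?h (t \<otimes> x \<otimes> inv t) \<in> q.image_cone" using in_cone[of "t \<otimes> x \<otimes> inv t"] y t xc by simp
      then show ?thesis using t x xc by (simp only: push)
    qed
  qed
  obtain n where n: "n \<in> N" "n \<notin> M" using MN by blast
  have "?h n \<noteq> \<one>\<^bsub>?H\<^esub>" using to_one[OF N.mem_carrier[OF n(1)]] n(2) by blast
  then have "?K \<noteq> {\<one>\<^bsub>?H\<^esub>}" using imageI[OF n(1), of ?h] by auto
  moreover have "?K \<noteq> carrier ?H"
  proof
    assume K: "?K = carrier ?H"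
    have "x \<in> N" if x: "x \<in> carrier G" for x
      using in_K[OF x] q.hom_closed[OF x] unfolding K by blast
    then show False using NG N.subset by blast
  qed
  ultimately show False using A.positive_action_not_isolated[OF q.image_isolated[OF iso]] by blast
qed

section \<open>Finiteness of the set of orderings\<close>

context left_ordered
begin

text \<open>
  An element \<open>s > 1\<close> whose conjugation reverses the sign of \<open>N - M\<close> exceeds every positive \<open>b \<in> N - M\<close>:
  in \<open>b\<inverse> s = s (s\<inverse> b\<inverse> s)\<close> both factors on the right are positive. Such \<open>b\<close> exceed all of \<open>M\<close>.
\<close>
lemma sign_change_dominates:
  assumes N: "N \<lhd> G" and M: "cone_convex (restricted G N) (P \<inter> N) M" and MN: "M \<noteq> N"
    and s: "s \<in> P" and flip: "\<And>b. b \<in> P \<inter> N - M \<Longrightarrow> inv s \<otimes> b \<otimes> s \<notin> P"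
    and c: "c \<in> N"
  shows "inv c \<otimes> s \<in> P"
proof -
  interpret N: normal N G by fact
  interpret GN: left_ordered "restricted G N" "P \<inter> N" by (rule restrict_cone[OF N.subgroup_axioms])
  have sc: "s \<in> carrier G" using s cone_carrier by blast
  have MsubN: "subgroup M (restricted G N)" using M by (rule GN.convex_subgroupD)
  then have "M \<subset> N" using subgroup.subset[OF MsubN] MN by auto
  then obtain b where b: "b \<in> P \<inter> N" "b \<notin> M"
    using GN.convex_pos_diff[OF MsubN GN.subgroup_self] by auto
  have big: "inv b \<otimes> s \<in> P" if b: "b \<in> P \<inter> N - M" for b
  proof -
    have bc: "b \<in> carrier G" using b cone_carrier by blast
    let ?d = "inv s \<otimes> b \<otimes> s"
    have d: "?d \<in> carrier G" using bc sc by simp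
    have "?d \<noteq> \<one>"
    proof
      assume "?d = \<one>"
      then have "s \<otimes> ?d \<otimes> inv s = \<one>" using sc by simp
      then have "b = \<one>" using sc bc by (simp add: word_simps)
      then show False using b one_notin_cone by blast
    qed
    then have "inv ?d \<in> P" using inv_in_cone_iff[OF d] flip[OF b] by blast
    then have "s \<otimes> inv ?d \<in> P" using s cone_mult by blast
    then show ?thesis using sc bc by (simp add: word_simps)
  qed
  have cc: "c \<in> carrier G" using c by (rule N.mem_carrier)
  have M_inv: "inv x \<in> M" if "x \<in> M" for x
    using subgroup.m_inv_closed[OF MsubN that] inv_restricted[OF N.subgroup_axioms] subgroup.subset[OF MsubN] that by auto
  consider "c \<in> P - M" | "c \<in> M" | "inv c \<in> P"
    using cone_cases[OF cc] subgroup.one_closed[OF MsubN] by auto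
  then show ?thesis
  proof cases
    case 1 then show ?thesis using big c by blast
  next
    case 2
    have "inv c \<otimes> b \<in> P"
      using GN.convex_absorb(3)[OF M b(1,2) M_inv[OF 2]] by simp
    then have "(inv c \<otimes> b) \<otimes> (inv b \<otimes> s) \<in> P" using big b cone_mult by blast
    then show ?thesis using cc sc b cone_carrier by (simp add: word_simps)
  next
    case 3 then show ?thesis using s cone_mult by blast
  qed
qed

text \<open>
  The hypothesis \<open>dom\<close> says that \<open>s\<close> exceeds every element of \<open>N\<close>, and so do its powers. If
  \<open>1 < g < c \<in> N\<close>, then by normality every power of \<open>g\<close> lies below some element of \<open>N\<close>. For \<open>g \<notin> N\<close> this
  contradicts that some power of \<open>g\<close> agrees modulo \<open>N\<close> with a power of \<open>s\<close> or of \<open>s\<inverse>\<close>.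
\<close>
lemma dominated_normal_convex:
  assumes N: "N \<lhd> G" and s: "s \<in> P" and dom: "\<And>c. c \<in> N \<Longrightarrow> inv c \<otimes> s \<in> P"
    and comm: "\<And>g. g \<in> carrier G \<Longrightarrow> g \<notin> N \<Longrightarrow>
      \<exists>(m::nat) (n::nat) k. 0 < m \<and> 0 < n \<and> k \<in> N \<and> (g [^] m = s [^] n \<otimes> k \<or> g [^] m = inv s [^] n \<otimes> k)"
  shows "cone_convex G P N"
proof -
  interpret N: normal N G by fact
  have sc: "s \<in> carrier G" using s cone_carrier by blast
  have pow: "c <\<^sub>P s [^] n" if "c \<in> N" "0 < n" for c and n :: nat
  proof -
    have cc: "c \<in> carrier G" using that N.mem_carrier by blast
    obtain n' where n': "n = Suc n'" using \<open>0 < n\<close> by (cases n) auto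
    have "s [^] n = s \<otimes> s [^] n'" unfolding n' using sc nat_pow_mult[of s 1 n'] by simp
    then have eq: "inv c \<otimes> s [^] n = (inv c \<otimes> s) \<otimes> s [^] n'" using cc sc by (simp add: m_assoc)
    have "inv c \<otimes> s [^] n \<in> P"
    proof (cases "n' = 0")
      case True then show ?thesis unfolding eq using dom[OF that(1)] cc sc by simp
    next
      case False then show ?thesis unfolding eq using cone_mult[OF dom[OF that(1)] cone_pow[OF s]] by simp
    qed
    then show ?thesis using cc sc by (simp add: prec_def)
  qed
  have "g \<in> N" if c: "c \<in> N" and g: "g \<in> P" "inv g \<otimes> c \<in> P" for c g
  proof (rule ccontr)
    assume gN: "g \<notin> N"
    have gc: "g \<in> carrier G" and cc: "c \<in> carrier G" using g c cone_carrier N.mem_carrier by auto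
    \<comment> \<open>The step: \<open>g g\<^sup>j < g d = (g d g\<inverse>) g < (g d g\<inverse>) c\<close>.\<close>
    have bound: "\<exists>d\<in>N. g [^] j <\<^sub>P d" if "0 < j" for j :: nat using that
    proof (induction j)
      case (Suc j)
      show ?case
      proof (cases "j = 0")
        case True then show ?thesis using c g gc cc by (intro bexI[of _ c]) (auto simp: prec_def)
      next
        case False
        then obtain d where d: "d \<in> N" "g [^] j <\<^sub>P d" using Suc.IH by blast
        have dc: "d \<in> carrier G" using d N.mem_carrier by blast
        let ?d = "g \<otimes> d \<otimes> inv g"
        have d': "?d \<in> N" using N.inv_op_closed2[OF gc d(1)] .
        have "g [^] Suc j = g \<otimes> g [^] j" using gc nat_pow_mult[of g 1 j] by simp
        also have "\<dots> <\<^sub>P g \<otimes> d" using prec_mult_left[OF d(2) gc] .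
        also have "g \<otimes> d = ?d \<otimes> g" using gc dc by (simp add: word_simps)
        also have "?d \<otimes> g <\<^sub>P ?d \<otimes> c" by (rule prec_mult_left) (use g gc cc dc in \<open>auto simp: prec_def\<close>)
        finally show ?thesis using N.m_closed[OF d' c] by blast
      qed
    qed simp
    obtain m n :: nat and k where mn: "0 < m" "0 < n" "k \<in> N"
      and rel: "g [^] m = s [^] n \<otimes> k \<or> g [^] m = inv s [^] n \<otimes> k" using comm[OF gc gN] by blast
    have kc: "k \<in> carrier G" using mn N.mem_carrier by blast
    from rel show False
    proof
      assume eq: "g [^] m = s [^] n \<otimes> k"
      obtain d where d: "d \<in> N" "g [^] m <\<^sub>P d" using bound[OF mn(1)] by blast
      have dc: "d \<in> carrier G" using d N.mem_carrier by blast
      let ?k = "s [^] n \<otimes> k \<otimes> inv (s [^] n)"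
      have k': "?k \<in> N" using N.inv_op_closed2[of "s [^] n" k] mn sc by simp
      have kc': "?k \<in> carrier G" using sc kc by simp
      have "?k \<otimes> s [^] n <\<^sub>P d" using d(2) eq sc kc by (simp add: word_simps)
      then have "inv ?k \<otimes> (?k \<otimes> s [^] n) <\<^sub>P inv ?k \<otimes> d" by (rule prec_mult_left) (use kc' in simp)
      then have "s [^] n <\<^sub>P inv ?k \<otimes> d" using sc inv_mult_cancel(1)[OF kc'] by simp
      moreover have "inv ?k \<otimes> d <\<^sub>P s [^] n" using pow[OF N.m_closed[OF N.m_inv_closed[OF k'] d(1)] mn(2)] .
      ultimately show False using prec_asym by blast
    next
      assume eq: "g [^] m = inv s [^] n \<otimes> k"
      have "inv (g [^] m) = inv k \<otimes> s [^] n" unfolding eq using sc kc by (simp add: inv_mult_group nat_pow_inv)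
      then have "inv (g [^] m) \<in> P" using pow[OF mn(3,2)] by (simp add: prec_def)
      then show False using cone_inv cone_pow[OF g(1) mn(1)] by blast
    qed
  qed
  then show ?thesis unfolding cone_convex_def using N.subgroup_axioms by blast
qed

text \<open>
  Since \<open>G / N\<close> has rank one, a convex subgroup that is strictly larger than \<open>N\<close> contains a power of
  every element, hence every element.
\<close>
lemma convex_iff_over:
  assumes rank: "rank_one_over G P N" and N: "N \<lhd> G" "N \<noteq> carrier G"
    and Q: "Q \<in> LO G" "cone_convex G Q N"
  shows "cone_convex G Q C \<longleftrightarrow> C = carrier G \<or> cone_convex (restricted G N) (Q \<inter> N) C"
proof
  interpret Q: left_ordered G Q by unfold_locales (rule Q(1))
  interpret N: normal N G by (rule N(1))
  assume C: "cone_convex G Q C"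
  interpret C: subgroup C G using C by (rule Q.convex_subgroupD)
  show "C = carrier G \<or> cone_convex (restricted G N) (Q \<inter> N) C"
  proof (cases "C \<subseteq> N")
    case True
    then show ?thesis using Q.convex_restrict[OF C N.subgroup_axioms] by blast
  next
    case False
    then have NC: "N \<subseteq> C" using Q.convex_chain[OF C Q(2)] by blast
    obtain x where x: "x \<in> C" "x \<notin> N" using False by blast
    have xc: "x \<in> carrier G" using x C.mem_carrier by blast
    have "y \<in> C" if y: "y \<in> carrier G" for y
    proof (cases "y \<in> N")
      case True then show ?thesis using NC by blast
    next
      case False
      obtain m n :: nat and k where mn: "0 < m" "0 < n" "k \<in> N"
        "y [^] m = x [^] n \<otimes> k \<or> y [^] m = inv x [^] n \<otimes> k"
        by (rule rank_one_over_commensurable[OF rank N(1) y False xc x(2)])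
      have "x [^] n \<in> C" "inv x [^] n \<in> C"
        using subgroup_nat_pow_closed[OF C.subgroup_axioms] x C.m_inv_closed by auto
      then have "y [^] m \<in> C" using mn NC C.m_closed by auto
      then show ?thesis using Q.convex_root[OF C y _ mn(1)] by blast
    qed
    then show ?thesis using C.subset by blast
  qed
next
  interpret Q: left_ordered G Q by unfold_locales (rule Q(1))
  assume "C = carrier G \<or> cone_convex (restricted G N) (Q \<inter> N) C"
  then show "cone_convex G Q C" using Q.convex_carrier Q.convex_trans(1)[OF Q(2)] by blast
qed

text \<open>
  Let \<open>M\<close> be convex in all orderings of \<open>N\<close>. Each of these induces one of the two orderings of the rank
  one group \<open>N / M\<close>, so it is \<open>P\<close> or its reverse on \<open>N - M\<close>. A sign change under \<open>t\<close> for one element and the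
  ordering \<open>P\<close> is therefore a sign change for all elements and all orderings.
\<close>
lemma sign_change_all_cones:
  assumes N: "N \<lhd> G" and M: "M \<lhd> G" 
    and conv: "\<And>Q. Q \<in> LO (restricted G N) \<Longrightarrow> cone_convex (restricted G N) Q M"
    and rank: "rank_one_over (restricted G N) (P \<inter> N) M"
    and t: "t \<in> carrier G" and a: "a \<in> P \<inter> N - M" "t \<otimes> a \<otimes> inv t \<notin> P"
    and Q: "Q \<in> LO G" and b: "b \<in> Q \<inter> N - M"
  shows "t \<otimes> b \<otimes> inv t \<notin> Q" "inv t \<otimes> b \<otimes> t \<notin> Q"
proof -
  interpret N: normal N G by fact
  interpret M: normal M G by fact
  interpret Q: left_ordered G Q by unfold_locales (rule Q)
  interpret GN: left_ordered "restricted G N" "P \<inter> N" by (rule restrict_cone[OF N.subgroup_axioms])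
  interpret QN: left_ordered "restricted G N" "Q \<inter> N" by (rule Q.restrict_cone[OF N.subgroup_axioms])
  let ?R = "{x \<in> N. inv (inv t) \<otimes> x \<otimes> inv t \<in> P \<inter> N}"
  have R: "?R \<in> LO (restricted G N)"
    by (rule conjugate_cone[OF is_group N GN.cone]) (use t in simp)
  have aR: "a \<notin> ?R" using a t by simp
  have flipP: "t \<otimes> x \<otimes> inv t \<notin> P" if x: "x \<in> P \<inter> N - M" for x
  proof
    assume "t \<otimes> x \<otimes> inv t \<in> P"
    then have "x \<in> ?R" using x t N.inv_op_closed2[of t x] by simp
    then have "a \<in> ?R" using GN.rank_one_over_same_sign[OF rank R conv[OF R] x a(1)] by blast
    then show False using aR by blast
  qed
  have same: "y \<in> Q" if "x \<in> P \<inter> N - M" "y \<in> P \<inter> N - M" "x \<in> Q" for x y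
    using GN.rank_one_over_same_sign[OF rank QN.cone conv[OF QN.cone] that(1,2)] that by blast
  have main: "t \<otimes> b \<otimes> inv t \<notin> Q" if b: "b \<in> Q \<inter> N - M" for b
  proof
    let ?y = "t \<otimes> b \<otimes> inv t"
    assume yQ: "?y \<in> Q"
    have bc: "b \<in> carrier G" using b N.mem_carrier by blast
    have y: "?y \<in> N" "?y \<in> carrier G" using b N.inv_op_closed2[OF t, of b] bc t by auto
    have yM: "?y \<notin> M"
    proof
      assume "?y \<in> M"
      from M.inv_op_closed1[OF t this] have "b \<in> M" using t bc by (simp add: word_simps)
      then show False using b by blast
    qed
    have iM: "inv x \<notin> M" if "x \<notin> M" "x \<in> carrier G" for x using M.m_inv_closed[of "inv x"] that by auto
    have iy: "inv ?y = t \<otimes> inv b \<otimes> inv t" using t bc by (simp add: word_simps)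
    show False
    proof (rule cone_cases[OF bc])
      assume bP: "b \<in> P"
      have "?y \<notin> P" using flipP b bP by blast
      moreover have "?y \<noteq> \<one>" using yM M.one_closed by metis
      ultimately have "inv ?y \<in> P \<inter> N - M" using inv_in_cone_iff[OF y(2)] iM[OF yM y(2)] N.m_inv_closed[OF y(1)] by blast
      then have "inv ?y \<in> Q" using same[of b "inv ?y"] b bP by blast
      then show False using Q.cone_inv[OF yQ] by blast
    next
      assume "b = \<one>" then show False using b M.one_closed by blast
    next
      assume ib: "inv b \<in> P"
      have ib': "inv b \<in> P \<inter> N - M" using ib iM[OF _ bc] b N.m_inv_closed by blast
      have "inv ?y \<notin> P" using flipP[OF ib'] iy by simp
      moreover have "?y \<noteq> \<one>" using yM M.one_closed by metis
      ultimately have "?y \<in> P \<inter> N - M" using inv_in_cone_iff[OF y(2)] y yM by blast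
      then have "inv b \<in> Q" using same[OF _ ib' yQ] by blast
      then show False using Q.cone_inv b by blast
    qed
  qed
  show "t \<otimes> b \<otimes> inv t \<notin> Q" by (rule main[OF b])
  show "inv t \<otimes> b \<otimes> t \<notin> Q"
  proof
    let ?y = "inv t \<otimes> b \<otimes> t"
    assume y: "?y \<in> Q"
    have bc: "b \<in> carrier G" using b N.mem_carrier by blast
    have undo: "t \<otimes> ?y \<otimes> inv t = b" using t bc by (simp add: word_simps)
    have "?y \<in> N" using N.inv_op_closed1[OF t] b by blast
    moreover have "?y \<notin> M" using M.inv_op_closed2[OF t, of ?y] undo b by auto
    ultimately have "t \<otimes> ?y \<otimes> inv t \<notin> Q" using main[of ?y] y by blast
    then show False unfolding undo using b by blast
  qed
qed

end

text \<open>
  Conjugation by \<open>d\<close> turns \<open>M\<close> into a proper convex subgroup for the conjugated ordering of \<open>N\<close>. By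
  \<open>rigid\<close> it is convex for the original ordering too, hence contained in the largest such subgroup \<open>M\<close>.
\<close>
lemma (in left_ordered) rigid_largest_convex_normal:
  assumes N: "N \<lhd> G" and MN: "subgroup M G" "M \<subseteq> N" "M \<noteq> N"
    and rigid: "\<And>Q C. Q \<in> LO (restricted G N) \<Longrightarrow>
      cone_convex (restricted G N) Q C \<longleftrightarrow> cone_convex (restricted G N) (P \<inter> N) C"
    and M: "cone_convex (restricted G N) (P \<inter> N) M"
    and M_max: "\<And>C. cone_convex (restricted G N) (P \<inter> N) C \<Longrightarrow> C \<noteq> N \<Longrightarrow> C \<subseteq> M"
  shows "M \<lhd> G"
  unfolding normal_inv_iff
proof (intro conjI ballI)
  interpret N: normal N G by fact
  interpret M: subgroup M G by fact
  show "subgroup M G" by fact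
  fix d x assume d: "d \<in> carrier G" and x: "x \<in> M"
  let ?R = "{x \<in> N. inv d \<otimes> x \<otimes> d \<in> P \<inter> N}"
  let ?M = "{x \<in> N. inv d \<otimes> x \<otimes> d \<in> M}"
  have R: "?R \<in> LO (restricted G N)"
    by (rule conjugate_cone[OF is_group N left_ordered.cone[OF restrict_cone[OF N.subgroup_axioms]] d])
  have subM: "subgroup ?M G"
  proof (rule subgroupI)
    show "?M \<subseteq> carrier G" using N.mem_carrier by blast
    have "\<one> \<in> ?M" using d M.one_closed N.one_closed by simp
    then show "?M \<noteq> {}" by blast
    fix a assume a: "a \<in> ?M"
    then have ac: "a \<in> carrier G" using N.mem_carrier by blast
    have "inv (inv d \<otimes> a \<otimes> d) \<in> M" using a M.m_inv_closed by blast
    moreover have "inv (inv d \<otimes> a \<otimes> d) = inv d \<otimes> inv a \<otimes> d" using ac d by (simp add: word_simps)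
    ultimately show "inv a \<in> ?M" using a N.m_inv_closed by simp
    fix b assume b: "b \<in> ?M"
    then have bc: "b \<in> carrier G" using N.mem_carrier by blast
    have "(inv d \<otimes> a \<otimes> d) \<otimes> (inv d \<otimes> b \<otimes> d) \<in> M" using a b M.m_closed by blast
    moreover have "(inv d \<otimes> a \<otimes> d) \<otimes> (inv d \<otimes> b \<otimes> d) = inv d \<otimes> (a \<otimes> b) \<otimes> d"
      using ac bc d by (simp add: word_simps)
    ultimately show "a \<otimes> b \<in> ?M" using a b N.m_closed by simp
  qed
  have RN: "?R \<inter> N = ?R" by blast
  have "g \<in> ?M" if c: "c \<in> ?M" and g: "g \<in> ?R" "inv g \<otimes> c \<in> ?R" for c g
  proof -
    have gc: "g \<in> carrier G" "c \<in> carrier G" using g c N.mem_carrier by auto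
    let ?g = "inv d \<otimes> g \<otimes> d" and ?c = "inv d \<otimes> c \<otimes> d"
    have "inv ?g \<otimes> ?c = inv d \<otimes> (inv g \<otimes> c) \<otimes> d" using gc d by (simp add: word_simps)
    then have "inv ?g \<otimes> ?c \<in> P" using g(2) by simp
    then have "?g \<in> M"
      using M c g(1) unfolding restricted_convex_iff[OF N.subgroup_axioms] by blast
    then show ?thesis using g(1) by blast
  qed
  then have "cone_convex (restricted G N) (?R \<inter> N) ?M"
    unfolding restricted_convex_iff[OF N.subgroup_axioms] using subM by blast
  then have "cone_convex (restricted G N) (P \<inter> N) ?M" using rigid[OF R] unfolding RN by blast
  moreover have "?M \<noteq> N"
  proof
    assume eq: "?M = N"
    have "y \<in> M" if y: "y \<in> N" for y
    proof -
      have "d \<otimes> y \<otimes> inv d \<in> ?M" unfolding eq by (rule N.inv_op_closed2[OF d y])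
      then show ?thesis using d N.mem_carrier[OF y] by (simp add: word_simps)
    qed
    then show False using MN by blast
  qed
  ultimately have "?M \<subseteq> M" by (rule M_max)
  moreover have "d \<otimes> x \<otimes> inv d \<in> ?M"
    using N.inv_op_closed2[OF d] x MN(2) d M.mem_carrier[OF x] by (auto simp: word_simps)
  ultimately show "d \<otimes> x \<otimes> inv d \<in> M" by blast
qed

text \<open>
  Let \<open>M\<close> be the largest proper convex subgroup of \<open>N\<close>. There is a \<open>t\<close> that reverses the sign of \<open>N - M\<close>
  in every ordering, so in the ordering \<open>Q\<close> one of \<open>t\<close>, \<open>t\<inverse>\<close> exceeds all of \<open>N\<close>. As \<open>G / N\<close> has rank
  one, this makes \<open>N\<close> convex for \<open>Q\<close>.
\<close>
lemma (in left_ordered) rigid_convex_for_all_cones: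
  assumes iso: "isolated_cone G P" and con: "Conradian_cone G P"
    and N: "cone_convex G P N" "N \<noteq> carrier G"
    and N_max: "\<And>C. cone_convex G P C \<Longrightarrow> C \<noteq> carrier G \<Longrightarrow> C \<subseteq> N"
    and rigid: "\<And>Q C. Q \<in> LO (restricted G N) \<Longrightarrow>
      cone_convex (restricted G N) Q C \<longleftrightarrow> cone_convex (restricted G N) (P \<inter> N) C"
    and Q: "Q \<in> LO G"
  shows "cone_convex G Q N"
proof (cases "N = {\<one>}")
  case True
  interpret Q: left_ordered G Q by unfold_locales (rule Q)
  show ?thesis unfolding True by (rule Q.convex_one)
next
  case False
  let ?GN = "restricted G N"
  have jump: "D = N \<or> D = carrier G" if "cone_convex G P D" "N \<subseteq> D" for D using N_max that by blast
  have normalN: "N \<lhd> G"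
    and commG: "\<And>x y. x \<in> carrier G \<Longrightarrow> y \<in> carrier G \<Longrightarrow> x \<otimes> y \<otimes> inv x \<otimes> inv y \<in> N"
    and rank: "rank_one_over G P N"
    using isolated_Conradian_jump[OF iso con N(1) jump] by (auto simp: rank_one_over_def)
  interpret N: normal N G by (rule normalN)
  interpret GN: left_ordered ?GN "P \<inter> N" by (rule restrict_cone[OF N.subgroup_axioms])
  interpret Q: left_ordered G Q by unfold_locales (rule Q)
  interpret QN: left_ordered ?GN "Q \<inter> N" by (rule Q.restrict_cone[OF N.subgroup_axioms])
  have isoN: "isolated_cone ?GN (P \<inter> N)" by (rule isolated_cone_restrict[OF is_group iso N(1)])
  have conN: "Conradian_cone ?GN (P \<inter> N)" by (rule Conradian_restrict[OF con N.subgroup_axioms])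
  obtain M where M: "cone_convex ?GN (P \<inter> N) M" "M \<noteq> N"
    and M_max: "\<And>C. cone_convex ?GN (P \<inter> N) C \<Longrightarrow> C \<noteq> N \<Longrightarrow> C \<subseteq> M"
    using GN.largest_proper_convex[OF finite_convex_subgroups[OF GN.is_group isoN]] False by auto
  have jumpM: "D = M \<or> D = carrier ?GN" if "cone_convex ?GN (P \<inter> N) D" "M \<subseteq> D" for D using M_max that by auto
  note JM = GN.isolated_Conradian_jump[OF isoN conN M(1) jumpM]
  have rankM: "rank_one_over ?GN (P \<inter> N) M" using JM(3) by (auto simp: rank_one_over_def)
  have commM: "x \<otimes> y \<otimes> inv x \<otimes> inv y \<in> M" if "x \<in> N" "y \<in> N" for x y
    using JM(2)[of x y] that inv_restricted[OF N.subgroup_axioms] by simp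
  have MG: "cone_convex G P M" "M \<subseteq> N" using convex_trans[OF N(1) M(1)] by auto
  have normalM: "M \<lhd> G"
    by (rule rigid_largest_convex_normal[OF normalN convex_subgroupD[OF MG(1)] MG(2) M(2) rigid M(1) M_max])
  have "M \<subset> N" using MG(2) M(2) by blast
  then obtain t a where ta: "t \<in> carrier G" "a \<in> P \<inter> N - M" "t \<otimes> a \<otimes> inv t \<notin> P"
    using convex_jump_sign_change[OF iso MG(1) normalM N(1) normalN _ N(2) commM rankM commG rank] by blast
  have M_all: "cone_convex ?GN R M" if "R \<in> LO ?GN" for R using rigid[OF that] M(1) by blast
  have flip: "t \<otimes> b \<otimes> inv t \<notin> Q" "inv t \<otimes> b \<otimes> t \<notin> Q" if "b \<in> Q \<inter> N - M" for b
    using sign_change_all_cones[OF normalN normalM M_all rankM ta Q that] by auto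
  have "t \<noteq> \<one>" using ta cone_carrier by auto
  then obtain s where s: "s \<in> Q" "s = t \<or> s = inv t" using Q.cone_cases[OF ta(1)] by blast
  have flip_s: "inv s \<otimes> b \<otimes> s \<notin> Q" if "b \<in> Q \<inter> N - M" for b
    using flip[OF that] s(2) ta(1) by auto
  have dom: "inv c \<otimes> s \<in> Q" if "c \<in> N" for c
    by (rule Q.sign_change_dominates[OF normalN M_all[OF QN.cone] M(2) s(1) flip_s that])
  have sc: "s \<in> carrier G" using s(1) Q.cone_carrier by blast
  have sN: "s \<notin> N" using dom[of s] sc Q.one_notin_cone by auto
  show ?thesis
  proof (rule Q.dominated_normal_convex[OF normalN s(1) dom])
    fix g assume g: "g \<in> carrier G" "g \<notin> N"
    show "\<exists>(m::nat) (n::nat) k. 0 < m \<and> 0 < n \<and> k \<in> N \<and> (g [^] m = s [^] n \<otimes> k \<or> g [^] m = inv s [^] n \<otimes> k)"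
      by (rule rank_one_over_commensurable[OF rank normalN g sc sN]) blast
  qed
qed

text \<open>
  Induction along the finite chain of convex subgroups. If \<open>N\<close> is the largest proper one, then \<open>N\<close> is
  convex in every ordering of \<open>G\<close>, and an ordering is determined by its restriction to \<open>N\<close> and one sign.
  The statement about convex subgroups is what keeps the induction going: it makes the largest convex
  subgroup of \<open>N\<close> normal in \<open>G\<close>.
\<close>
theorem isolated_Conradian_rigid:
  fixes G :: "('a, 'b) monoid_scheme"
  assumes "Group.group G" "isolated_cone G P" "Conradian_cone G P"
  shows "finite (LO G) \<and> (\<forall>Q\<in>LO G. \<forall>C. cone_convex G Q C \<longleftrightarrow> cone_convex G P C)"
  using assms
proof (induction "card {C. cone_convex G P C}" arbitrary: G P rule: less_induct)
  case less
  note iso = \<open>isolated_cone G P\<close> and con = \<open>Conradian_cone G P\<close>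
  interpret left_ordered G P
    using less.prems by (simp add: left_ordered_def left_ordered_axioms_def isolated_cone_def)
  note fin = finite_convex_subgroups[OF is_group iso]
  show ?case
  proof (cases "carrier G = {\<one>\<^bsub>G\<^esub>}")
    case True
    have triv: "Q = {}" if "Q \<in> LO G" for Q
    proof -
      interpret Q: left_ordered G Q by unfold_locales (rule that)
      have "x \<notin> Q" for x using Q.cone_carrier[of x] Q.one_notin_cone True by auto
      then show ?thesis by blast
    qed
    then have "LO G \<subseteq> {{}}" by blast
    then have "finite (LO G)" by (rule finite_subset) simp
    then show ?thesis using triv triv[OF cone] by auto
  next
    case False
    obtain N where N: "cone_convex G P N" "N \<noteq> carrier G"
      and N_max: "\<And>C. cone_convex G P C \<Longrightarrow> C \<noteq> carrier G \<Longrightarrow> C \<subseteq> N"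
      using largest_proper_convex[OF fin False] by blast
    have jump: "D = N \<or> D = carrier G" if "cone_convex G P D" "N \<subseteq> D" for D using N_max that by blast
    have normalN: "N \<lhd> G" and rank: "rank_one_over G P N"
      using isolated_Conradian_jump[OF iso con N(1) jump] by (auto simp: rank_one_over_def)
    interpret N: normal N G by (rule normalN)
    let ?GN = "restricted G N"
    interpret GN: left_ordered ?GN "P \<inter> N" by (rule restrict_cone[OF N.subgroup_axioms])
    have "{C. cone_convex ?GN (P \<inter> N) C} \<subset> {C. cone_convex G P C}"
    proof
      show "{C. cone_convex ?GN (P \<inter> N) C} \<subseteq> {C. cone_convex G P C}" using convex_trans(1)[OF N(1)] by blast
      have "carrier G \<notin> {C. cone_convex ?GN (P \<inter> N) C}"
        using convex_trans(2)[OF N(1), of "carrier G"] N(2) N.subset by blast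
      then show "{C. cone_convex ?GN (P \<inter> N) C} \<noteq> {C. cone_convex G P C}" using convex_carrier by blast
    qed
    then have "card {C. cone_convex ?GN (P \<inter> N) C} < card {C. cone_convex G P C}" by (rule psubset_card_mono[OF fin])
    from less.hyps[OF this GN.is_group isolated_cone_restrict[OF is_group iso N(1)]
        Conradian_restrict[OF con N.subgroup_axioms]]
    have finN: "finite (LO ?GN)" and
      rigidN: "\<And>Q C. Q \<in> LO ?GN \<Longrightarrow> cone_convex ?GN Q C \<longleftrightarrow> cone_convex ?GN (P \<inter> N) C" by blast+
    have N_convex: "cone_convex G Q N" if "Q \<in> LO G" for Q
      using rigid_convex_for_all_cones[OF iso con N N_max rigidN that] by blast
    have same: "cone_convex G Q C \<longleftrightarrow> cone_convex G P C" if Q: "Q \<in> LO G" for Q C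
    proof -
      interpret Q: left_ordered G Q by unfold_locales (rule Q)
      interpret QN: left_ordered ?GN "Q \<inter> N" by (rule Q.restrict_cone[OF N.subgroup_axioms])
      show ?thesis
        unfolding convex_iff_over[OF rank normalN N(2) Q N_convex[OF Q]] convex_iff_over[OF rank normalN N(2) cone N(1)]
        using rigidN[OF QN.cone] by blast
    qed
    have "N \<subset> carrier G" using N(2) N.subset by blast
    then obtain t where t: "t \<in> P - N" using convex_pos_diff[OF N.subgroup_axioms subgroup_self] by blast
    have inj: "inj_on (\<lambda>Q. (Q \<inter> N, t \<in> Q)) (LO G)"
    proof (rule inj_onI)
      fix Q Q' assume Q: "Q \<in> LO G" and Q': "Q' \<in> LO G" and eq: "(Q \<inter> N, t \<in> Q) = (Q' \<inter> N, t \<in> Q')"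
      show "Q = Q'"
        by (rule rank_one_over_cone_eqI[OF rank N(1) t Q N_convex[OF Q] Q' N_convex[OF Q']]) (use eq in auto)
    qed
    have "finite (LO G)"
    proof (rule inj_on_finite[OF inj])
      show "finite (LO ?GN \<times> (UNIV :: bool set))" using finN by simp
      show "(\<lambda>Q. (Q \<inter> N, t \<in> Q)) ` LO G \<subseteq> LO ?GN \<times> UNIV"
      proof
        fix z assume "z \<in> (\<lambda>Q. (Q \<inter> N, t \<in> Q)) ` LO G"
        then obtain Q where Q: "Q \<in> LO G" "z = (Q \<inter> N, t \<in> Q)" by blast
        interpret Q: left_ordered G Q by unfold_locales (rule Q(1))
        show "z \<in> LO ?GN \<times> UNIV" unfolding Q(2)
          using left_ordered.cone[OF Q.restrict_cone[OF N.subgroup_axioms]] by blast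
      qed
    qed
    then show ?thesis using same by blast
  qed
qed

section \<open>The tensor product with the rationals\<close>

context comm_group
begin

lemma tensor_free_group_simps:
  "x \<otimes>\<^bsub>tensor_free_group G\<^esub> y = x + y" "\<one>\<^bsub>tensor_free_group G\<^esub> = 0"
  "x \<in> carrier (tensor_free_group G) \<longleftrightarrow> Poly_Mapping.keys x \<subseteq> carrier G \<times> UNIV"
  by (simp_all add: tensor_free_group_def)

lemma tensor_free_group_inv: "x \<in> carrier (tensor_free_group G) \<Longrightarrow> inv\<^bsub>tensor_free_group G\<^esub> x = - x"
  by (simp add: tensor_free_group_def)

lemma tensor_free_group: "comm_group (tensor_free_group G)"
  unfolding tensor_free_group_def by (rule abelian_free_Abelian_group)

lemma tensor_free_closed:
  "x \<in> carrier (tensor_free_group G) \<Longrightarrow> y \<in> carrier (tensor_free_group G) \<Longrightarrow> x + y \<in> carrier (tensor_free_group G)"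
  "x \<in> carrier (tensor_free_group G) \<Longrightarrow> y \<in> carrier (tensor_free_group G) \<Longrightarrow> x - y \<in> carrier (tensor_free_group G)"
  "a \<in> carrier G \<Longrightarrow> frag_of (a, q) \<in> carrier (tensor_free_group G)"
proof -
  interpret F: comm_group "tensor_free_group G" by (rule tensor_free_group)
  show add: "x + y \<in> carrier (tensor_free_group G)"
    if "x \<in> carrier (tensor_free_group G)" "y \<in> carrier (tensor_free_group G)" for x y
    using F.m_closed[OF that] by (simp only: tensor_free_group_simps)
  show "x - y \<in> carrier (tensor_free_group G)"
    if "x \<in> carrier (tensor_free_group G)" "y \<in> carrier (tensor_free_group G)" for x y
    using add[OF that(1) F.inv_closed[OF that(2)]] tensor_free_group_inv[OF that(2)] by simp
  show "a \<in> carrier G \<Longrightarrow> frag_of (a, q) \<in> carrier (tensor_free_group G)"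
    by (simp add: tensor_free_group_simps)
qed

lemma tensor_relations_subset: "tensor_relations G \<subseteq> carrier (tensor_free_group G)"
  unfolding tensor_relations_def by (auto intro!: tensor_free_closed)

lemma tensor_kernel_subgroup: "subgroup (tensor_kernel G) (tensor_free_group G)"
  unfolding tensor_kernel_def
  by (rule group.generate_is_subgroup[OF comm_group.axioms(2)[OF tensor_free_group] tensor_relations_subset])

lemma tensor_kernel_carrier: "x \<in> tensor_kernel G \<Longrightarrow> x \<in> carrier (tensor_free_group G)"
  by (rule subgroup.mem_carrier[OF tensor_kernel_subgroup])

lemma tensor_kernel_closed:
  "0 \<in> tensor_kernel G"
  "x \<in> tensor_kernel G \<Longrightarrow> y \<in> tensor_kernel G \<Longrightarrow> x + y \<in> tensor_kernel G"
  "x \<in> tensor_kernel G \<Longrightarrow> - x \<in> tensor_kernel G"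
  "x \<in> tensor_kernel G \<Longrightarrow> y \<in> tensor_kernel G \<Longrightarrow> x - y \<in> tensor_kernel G"
proof -
  show "0 \<in> tensor_kernel G"
    using subgroup.one_closed[OF tensor_kernel_subgroup] by (simp only: tensor_free_group_simps)
  show add: "x + y \<in> tensor_kernel G" if "x \<in> tensor_kernel G" "y \<in> tensor_kernel G" for x y
    using subgroup.m_closed[OF tensor_kernel_subgroup that] by (simp only: tensor_free_group_simps)
  show neg: "- x \<in> tensor_kernel G" if "x \<in> tensor_kernel G" for x
    using subgroup.m_inv_closed[OF tensor_kernel_subgroup that] tensor_free_group_inv[OF tensor_kernel_carrier[OF that]]
    by simp
  show "x - y \<in> tensor_kernel G" if "x \<in> tensor_kernel G" "y \<in> tensor_kernel G" for x y
    using add[OF that(1) neg[OF that(2)]] by simp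
qed

lemma tensor_kernel_induct [consumes 1, case_names zero relation minus add]:
  assumes "x \<in> tensor_kernel G" "Q 0" "\<And>x. x \<in> tensor_relations G \<Longrightarrow> Q x"
    "\<And>x. x \<in> tensor_relations G \<Longrightarrow> Q (- x)"
    "\<And>x y. x \<in> tensor_kernel G \<Longrightarrow> y \<in> tensor_kernel G \<Longrightarrow> Q x \<Longrightarrow> Q y \<Longrightarrow> Q (x + y)"
  shows "Q x"
  using assms(1) unfolding tensor_kernel_def
proof (induction rule: generate.induct)
  case one
  then show ?case using assms(2) by (simp only: tensor_free_group_simps)
next
  case (inv h)
  have "h \<in> carrier (tensor_free_group G)" using tensor_relations_subset inv by blast
  then show ?case using assms(4)[OF inv] tensor_free_group_inv by simp
next
  case (eng h1 h2)
  then show ?case using assms(5) by (simp only: tensor_free_group_simps tensor_kernel_def)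
qed (use assms(3) in blast)

lemma tensor_scale_kernel:
  assumes "x \<in> tensor_kernel G"
  shows "tensor_scale p x \<in> tensor_kernel G"
proof -
  have rel: "tensor_scale p x \<in> tensor_relations G" if "x \<in> tensor_relations G" for x
    using that unfolding tensor_relations_def by (auto simp: distrib_left) blast+
  have incl: "x \<in> tensor_relations G \<Longrightarrow> x \<in> tensor_kernel G" for x
    unfolding tensor_kernel_def by (rule generate.incl)
  show ?thesis using assms
    by (induction rule: tensor_kernel_induct) (auto intro: tensor_kernel_closed incl rel)
qed

text \<open>
  The class in \<open>A \<otimes> \<rat>\<close> of an element of the free abelian group.
\<close>
definition tensor_class :: "('a \<times> rat \<Rightarrow>\<^sub>0 int) \<Rightarrow> ('a \<times> rat \<Rightarrow>\<^sub>0 int) set" where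
  "tensor_class x = tensor_kernel G #>\<^bsub>tensor_free_group G\<^esub> x"

lemma tensor_class_eq: "tensor_class x = {y + x | y. y \<in> tensor_kernel G}"
  by (auto simp: tensor_class_def r_coset_def tensor_free_group_simps)

lemma tensor_class_eqI:
  assumes "x - y \<in> tensor_kernel G"
  shows "tensor_class x = tensor_class y"
proof -
  have *: "tensor_class x \<subseteq> tensor_class y" if d: "x - y \<in> tensor_kernel G" for x y
  proof
    fix z assume "z \<in> tensor_class x"
    then obtain r where r: "r \<in> tensor_kernel G" "z = r + x" unfolding tensor_class_eq by blast
    then have "z = (r + (x - y)) + y" by simp
    then show "z \<in> tensor_class y" unfolding tensor_class_eq using tensor_kernel_closed(2)[OF r(1) d] by blast
  qed
  have "y - x \<in> tensor_kernel G" using tensor_kernel_closed(3)[OF assms] by simp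
  then show ?thesis using *[OF assms] *[of y x] by blast
qed

lemma tensor_class_eq_zeroD:
  assumes "tensor_class x = tensor_class 0"
  shows "x \<in> tensor_kernel G"
proof -
  have "0 + x \<in> tensor_class x" unfolding tensor_class_eq using tensor_kernel_closed(1) by blast
  then have "x \<in> tensor_class 0" using assms by simp
  then show ?thesis unfolding tensor_class_eq by auto
qed

lemma carrier_tensor_Rat: "carrier (tensor_Rat G) = tensor_class ` carrier (tensor_free_group G)"
  by (auto simp: tensor_Rat_def FactGroup_def RCOSETS_def tensor_class_def)

lemma zero_tensor_Rat: "\<zero>\<^bsub>tensor_Rat G\<^esub> = tensor_class 0"
  by (auto simp: tensor_Rat_def tensor_class_eq)

lemma smult_tensor_Rat: "p \<odot>\<^bsub>tensor_Rat G\<^esub> tensor_class x = tensor_class (tensor_scale p x)"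
proof -
  have "p \<odot>\<^bsub>tensor_Rat G\<^esub> tensor_class x =
      {r + tensor_scale p (s + x) | r s. r \<in> tensor_kernel G \<and> s \<in> tensor_kernel G}"
    unfolding tensor_class_eq by (auto simp: tensor_Rat_def set_mult_def tensor_free_group_simps simp del: tensor_scale_simps)
  also have "\<dots> = tensor_class (tensor_scale p x)"
  proof (intro equalityI subsetI)
    fix z assume "z \<in> {r + tensor_scale p (s + x) | r s. r \<in> tensor_kernel G \<and> s \<in> tensor_kernel G}"
    then obtain r s where rs: "r \<in> tensor_kernel G" "s \<in> tensor_kernel G" "z = r + tensor_scale p (s + x)" by blast
    have "r + tensor_scale p s \<in> tensor_kernel G" using tensor_kernel_closed(2)[OF rs(1) tensor_scale_kernel[OF rs(2)]] .
    moreover have "z = (r + tensor_scale p s) + tensor_scale p x" using rs(3) by simp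
    ultimately show "z \<in> tensor_class (tensor_scale p x)" unfolding tensor_class_eq by blast
  next
    fix z assume "z \<in> tensor_class (tensor_scale p x)"
    then obtain r where r: "r \<in> tensor_kernel G" "z = r + tensor_scale p x" unfolding tensor_class_eq by blast
    then have "z = r + tensor_scale p (0 + x)" by simp
    then show "z \<in> {r + tensor_scale p (s + x) | r s. r \<in> tensor_kernel G \<and> s \<in> tensor_kernel G}"
      using r(1) tensor_kernel_closed(1) by blast
  qed
  finally show ?thesis .
qed

lemma tensor_kernel_relation:
  "a \<in> carrier G \<Longrightarrow> b \<in> carrier G \<Longrightarrow> frag_of (a \<otimes> b, q) - (frag_of (a, q) + frag_of (b, q)) \<in> tensor_kernel G"
  "a \<in> carrier G \<Longrightarrow> frag_of (a, p + q) - (frag_of (a, p) + frag_of (a, q)) \<in> tensor_kernel G"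
  unfolding tensor_kernel_def tensor_relations_def by (rule generate.incl, blast)+

lemma tensor_pow:
  assumes b: "b \<in> carrier G"
  shows "frag_of (b [^] (n::nat), q) - frag_of (b, of_nat n * q) \<in> tensor_kernel G"
proof -
  note addq = tensor_kernel_relation(2)[OF b]
  show ?thesis
  proof (induction n)
    case 0
    from tensor_kernel_closed(4)[OF addq[of 0 0] tensor_kernel_relation(1)[OF one_closed one_closed, of q]] show ?case by simp
  next
    case (Suc n)
    have "frag_of (b [^] n \<otimes> b, q) - (frag_of (b [^] n, q) + frag_of (b, q)) \<in> tensor_kernel G"
      using tensor_kernel_relation(1)[of "b [^] n" b] b by simp
    from tensor_kernel_closed(4)[OF tensor_kernel_closed(2)[OF this Suc] addq[of "of_nat n * q" q]]
    show ?case by (simp add: algebra_simps)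
  qed
qed

text \<open>
  An additive function \<open>w\<close> extends to the functional \<open>a \<otimes> q \<mapsto> w a * q\<close> on the free abelian group, which
  vanishes on the relations and separates \<open>a \<otimes> 1\<close> from \<open>0\<close>.
\<close>
lemma tensor_functional:
  assumes w: "\<And>x y. x \<in> carrier G \<Longrightarrow> y \<in> carrier G \<Longrightarrow> w (x \<otimes> y) = w x + (w y :: rat)"
    and a: "a \<in> carrier G" "w a \<noteq> 0"
  shows "frag_of (a, 1) \<notin> tensor_kernel G"
proof -
  define A :: "rat monoid" where "A = \<lparr>carrier = UNIV, mult = (+), one = 0\<rparr>"
  have "comm_group A"
    by (rule comm_groupI) (auto simp: A_def intro: exI[of _ "- _"])
  then interpret A: comm_group A .
  obtain h where h: "h \<in> hom (free_Abelian_group (carrier G \<times> UNIV)) A"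
    and hf: "\<And>x. x \<in> carrier G \<times> UNIV \<Longrightarrow> h (frag_of x) = (\<lambda>(b, q). w b * q) x"
    using A.free_Abelian_group_universal[of "\<lambda>(b, q). w b * q" "carrier G \<times> (UNIV :: rat set)"]
    by (auto simp: A_def)
  have frag: "h (frag_of (b, q)) = w b * q" if "b \<in> carrier G" for b q using hf[of "(b, q)"] that by simp
  have add: "h (x + y) = h x + h y" if "x \<in> carrier (tensor_free_group G)" "y \<in> carrier (tensor_free_group G)" for x y
    using hom_mult[OF h[folded tensor_free_group_def] that] by (simp add: tensor_free_group_simps A_def)
  have zc: "0 \<in> carrier (tensor_free_group G)" using tensor_kernel_carrier tensor_kernel_closed(1) by blast
  have zero: "h 0 = 0" using add[OF zc zc] by simp
  have diff: "h (x - y) = h x - h y" if "x \<in> carrier (tensor_free_group G)" "y \<in> carrier (tensor_free_group G)" for x y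
    using add[OF tensor_free_closed(2)[OF that] that(2)] by simp
  have rel: "h x = 0" if x: "x \<in> tensor_relations G" for x
  proof -
    consider b c q where "b \<in> carrier G" "c \<in> carrier G" "x = frag_of (b \<otimes> c, q) - (frag_of (b, q) + frag_of (c, q))"
      | b p q where "b \<in> carrier G" "x = frag_of (b, p + q) - (frag_of (b, p) + frag_of (b, q))"
      using x unfolding tensor_relations_def by blast
    then show ?thesis
    proof cases
      case 1 then show ?thesis by (simp add: diff add frag tensor_free_closed w distrib_right)
    next
      case 2 then show ?thesis by (simp add: diff add frag tensor_free_closed distrib_left)
    qed
  qed
  note h_add = add
  have "h x = 0" if "x \<in> tensor_kernel G" for x using that
  proof (induction rule: tensor_kernel_induct)
    case (minus x)
    have "h (0 - x) = h 0 - h x" by (rule diff[OF zc]) (use minus tensor_relations_subset in blast)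
    then show ?case using zero rel[OF minus] by simp
  next
    case (add x y)
    then show ?case using h_add tensor_kernel_carrier by simp
  qed (use zero rel in auto)
  then show ?thesis using frag[OF a(1), of 1] a(2) by auto
qed

end

text \<open>
  The weight of \<open>b\<close> is \<open>n / m\<close> if \<open>b\<^sup>m = a\<^sup>n\<close> with \<open>m > 0\<close>; torsion-freeness makes it well defined.
\<close>
lemma (in left_ordered) commensurable_weight:
  assumes "comm_group G" and a: "a \<in> P"
    and comm: "\<And>b. b \<in> P \<Longrightarrow> \<exists>m>0. \<exists>n>0. b [^] (m::nat) = a [^] (n::nat)"
  obtains w :: "'a \<Rightarrow> rat" where "w a = 1"
    "\<And>x y. x \<in> carrier G \<Longrightarrow> y \<in> carrier G \<Longrightarrow> w (x \<otimes> y) = w x + w y"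
proof -
  interpret comm_group G by fact
  have ac: "a \<in> carrier G" using a cone_carrier by blast
  define rel where "rel b r \<longleftrightarrow> (\<exists>m n::int. 0 < m \<and> b [^] m = a [^] n \<and> r = of_int n / (of_int m :: rat))" for b r
  have inj: "i = j" if "a [^] (i::int) = a [^] (j::int)" for i j
  proof -
    have *: "\<not> i < j" if "a [^] (i::int) = a [^] (j::int)" for i j
    proof
      assume "i < j"
      have "a [^] (j - i) = \<one>" using that ac by (simp add: int_pow_diff)
      then have "a [^] nat (j - i) = \<one>" using \<open>i < j\<close> int_pow_int[of G a "nat (j - i)"] by simp
      then have "a = \<one>" using pow_eq_one[OF ac, of "nat (j - i)"] \<open>i < j\<close> by simp
      then show False using a one_notin_cone by blast
    qed
    show ?thesis using *[of i j] *[of j i] that by force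
  qed
  have uniq: "r = s" if rs: "rel b r" "rel b s" and b: "b \<in> carrier G" for b r s
  proof -
    obtain m n m' n' :: int where mn: "0 < m" "b [^] m = a [^] n" "r = of_int n / of_int m"
      "0 < m'" "b [^] m' = a [^] n'" "s = of_int n' / of_int m'" using rs unfolding rel_def by blast
    have "a [^] (n * m') = (b [^] m) [^] m'" using mn(2) ac by (simp add: int_pow_pow)
    also have "\<dots> = (b [^] m') [^] m" using b by (simp add: int_pow_pow mult.commute)
    also have "\<dots> = a [^] (n' * m)" using mn(5) ac by (simp add: int_pow_pow)
    finally have "n * m' = n' * m" by (rule inj)
    then have "of_int n * (of_int m' :: rat) = of_int n' * of_int m" by (metis of_int_mult)
    then show ?thesis using mn by (simp add: frac_eq_eq)
  qed
  have relI: "\<exists>r. rel b r" if "0 < m" "b [^] m = a [^] n" for b and m n :: int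
    unfolding rel_def using that by blast
  have ex: "\<exists>r. rel b r" if b: "b \<in> carrier G" for b
  proof (rule cone_cases[OF b])
    assume "b \<in> P"
    then obtain m n :: nat where mn: "0 < m" "b [^] m = a [^] n" using comm by blast
    then have "b [^] int m = a [^] int n" by (simp add: int_pow_int)
    from relI[OF _ this] show ?thesis using mn(1) by simp
  next
    assume "b = \<one>"
    then have "b [^] (1::int) = a [^] (0::int)" by simp
    from relI[OF _ this] show ?thesis by simp
  next
    assume "inv b \<in> P"
    then obtain m n :: nat where mn: "0 < m" "inv b [^] m = a [^] n" using comm by blast
    have "b [^] int m = inv (inv b [^] m)" using b by (simp add: int_pow_int nat_pow_inv)
    also have "\<dots> = a [^] (- int n)" unfolding mn(2) using ac by (simp add: int_pow_neg_int)
    finally have "b [^] int m = a [^] (- int n)" .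
    from relI[OF _ this] show ?thesis using mn(1) by simp
  qed
  define w where "w b = (THE r. rel b r)" for b
  have w: "w b = r" if "b \<in> carrier G" "rel b r" for b r
    unfolding w_def by (rule the_equality) (use that uniq in auto)
  have relw: "rel b (w b)" if "b \<in> carrier G" for b using ex[OF that] w[OF that] by auto
  have "rel a 1" unfolding rel_def by (intro exI[of _ 1]) auto
  then have "w a = 1" using w ac by blast
  moreover have "w (x \<otimes> y) = w x + w y" if xy: "x \<in> carrier G" "y \<in> carrier G" for x y
  proof -
    obtain m n m' n' :: int where mn: "0 < m" "x [^] m = a [^] n" "w x = of_int n / of_int m"
      "0 < m'" "y [^] m' = a [^] n'" "w y = of_int n' / of_int m'" using relw xy unfolding rel_def by metis
    have "(x \<otimes> y) [^] (m * m') = (x [^] m) [^] m' \<otimes> (y [^] m') [^] m"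
      using xy by (simp add: int_pow_distrib int_pow_pow mult.commute)
    also have "\<dots> = a [^] (n * m' + n' * m)" unfolding mn(2,5) using ac by (simp add: int_pow_pow int_pow_mult)
    finally have "(x \<otimes> y) [^] (m * m') = a [^] (n * m' + n' * m)" .
    moreover have "0 < m * m'" using mn by simp
    moreover have "w x + w y = of_int (n * m' + n' * m) / of_int (m * m')" using mn by (simp add: add_frac_eq)
    ultimately have "rel (x \<otimes> y) (w x + w y)" unfolding rel_def by blast
    then show ?thesis using w xy by simp
  qed
  ultimately show ?thesis by (rule that)
qed

text \<open>
  If \<open>b\<^sup>m = a\<^sup>n\<close> then \<open>b \<otimes> q = b\<^sup>m \<otimes> (q / m) = a \<otimes> (n q / m)\<close>, so \<open>a \<otimes> 1\<close> spans the tensor product, and it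
  is not \<open>0\<close> because the weight relative to \<open>a\<close> is an additive function with value \<open>1\<close> at \<open>a\<close>.
\<close>
lemma (in left_ordered) commensurable_has_rank_one:
  assumes comm_group: "comm_group G" and a: "a \<in> P"
    and comm: "\<And>b. b \<in> P \<Longrightarrow> \<exists>m>0. \<exists>n>0. b [^] (m::nat) = a [^] (n::nat)"
  shows "has_rank G 1"
proof -
  interpret comm_group G by fact
  interpret V: vectorspace "class_ring :: rat ring" "tensor_Rat G" by (rule vectorspace_tensor_Rat[OF comm_group])
  have ac: "a \<in> carrier G" using a cone_carrier by blast
  let ?v = "tensor_class (frag_of (a, 1))"
  have vc: "?v \<in> carrier (tensor_Rat G)" unfolding carrier_tensor_Rat using tensor_free_closed(3)[OF ac] by blast
  obtain w :: "'a \<Rightarrow> rat" where w: "w a = 1" "\<And>x y. x \<in> carrier G \<Longrightarrow> y \<in> carrier G \<Longrightarrow> w (x \<otimes> y) = w x + w y"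
    using commensurable_weight[OF comm_group a comm] by blast
  have v0: "?v \<noteq> \<zero>\<^bsub>tensor_Rat G\<^esub>"
    unfolding zero_tensor_Rat using tensor_functional[of w a] w ac tensor_class_eq_zeroD by auto
  have posfrag: "\<exists>r. frag_of (b, q) - frag_of (a, r) \<in> tensor_kernel G" if b: "b \<in> P" for b q
  proof -
    have bc: "b \<in> carrier G" using b cone_carrier by blast
    obtain m n :: nat where mn: "0 < m" "b [^] m = a [^] n" using comm[OF b] by blast
    have "of_nat m * (q / of_nat m) = q" using mn(1) by simp
    then have "frag_of (a [^] n, q / of_nat m) - frag_of (b, q) \<in> tensor_kernel G"
      using tensor_pow[OF bc, of m "q / of_nat m"] mn(2) by simp
    from tensor_kernel_closed(4)[OF tensor_pow[OF ac, of n "q / of_nat m"] this]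
    show ?thesis by auto
  qed
  have combine: "x - y - frag_of (a, r - s) \<in> tensor_kernel G"
    if xy: "x - frag_of (a, r) \<in> tensor_kernel G" "y - frag_of (a, s) \<in> tensor_kernel G" for x y r s
  proof -
    have "frag_of (a, (r - s) + s) - (frag_of (a, r - s) + frag_of (a, s)) \<in> tensor_kernel G"
      by (rule tensor_kernel_relation(2)[OF ac])
    then have "frag_of (a, r) - (frag_of (a, r - s) + frag_of (a, s)) \<in> tensor_kernel G" by simp
    from tensor_kernel_closed(2)[OF tensor_kernel_closed(4)[OF xy] this]
    show ?thesis by (simp add: algebra_simps)
  qed
  have zerofrag: "0 - frag_of (a, 0) \<in> tensor_kernel G"
  proof -
    have "frag_of (a, 0 + 0) - (frag_of (a, 0) + frag_of (a, 0)) \<in> tensor_kernel G"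
      by (rule tensor_kernel_relation(2)[OF ac])
    then show ?thesis by simp
  qed
  have frag: "\<exists>r. frag_of (b, q) - frag_of (a, r) \<in> tensor_kernel G" if b: "b \<in> carrier G" for b q
  proof (rule cone_cases[OF b])
    assume "b \<in> P" then show ?thesis by (rule posfrag)
  next
    assume "b = \<one>"
    then have "frag_of (b, q) - frag_of (a, 0 * q) \<in> tensor_kernel G" using tensor_pow[OF ac, of 0 q] by simp
    then show ?thesis by blast
  next
    assume "inv b \<in> P"
    then obtain r where r: "frag_of (inv b, q) - frag_of (a, r) \<in> tensor_kernel G" using posfrag by blast
    have "frag_of (inv b \<otimes> b, q) - (frag_of (inv b, q) + frag_of (b, q)) \<in> tensor_kernel G"
      by (rule tensor_kernel_relation(1)) (use b in auto)
    then have 1: "frag_of (\<one>, q) - (frag_of (inv b, q) + frag_of (b, q)) \<in> tensor_kernel G" using b by simp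
    have 2: "frag_of (\<one>, q) - frag_of (a, 0) \<in> tensor_kernel G" using tensor_pow[OF ac, of 0 q] by simp
    have "frag_of (\<one>, q) - frag_of (inv b, q) - frag_of (a, 0 - r) \<in> tensor_kernel G" by (rule combine[OF 2 r])
    from tensor_kernel_closed(4)[OF this 1] show ?thesis by (intro exI[of _ "0 - r"]) simp
  qed
  have multiple: "\<exists>r. x - frag_of (a, r) \<in> tensor_kernel G" if x: "x \<in> carrier (tensor_free_group G)" for x
  proof (rule free_Abelian_group_induct[of x "carrier G \<times> UNIV"])
    show "Poly_Mapping.keys x \<subseteq> carrier G \<times> UNIV" using x by (simp only: tensor_free_group_simps)
    show "\<exists>r. 0 - frag_of (a, r) \<in> tensor_kernel G" using zerofrag by blast
    show "\<exists>r. y - z - frag_of (a, r) \<in> tensor_kernel G"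
      if "\<exists>r. y - frag_of (a, r) \<in> tensor_kernel G" "\<exists>r. z - frag_of (a, r) \<in> tensor_kernel G" for y z
      using that combine by blast
    show "\<exists>r. frag_of b - frag_of (a, r) \<in> tensor_kernel G" if "b \<in> carrier G \<times> UNIV" for b
      using that frag by auto
  qed
  have "V.span {?v} = carrier (tensor_Rat G)"
  proof
    show "V.span {?v} \<subseteq> carrier (tensor_Rat G)" by (rule V.span_is_subset2) (use vc in simp)
    show "carrier (tensor_Rat G) \<subseteq> V.span {?v}"
    proof
      fix X assume "X \<in> carrier (tensor_Rat G)"
      then obtain x where x: "x \<in> carrier (tensor_free_group G)" "X = tensor_class x" unfolding carrier_tensor_Rat by blast
      obtain r where "x - frag_of (a, r) \<in> tensor_kernel G" using multiple[OF x(1)] by blast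
      then have "X = tensor_class (frag_of (a, r))" using x(2) tensor_class_eqI by blast
      also have "\<dots> = r \<odot>\<^bsub>tensor_Rat G\<^esub> ?v" by (simp add: smult_tensor_Rat)
      also have "\<dots> = V.lincomb (\<lambda>_. r) {?v}" using vc V.smult_closed[of r ?v] by (simp add: V.lincomb_def)
      finally show "X \<in> V.span {?v}" unfolding V.span_def by (intro CollectI exI[of _ "\<lambda>_. r"] exI[of _ "{?v}"]) auto
    qed
  qed
  then have "V.dim = 1" "V.fin_dim" using V.dim1I[OF _ v0 vc] vc unfolding V.fin_dim_def by auto
  then show ?thesis by (simp add: has_rank_def)
qed

section \<open>The two souls of an isolated ordering\<close>

text \<open>
  A basic neighbourhood of \<open>P\<close> prescribes membership for finitely many elements \<open>g\<close>. Two cones that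
  contain the positive ones among these \<open>g\<close> and their inverses agree on all of them.
\<close>
lemma isolated_point_imp_isolated_cone:
  assumes G: "Group.group G" and iso: "isolated_point (LO_topology G) P"
  shows "isolated_cone G P"
proof -
  interpret Group.group G by fact
  let ?A = "carrier G" and ?f = "\<lambda>S. \<lambda>a\<in>carrier G. a \<in> S"
  let ?T = "product_topology (\<lambda>_. discrete_topology (UNIV :: bool set)) ?A"
  have P: "P \<in> LO G" and "openin (LO_topology G) {P}" using iso by (auto simp: isolated_point_def)
  then obtain U where U: "openin ?T U" "{P} = (?f -` U \<inter> Pow ?A) \<inter> LO G"
    unfolding LO_topology_def powerset_topology_def openin_subtopology openin_pullback_topology by auto
  interpret P: left_ordered G P by unfold_locales (rule P)
  have "?f P \<in> U" using U(2) by blast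
  then obtain W where W: "finite {i \<in> ?A. W i \<noteq> (UNIV :: bool set)}" "?f P \<in> Pi\<^sub>E ?A W" "Pi\<^sub>E ?A W \<subseteq> U"
    using U(1) unfolding openin_product_topology_alt by auto
  let ?J = "{i \<in> ?A. W i \<noteq> (UNIV :: bool set)}"
  define F where "F = (?J \<union> m_inv G ` ?J) \<inter> P"
  have "Q = P" if Q: "Q \<in> LO G" "F \<subseteq> Q" for Q
  proof -
    interpret Q: left_ordered G Q by unfold_locales (rule Q(1))
    have agree: "g \<in> Q \<longleftrightarrow> g \<in> P" if g: "g \<in> ?J" for g
    proof (rule P.cone_cases)
      show gc: "g \<in> carrier G" using g by blast
      show "g \<in> Q \<longleftrightarrow> g \<in> P" if "g \<in> P" using that g Q(2) by (auto simp: F_def)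
      show "g \<in> Q \<longleftrightarrow> g \<in> P" if "g = \<one>\<^bsub>G\<^esub>" using that P.one_notin_cone Q.one_notin_cone by simp
      show "g \<in> Q \<longleftrightarrow> g \<in> P" if i: "inv\<^bsub>G\<^esub> g \<in> P"
      proof -
        have "inv\<^bsub>G\<^esub> g \<in> Q" using i g Q(2) by (auto simp: F_def)
        then show ?thesis using Q.cone_inv[of "inv\<^bsub>G\<^esub> g"] P.cone_inv[OF i] gc by auto
      qed
    qed
    have "?f Q \<in> Pi\<^sub>E ?A W"
    proof (rule PiE_I)
      fix g assume g: "g \<in> ?A"
      show "?f Q g \<in> W g"
      proof (cases "W g = UNIV")
        case False
        then have eq: "?f Q g = ?f P g" using agree g by simp
        show ?thesis unfolding eq by (rule PiE_mem[OF W(2) g])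
      qed simp
    qed simp
    moreover have "Q \<subseteq> ?A" using Q.cone_carrier by blast
    ultimately have "Q \<in> {P}" unfolding U(2) using W(3) Q(1) by blast
    then show ?thesis by blast
  qed
  moreover have "finite F" "F \<subseteq> P" using W(1) by (auto simp: F_def)
  ultimately show ?thesis unfolding isolated_cone_def using P by blast
qed

context left_ordered
begin

lemma left_ordering_cone_ordering: "left_ordering G (cone_ordering G P)"
  using cone cone_ordering_positive_cone[OF is_group] unfolding LO_def by auto

lemma positive_cone_cone_ordering: "positive_cone G (cone_ordering G P) = P"
  using cone_carrier by (auto simp: positive_cone_def cone_ordering_def)

lemma convex_subgroup_iff: "convex_subgroup G (cone_ordering G P) C \<longleftrightarrow> cone_convex G P C"
proof
  assume C: "convex_subgroup G (cone_ordering G P) C"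
  then have sC: "subgroup C G" by (simp add: convex_subgroup_def)
  have "g \<in> C" if "c \<in> C" "g \<in> P" "inv g \<otimes> c \<in> P" for c g
  proof -
    have "(\<one>, g) \<in> cone_ordering G P" "(g, c) \<in> cone_ordering G P" "g \<in> carrier G"
      using that cone_carrier subgroup.mem_carrier[OF sC] by (auto simp: cone_ordering_def)
    then show ?thesis using C subgroup.one_closed[OF sC] that(1) unfolding convex_subgroup_def by blast
  qed
  then show "cone_convex G P C" using sC by (auto simp: cone_convex_def)
next
  assume C: "cone_convex G P C"
  interpret C: subgroup C G using C by (rule convex_subgroupD)
  have "g \<in> C" if f: "f \<in> C" and h: "h \<in> C" and g: "g \<in> carrier G"
    and less: "(f, g) \<in> cone_ordering G P" "(g, h) \<in> cone_ordering G P" for f g h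
  proof -
    have c: "f \<in> carrier G" "h \<in> carrier G" using f h C.mem_carrier by auto
    have "inv f \<otimes> g \<in> P" "inv g \<otimes> h \<in> P" using less by (auto simp: cone_ordering_def)
    moreover have "inv (inv f \<otimes> g) \<otimes> (inv f \<otimes> h) = inv g \<otimes> h" using c g by (simp add: word_simps)
    ultimately have "inv f \<otimes> g \<in> C" using convex_cone_memD[OF C, of "inv f \<otimes> h" "inv f \<otimes> g"] f h C.m_closed C.m_inv_closed by simp
    then have "f \<otimes> (inv f \<otimes> g) \<in> C" using f C.m_closed by blast
    then show ?thesis using c g by (simp add: inv_mult_cancel)
  qed
  then show "convex_subgroup G (cone_ordering G P) C"
    unfolding convex_subgroup_def using C.subgroup_axioms by blast
qed

lemma Restr_cone_ordering:
  assumes C: "subgroup C G"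
  shows "Restr (cone_ordering G P) C = cone_ordering (restricted G C) (P \<inter> C)"
  using inv_restricted[OF C] subgroup.mem_carrier[OF C] subgroup.m_closed[OF C] subgroup.m_inv_closed[OF C]
  by (auto simp: cone_ordering_def)

lemma Conradian_ordering_iff: "Conradian_ordering G (cone_ordering G P) \<longleftrightarrow> Conradian_cone G P"
  using left_ordering_cone_ordering cone_carrier
  unfolding Conradian_ordering_def positive_cone_cone_ordering Conradian_cone_def
  by (auto simp: cone_ordering_def)

lemma bi_ordering_imp_invariant:
  assumes bi: "bi_ordering G (cone_ordering G P)" and h: "h \<in> carrier G" and x: "x \<in> P"
  shows "h \<otimes> x \<otimes> inv h \<in> P"
proof -
  have xc: "x \<in> carrier G" using x cone_carrier by blast
  have "(\<one>, x) \<in> cone_ordering G P" using x xc by (simp add: cone_ordering_def)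
  then have "(\<one> \<otimes> inv h, x \<otimes> inv h) \<in> cone_ordering G P" using bi h xc unfolding bi_ordering_def by blast
  then show ?thesis using h xc by (simp add: cone_ordering_def m_assoc)
qed

lemma comm_group_bi_ordering:
  assumes "comm_group G"
  shows "bi_ordering G (cone_ordering G P)"
proof -
  interpret comm_group G by fact
  have "(g \<otimes> f, h \<otimes> f) \<in> cone_ordering G P"
    if c: "f \<in> carrier G" "g \<in> carrier G" "h \<in> carrier G" and gh: "(g, h) \<in> cone_ordering G P" for f g h
  proof -
    have "(f \<otimes> g, f \<otimes> h) \<in> cone_ordering G P"
      using left_ordering_cone_ordering c gh unfolding left_ordering_def by blast
    then show ?thesis using c by (simp add: m_comm)
  qed
  then show ?thesis using left_ordering_cone_ordering by (simp add: bi_ordering_def)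
qed

lemma smallest_convex_above:
  assumes fin: "finite {C. cone_convex G P C}" and N: "cone_convex G P N" "N \<noteq> carrier G"
  obtains D where "cone_convex G P D" "N \<subset> D" "\<And>C. cone_convex G P C \<Longrightarrow> N \<subset> C \<Longrightarrow> D \<subseteq> C"
proof -
  let ?S = "{C. cone_convex G P C \<and> N \<subset> C}"
  have "finite ?S" using fin by (rule rev_finite_subset) blast
  moreover have "carrier G \<in> ?S"
    using convex_carrier N subgroup.subset[OF convex_subgroupD[OF N(1)]] by blast
  ultimately obtain D where D: "D \<in> ?S" "\<And>C. C \<in> ?S \<Longrightarrow> C \<subseteq> D \<Longrightarrow> D = C"
    using finite_has_minimal[of ?S] by (metis empty_iff)
  have "D \<subseteq> C" if "cone_convex G P C" "N \<subset> C" for C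
    using convex_chain[of C D] D(1) D(2)[of C] that by blast
  then show ?thesis using that D(1) by blast
qed

lemma smallest_convex_simple:
  assumes D: "cone_convex G P D" and least: "\<And>C. cone_convex G P C \<Longrightarrow> {\<one>} \<subset> C \<Longrightarrow> D \<subseteq> C"
    and C: "cone_convex (restricted G D) (P \<inter> D) C"
  shows "C = {\<one>} \<or> C = D"
proof -
  have 1: "cone_convex G P C" "C \<subseteq> D" using convex_trans[OF D C] by auto
  have "\<one> \<in> C" using subgroup.one_closed[OF convex_subgroupD[OF 1(1)]] .
  then show ?thesis using least[OF 1(1)] 1(2) by blast
qed

text \<open>
  Let \<open>K\<close> be the smallest nontrivial convex subgroup, and suppose that \<open>K\<close> is proper. Together with the next
  convex subgroup \<open>D\<close> it forms a positive action with an isolated ordering, because the ordering is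
  invariant under conjugation.
\<close>
lemma isolated_invariant_simple:
  assumes iso: "isolated_cone G P" and inv: "\<And>h x. h \<in> carrier G \<Longrightarrow> x \<in> P \<Longrightarrow> h \<otimes> x \<otimes> inv h \<in> P"
    and C: "cone_convex G P C"
  shows "C = {\<one>} \<or> C = carrier G"
proof (rule ccontr)
  assume n: "\<not> ?thesis"
  note fin = finite_convex_subgroups[OF is_group iso]
  have oneC: "{\<one>} \<subset> C" using n subgroup.one_closed[OF convex_subgroupD[OF C]] by blast
  have CG: "C \<subset> carrier G" using n subgroup.subset[OF convex_subgroupD[OF C]] by blast
  have "{\<one>} \<noteq> carrier G" using oneC CG by blast
  then obtain K where K: "cone_convex G P K" "{\<one>} \<subset> K" and K_least: "\<And>D. cone_convex G P D \<Longrightarrow> {\<one>} \<subset> D \<Longrightarrow> K \<subseteq> D"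
    using smallest_convex_above[OF fin convex_one] by metis
  have "K \<noteq> carrier G" using K_least[OF C oneC] CG by blast
  then obtain D where D: "cone_convex G P D" "K \<subset> D" and D_least: "\<And>E. cone_convex G P E \<Longrightarrow> K \<subset> E \<Longrightarrow> D \<subseteq> E"
    using smallest_convex_above[OF fin K(1)] by metis
  have sK: "subgroup K G" and sD: "subgroup D G" using K D convex_subgroupD by auto
  let ?K = "restricted G K" and ?D = "restricted G D"
  interpret K: left_ordered ?K "P \<inter> K" by (rule restrict_cone[OF sK])
  interpret D: left_ordered ?D "P \<inter> D" by (rule restrict_cone[OF sD])
  have isoK: "isolated_cone ?K (P \<inter> K)" by (rule isolated_cone_restrict[OF is_group iso K(1)])
  have isoD: "isolated_cone ?D (P \<inter> D)" by (rule isolated_cone_restrict[OF is_group iso D(1)])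
  have simpleK: "E = {\<one>\<^bsub>?K\<^esub>} \<or> E = carrier ?K" if "cone_convex ?K (P \<inter> K) E" for E
    using smallest_convex_simple[OF K(1) K_least that] by simp
  have commK: "comm_group ?K"
    and rankK: "\<And>x y. x \<in> P \<inter> K \<Longrightarrow> y \<in> P \<inter> K \<Longrightarrow> \<exists>m>0. \<exists>n>0. x [^]\<^bsub>?K\<^esub> (m::nat) = y [^]\<^bsub>?K\<^esub> (n::nat)"
    using K.isolated_simple_rank_one[OF isoK simpleK] by auto
  have KD: "cone_convex ?D (P \<inter> D) K" using convex_restrict[OF K(1) sD] D(2) by blast
  have con: "Conradian_cone ?D (P \<inter> D)" by (rule Conradian_restrict[OF invariant_Conradian[OF inv] sD])
  have jump: "E = K \<or> E = carrier ?D" if "cone_convex ?D (P \<inter> D) E" "K \<subseteq> E" for E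
    using convex_trans[OF D(1) that(1)] D_least[of E] that(2) by auto
  have J: "K \<lhd> ?D"
    "\<And>x y. x \<in> carrier ?D \<Longrightarrow> y \<in> carrier ?D \<Longrightarrow> x \<otimes>\<^bsub>?D\<^esub> y \<otimes>\<^bsub>?D\<^esub> inv\<^bsub>?D\<^esub> x \<otimes>\<^bsub>?D\<^esub> inv\<^bsub>?D\<^esub> y \<in> K"
    "\<And>x y. x \<in> P \<inter> D - K \<Longrightarrow> y \<in> P \<inter> D - K \<Longrightarrow>
        \<exists>m>0. \<exists>n>0. inv\<^bsub>?D\<^esub> (y [^]\<^bsub>?D\<^esub> (n::nat)) \<otimes>\<^bsub>?D\<^esub> x [^]\<^bsub>?D\<^esub> (m::nat) \<in> K"
    using D.isolated_Conradian_jump[OF isoD con KD jump] by auto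
  interpret A: positive_action ?D "P \<inter> D" K
  proof (intro positive_action.intro positive_action_axioms.intro D.left_ordered_axioms KD J)
    show "x \<otimes>\<^bsub>?D\<^esub> y = y \<otimes>\<^bsub>?D\<^esub> x" if "x \<in> K" "y \<in> K" for x y
      using comm_groupE(4)[OF commK, of x y] that by simp
    show "\<exists>m>0. \<exists>n>0. x [^]\<^bsub>?D\<^esub> (m::nat) = y [^]\<^bsub>?D\<^esub> (n::nat)" if "x \<in> P \<inter> D \<inter> K" "y \<in> P \<inter> D \<inter> K" for x y
      using rankK[of x y] that by (simp add: nat_pow_def)
    show "h \<otimes>\<^bsub>?D\<^esub> k \<otimes>\<^bsub>?D\<^esub> inv\<^bsub>?D\<^esub> h \<in> P \<inter> D" if "h \<in> carrier ?D" "k \<in> P \<inter> D \<inter> K" for h k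
    proof -
      have "h \<in> D" using that by simp
      moreover have "h \<otimes> k \<otimes> inv h \<in> P" using inv[of h k] that subgroup.mem_carrier[OF sD] by simp
      ultimately show ?thesis
        using that subgroup.m_closed[OF sD] subgroup.m_inv_closed[OF sD] inv_restricted[OF sD] by simp
    qed
  qed
  show False using A.positive_action_not_isolated[OF isoD] K(2) D(2) by auto
qed

end

theorem theorem1p2:
  fixes G (structure) and P :: "'a set" and less :: "'a rel"
  assumes "group G"
    and "carrier G \<noteq> {\<one>}"
    and "P \<in> LO G"
    and "isolated_point (LO_topology G) P"
    and "less = cone_ordering G P"
  shows "comm_group (G\<lparr>carrier := bi_ordered_soul G less\<rparr>)
       \<and> has_rank (G\<lparr>carrier := bi_ordered_soul G less\<rparr>) 1
       \<and> Conradian_soul G less \<noteq> {\<one>}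
       \<and> finite {r. left_ordering (G\<lparr>carrier := Conradian_soul G less\<rparr>) r}"
proof -
  interpret left_ordered G P using assms(1,3) by (simp add: left_ordered_def left_ordered_axioms_def)
  have iso: "isolated_cone G P" by (rule isolated_point_imp_isolated_cone[OF assms(1,4)])
  note less = \<open>less = cone_ordering G P\<close>
  have lo: "left_ordering G less" unfolding less by (rule left_ordering_cone_ordering)
  note fin = finite_convex_subgroups[OF is_group iso]
  have one_ne: "{\<one>} \<noteq> carrier G" using assms(2) by blast
  obtain K where K: "cone_convex G P K" "{\<one>} \<subset> K" and K_least: "\<And>D. cone_convex G P D \<Longrightarrow> {\<one>} \<subset> D \<Longrightarrow> K \<subseteq> D"
    using smallest_convex_above[OF fin convex_one one_ne] by metis
  have sK: "subgroup K G" using K convex_subgroupD by blast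
  let ?K = "restricted G K"
  interpret K: left_ordered ?K "P \<inter> K" by (rule restrict_cone[OF sK])
  have "E = {\<one>\<^bsub>?K\<^esub>} \<or> E = carrier ?K" if "cone_convex ?K (P \<inter> K) E" for E
    using smallest_convex_simple[OF K(1) K_least that] by simp
  from K.isolated_simple_rank_one(1)[OF isolated_cone_restrict[OF is_group iso K(1)] this]
  have "bi_ordering ?K (cone_ordering ?K (P \<inter> K))" by (rule K.comm_group_bi_ordering)
  then have K_bi: "bi_ordering ?K (Restr less K)" unfolding less Restr_cone_ordering[OF sK] .
  have K_convex: "convex_subgroup G less K" unfolding less convex_subgroup_iff by (rule K(1))

  \<comment> \<open>The largest bi-ordered convex subgroup contains \<open>K\<close>, and has no proper nontrivial convex subgroup.\<close>
  define B where "B = bi_ordered_soul G less"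
  have KB: "K \<subseteq> B" unfolding B_def by (rule bi_ordered_soul(3)[OF is_group lo K_convex K_bi])
  have Bc: "cone_convex G P B"
    using bi_ordered_soul(1)[OF is_group lo] unfolding less convex_subgroup_iff B_def .
  have sB: "subgroup B G" by (rule convex_subgroupD[OF Bc])
  let ?B = "restricted G B"
  interpret B: left_ordered ?B "P \<inter> B" by (rule restrict_cone[OF sB])
  have isoB: "isolated_cone ?B (P \<inter> B)" by (rule isolated_cone_restrict[OF is_group iso Bc])
  have B_restr: "Restr less B = cone_ordering ?B (P \<inter> B)" unfolding less by (rule Restr_cone_ordering[OF sB])
  have B_bi: "bi_ordering ?B (cone_ordering ?B (P \<inter> B))"
    using bi_ordered_soul(2)[OF is_group lo, folded B_def] unfolding B_restr .
  note B_inv = B.bi_ordering_imp_invariant[OF B_bi]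
  note rankB = B.isolated_simple_rank_one[OF isoB B.isolated_invariant_simple[OF isoB B_inv]]
  have "{\<one>} \<subset> B" using K(2) KB by blast
  then obtain a where a: "a \<in> P" "a \<in> B" by (rule convex_pos_diff[OF triv_subgroup sB])
  have rank1: "has_rank ?B 1"
    by (rule B.commensurable_has_rank_one[OF rankB(1), of a]) (use a rankB(2) in auto)

  \<comment> \<open>Bi-orderings are Conradian, so the Conradian soul contains \<open>B\<close>.\<close>
  define S where "S = Conradian_soul G less"
  have B_con: "Conradian_ordering ?B (Restr less B)"
    unfolding B_restr B.Conradian_ordering_iff by (rule B.invariant_Conradian[OF B_inv])
  have "convex_subgroup G less B" unfolding less convex_subgroup_iff by (rule Bc)
  then have BS: "B \<subseteq> S" unfolding S_def by (rule Conradian_soul(3)[OF is_group lo _ B_con])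
  have Sc: "cone_convex G P S"
    using Conradian_soul(1)[OF is_group lo] unfolding less convex_subgroup_iff S_def .
  have sS: "subgroup S G" by (rule convex_subgroupD[OF Sc])
  let ?S = "restricted G S"
  interpret S: left_ordered ?S "P \<inter> S" by (rule restrict_cone[OF sS])
  have S_restr: "Restr less S = cone_ordering ?S (P \<inter> S)" unfolding less by (rule Restr_cone_ordering[OF sS])
  have S_con: "Conradian_cone ?S (P \<inter> S)"
    using Conradian_soul(2)[OF is_group lo, folded S_def] unfolding S_restr S.Conradian_ordering_iff .
  have finS: "finite (LO ?S)"
    using isolated_Conradian_rigid[OF S.is_group isolated_cone_restrict[OF is_group iso Sc] S_con] by blast
  have "{r. left_ordering ?S r} \<subseteq> cone_ordering ?S ` LO ?S"
  proof
    fix r assume "r \<in> {r. left_ordering ?S r}"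
    then have r: "left_ordering ?S r" by simp
    then have "positive_cone ?S r \<in> LO ?S" by (auto simp: LO_def)
    then show "r \<in> cone_ordering ?S ` LO ?S" using cone_ordering_positive_cone[OF S.is_group r] by force
  qed
  then have "finite {r. left_ordering ?S r}" using finS finite_surj by blast
  moreover have "S \<noteq> {\<one>}" using \<open>{\<one>} \<subset> B\<close> BS by blast
  ultimately show ?thesis using rankB(1) rank1 unfolding B_def S_def by blast
qed

end
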